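(* If $G$ and $H$ are groups such that $G\equiv^{\mathrm{bf}}_\omega H$ (that is, $G$ and $H$ are $\omega$-back-and-forth-equivalent), then $L(G)$ and $L(H)$ are elementarily equivalent tracial von Neumann algebras.
   Context: Back-and-forth relations. Groups are (discrete) first-order structures in the language of groups (multiplication, inverse, identity). Given structures $M,N$ in the same classical language, finite tuples $\vec a$ from $M$ and $\vec b$ from $N$ of the same length, and an ordinal $\alpha$, define $(M,\vec a)\equiv^{\mathrm{bf}}_\alpha(N,\vec b)$ by recursion on $\alpha$. For $\alpha=0$: for every quantifier-free formula $\varphi(\vec x)$, $M\models\varphi(\vec a)\Leftrightarrow N\models\varphi(\vec b)$. For $\alpha>0$: for every $\beta<\alpha$ and every finite tuple $\vec c$ from $M$ (of arbitrary length) there is a finite tuple $\vec d$ from $N$ with $(M,\vec a,\vec c)\equiv^{\mathrm{bf}}_\beta(N,\vec b,\vec d)$, and for every $\beta<\alpha$ and every finite tuple $\vec d$ from $N$ there is a finite tuple $\vec c$ from $M$ with $(M,\vec a,\vec c)\equiv^{\mathrm{bf}}_\beta(N,\vec b,\vec d)$. Write $M\equiv^{\mathrm{bf}}_\alpha N$ if $(M,\varnothing)\equiv^{\mathrm{bf}}_\alpha(N,\varnothing)$. Group von Neumann algebra. For $g\in G$ let $u_g$ be the unitary on $\ell^2(G)$ with $u_g(\delta_h)=\delta_{gh}$. $\mathbb C[G]$ is identified with the span of the $u_g$ in $\mathcal B(\ell^2(G))$; $L(G)$ is its closure in the strong operator topology, with trace $\operatorname{tr}(x)=\langle x\delta_e,\delta_e\rangle$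 and $\|x\|_2=\sqrt{\operatorname{tr}(x^*x)}$. Metric structures. A tracial von Neumann algebra is viewed as a many-sorted metric structure: its sorts are the operator norm balls of integer radius, with metric induced by $\|\cdot\|_2$; the function symbols are the restrictions to these balls of addition, multiplication, scalar multiplication (by each complex scalar) and adjoint, together with the inclusion maps between balls; there are constants $0,1$ in the unit ball. Two metric structures $M,N$ in the same language are elementarily equivalent if $\sigma^M=\sigma^N$ for every (finitary) continuous first-order sentence $\sigma$ of the language. *)

theory Defs
  imports "HOL-Analysis.Analysis" "HOL-Algebra.Group"
begin

section \<open>Back-and-forth equivalence of groups\<close>

datatype group_term =
    GVar nat
  | GOne
  | GInv group_term
  | GMult group_term group_term

datatype group_qf =
    GEq group_term group_term
  | GNot group_qf
  | GAnd group_qf group_qf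
  | GOr group_qf group_qf

primrec group_term_vars :: "group_term \<Rightarrow> nat set" where
  "group_term_vars (GVar i) = {i}"
| "group_term_vars GOne = {}"
| "group_term_vars (GInv t) = group_term_vars t"
| "group_term_vars (GMult s t) = group_term_vars s \<union> group_term_vars t"

primrec group_qf_vars :: "group_qf \<Rightarrow> nat set" where
  "group_qf_vars (GEq s t) = group_term_vars s \<union> group_term_vars t"
| "group_qf_vars (GNot \<phi>) = group_qf_vars \<phi>"
| "group_qf_vars (GAnd \<phi> \<psi>) = group_qf_vars \<phi> \<union> group_qf_vars \<psi>"
| "group_qf_vars (GOr \<phi> \<psi>) = group_qf_vars \<phi> \<union> group_qf_vars \<psi>"

primrec group_term_val :: "('a, 'm) monoid_scheme \<Rightarrow> 'a list \<Rightarrow> group_term \<Rightarrow> 'a" where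
  "group_term_val G as (GVar i) = as ! i"
| "group_term_val G as GOne = \<one>\<^bsub>G\<^esub>"
| "group_term_val G as (GInv t) = inv\<^bsub>G\<^esub> group_term_val G as t"
| "group_term_val G as (GMult s t) = group_term_val G as s \<otimes>\<^bsub>G\<^esub> group_term_val G as t"

primrec group_qf_holds :: "('a, 'm) monoid_scheme \<Rightarrow> 'a list \<Rightarrow> group_qf \<Rightarrow> bool" where
  "group_qf_holds G as (GEq s t) \<longleftrightarrow> group_term_val G as s = group_term_val G as t"
| "group_qf_holds G as (GNot \<phi>) \<longleftrightarrow> \<not> group_qf_holds G as \<phi>"
| "group_qf_holds G as (GAnd \<phi> \<psi>) \<longleftrightarrow> group_qf_holds G as \<phi> \<and> group_qf_holds G as \<psi>"
| "group_qf_holds G as (GOr \<phi> \<psi>) \<longleftrightarrow> group_qf_holds G as \<phi> \<or> group_qf_holds G as \<psi>"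

definition same_qf_type ::
    "('a, 'm) monoid_scheme \<Rightarrow> 'a list \<Rightarrow> ('b, 'n) monoid_scheme \<Rightarrow> 'b list \<Rightarrow> bool" where
  "same_qf_type G as H bs \<longleftrightarrow>
    (\<forall>\<phi>. group_qf_vars \<phi> \<subseteq> {..<length as} \<longrightarrow> (group_qf_holds G as \<phi> \<longleftrightarrow> group_qf_holds H bs \<phi>))"

text \<open>
  An ordinal is represented by an element of an arbitrary well-ordered type, namely as the
  order type of the set of its predecessors; so the least element of the type plays the role
  of the ordinal 0. The tuples \<open>as\<close>, \<open>bs\<close> are meant to have the same length, which is
  why the answering tuple must have the length of the tuple played.
\<close>

function bf_equiv :: "'o::wellorder \<Rightarrow>
    ('a, 'm) monoid_scheme \<Rightarrow> 'a list \<Rightarrow> ('b, 'n) monoid_scheme \<Rightarrow> 'b list \<Rightarrow> bool" where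
  "bf_equiv \<alpha> G as H bs \<longleftrightarrow>
    (if \<forall>\<beta>. \<alpha> \<le> \<beta> then same_qf_type G as H bs
     else (\<forall>\<beta>. \<beta> < \<alpha> \<longrightarrow>
        (\<forall>cs\<in>lists (carrier G). \<exists>ds\<in>lists (carrier H).
            length ds = length cs \<and> bf_equiv \<beta> G (as @ cs) H (bs @ ds)) \<and>
        (\<forall>ds\<in>lists (carrier H). \<exists>cs\<in>lists (carrier G).
            length cs = length ds \<and> bf_equiv \<beta> G (as @ cs) H (bs @ ds))))"
  by pat_completeness auto
termination
  by (relation "inv_image {(\<beta>, \<alpha>). \<beta> < \<alpha>} fst") (auto intro: wf)

declare bf_equiv.simps [simp del]

text \<open>
  In \<^typ>\<open>enat\<close> the predecessors of \<open>\<infinity>\<close> are exactly the natural numbers, so \<open>\<infinity>\<close> is \<open>\<omega>\<close>.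
\<close>

definition bf_omega_equiv :: "('a, 'm) monoid_scheme \<Rightarrow> ('b, 'n) monoid_scheme \<Rightarrow> bool" where
  "bf_omega_equiv G H \<longleftrightarrow> bf_equiv (\<infinity>::enat) G [] H []"


section \<open>Bounded operators on the Hilbert space of square-summable functions\<close>

text \<open>
  Elements of $\ell^2(A)$ are functions on the whole type that vanish outside \<open>A\<close>; an operator
  on it is a function on all of \<^typ>\<open>'a \<Rightarrow> complex\<close> that is 0 at arguments outside $\ell^2(A)$,
  so that equality of operators is equality of functions.
\<close>

definition l2 :: "'a set \<Rightarrow> ('a \<Rightarrow> complex) set" where
  "l2 A = {f. (\<forall>x. x \<notin> A \<longrightarrow> f x = 0) \<and> (\<lambda>x. (cmod (f x))\<^sup>2) summable_on A}"

definition l2_inner :: "'a set \<Rightarrow> ('a \<Rightarrow> complex) \<Rightarrow> ('a \<Rightarrow> complex) \<Rightarrow> complex" where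
  "l2_inner A f g = (\<Sum>\<^sub>\<infinity>x\<in>A. f x * cnj (g x))"

definition l2_norm :: "'a set \<Rightarrow> ('a \<Rightarrow> complex) \<Rightarrow> real" where
  "l2_norm A f = sqrt (\<Sum>\<^sub>\<infinity>x\<in>A. (cmod (f x))\<^sup>2)"

type_synonym 'a operator = "('a \<Rightarrow> complex) \<Rightarrow> 'a \<Rightarrow> complex"

definition bounded_operators :: "'a set \<Rightarrow> 'a operator set" where
  "bounded_operators A = {T.
     (\<forall>f\<in>l2 A. T f \<in> l2 A) \<and>
     (\<forall>f. f \<notin> l2 A \<longrightarrow> T f = (\<lambda>x. 0)) \<and>
     (\<forall>f\<in>l2 A. \<forall>g\<in>l2 A. T (\<lambda>x. f x + g x) = (\<lambda>x. T f x + T g x)) \<and>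
     (\<forall>c. \<forall>f\<in>l2 A. T (\<lambda>x. c * f x) = (\<lambda>x. c * T f x)) \<and>
     (\<exists>K. \<forall>f\<in>l2 A. l2_norm A (T f) \<le> K * l2_norm A f)}"

definition operator_norm :: "'a set \<Rightarrow> 'a operator \<Rightarrow> real" where
  "operator_norm A T = (SUP f\<in>{f \<in> l2 A. l2_norm A f \<le> 1}. l2_norm A (T f))"

definition adjoint_op :: "'a set \<Rightarrow> 'a operator \<Rightarrow> 'a operator" where
  "adjoint_op A T = (THE S. S \<in> bounded_operators A \<and>
     (\<forall>f\<in>l2 A. \<forall>g\<in>l2 A. l2_inner A (T f) g = l2_inner A f (S g)))"

definition identity_op :: "'a set \<Rightarrow> 'a operator" where
  "identity_op A = (\<lambda>f. if f \<in> l2 A then f else (\<lambda>x. 0))"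

definition strong_operator_topology :: "'a set \<Rightarrow> 'a operator topology" where
  "strong_operator_topology A = topology_generated_by
     {{T \<in> bounded_operators A. l2_norm A (\<lambda>x. T f x - S f x) < \<epsilon>} | S f \<epsilon>.
        S \<in> bounded_operators A \<and> f \<in> l2 A \<and> \<epsilon> > 0}"


section \<open>The group von Neumann algebra\<close>

definition left_regular :: "('a, 'm) monoid_scheme \<Rightarrow> 'a \<Rightarrow> 'a operator" where
  "left_regular G g = (\<lambda>f. if f \<in> l2 (carrier G)
     then (\<lambda>h. if h \<in> carrier G then f (inv\<^bsub>G\<^esub> g \<otimes>\<^bsub>G\<^esub> h) else 0) else (\<lambda>h. 0))"

lemma indicator_in_l2: "h \<in> A \<Longrightarrow> indicator {h} \<in> l2 A"
proof -
  assume h: "h \<in> A"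
  have "(\<lambda>x. (cmod (indicator {h} x))\<^sup>2) summable_on {h}"
    by simp
  then have "(\<lambda>x. (cmod (indicator {h} x))\<^sup>2) summable_on A"
    by (rule summable_on_cong_neutral [THEN iffD1, rotated -1])
      (use h in \<open>auto simp: indicator_def\<close>)
  then show ?thesis
    using h by (auto simp: l2_def indicator_def)
qed

lemma left_regular_indicator:
  assumes "group G" "g \<in> carrier G" "h \<in> carrier G"
  shows "left_regular G g (indicator {h}) = indicator {g \<otimes>\<^bsub>G\<^esub> h}"
proof -
  interpret group G by fact
  have eq: "inv\<^bsub>G\<^esub> g \<otimes>\<^bsub>G\<^esub> x = h \<longleftrightarrow> x = g \<otimes>\<^bsub>G\<^esub> h" if "x \<in> carrier G" for x
    using assms that by (metis inv_solve_left m_closed)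
  show ?thesis
    using indicator_in_l2 [OF assms(3)] assms
    by (auto simp: left_regular_def indicator_def fun_eq_iff eq)
qed

definition group_algebra :: "('a, 'm) monoid_scheme \<Rightarrow> 'a operator set" where
  "group_algebra G = {\<lambda>f x. \<Sum>g\<in>F. c g * left_regular G g f x | F c. finite F \<and> F \<subseteq> carrier G}"

definition group_vN_algebra :: "('a, 'm) monoid_scheme \<Rightarrow> 'a operator set" where
  "group_vN_algebra G = strong_operator_topology (carrier G) closure_of group_algebra G"

definition group_trace :: "('a, 'm) monoid_scheme \<Rightarrow> 'a operator \<Rightarrow> complex" where
  "group_trace G T = l2_inner (carrier G) (T (indicator {\<one>\<^bsub>G\<^esub>})) (indicator {\<one>\<^bsub>G\<^esub>})"


section \<open>Many-sorted continuous logic\<close>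

text \<open>
  The metric is the only predicate symbol. A variable is a pair of a sort and an index.
\<close>

record ('s, 'f) metric_language =
  sorts :: "'s set"
  funs :: "'f set"
  fun_dom :: "'f \<Rightarrow> 's list"
  fun_rng :: "'f \<Rightarrow> 's"

record ('s, 'f, 'x) metric_structure =
  universe :: "'s \<Rightarrow> 'x set"
  mdist :: "'s \<Rightarrow> 'x \<Rightarrow> 'x \<Rightarrow> real"
  interp :: "'f \<Rightarrow> 'x list \<Rightarrow> 'x"

datatype ('s, 'f) mterm =
    MVar 's nat
  | MApp 'f "('s, 'f) mterm list"

datatype ('s, 'f) mformula =
    MDist 's "('s, 'f) mterm" "('s, 'f) mterm"
  | MConn "(nat \<Rightarrow> real) \<Rightarrow> real" "('s, 'f) mformula list"
  | MSup 's nat "('s, 'f) mformula"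
  | MInf 's nat "('s, 'f) mformula"

fun mterm_sort :: "('s, 'f) metric_language \<Rightarrow> ('s, 'f) mterm \<Rightarrow> 's" where
  "mterm_sort L (MVar s i) = s"
| "mterm_sort L (MApp f ts) = fun_rng L f"

fun wf_mterm :: "('s, 'f) metric_language \<Rightarrow> ('s, 'f) mterm \<Rightarrow> bool" where
  "wf_mterm L (MVar s i) \<longleftrightarrow> s \<in> sorts L"
| "wf_mterm L (MApp f ts) \<longleftrightarrow>
    f \<in> funs L \<and> (\<forall>t\<in>set ts. wf_mterm L t) \<and> map (mterm_sort L) ts = fun_dom L f"

fun mterm_vars :: "('s, 'f) mterm \<Rightarrow> ('s \<times> nat) set" where
  "mterm_vars (MVar s i) = {(s, i)}"
| "mterm_vars (MApp f ts) = (\<Union>t\<in>set ts. mterm_vars t)"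

text \<open>The connectives are all continuous functions from $\mathbb{R}^n$ to $\mathbb{R}$.\<close>

fun wf_mformula :: "('s, 'f) metric_language \<Rightarrow> ('s, 'f) mformula \<Rightarrow> bool" where
  "wf_mformula L (MDist s t t') \<longleftrightarrow>
    wf_mterm L t \<and> wf_mterm L t' \<and> mterm_sort L t = s \<and> mterm_sort L t' = s"
| "wf_mformula L (MConn u \<phi>s) \<longleftrightarrow>
    continuous_map (powertop_real {..<length \<phi>s}) euclideanreal u \<and> (\<forall>\<phi>\<in>set \<phi>s. wf_mformula L \<phi>)"
| "wf_mformula L (MSup s i \<phi>) \<longleftrightarrow> s \<in> sorts L \<and> wf_mformula L \<phi>"
| "wf_mformula L (MInf s i \<phi>) \<longleftrightarrow> s \<in> sorts L \<and> wf_mformula L \<phi>"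

fun mformula_free :: "('s, 'f) mformula \<Rightarrow> ('s \<times> nat) set" where
  "mformula_free (MDist s t t') = mterm_vars t \<union> mterm_vars t'"
| "mformula_free (MConn u \<phi>s) = (\<Union>\<phi>\<in>set \<phi>s. mformula_free \<phi>)"
| "mformula_free (MSup s i \<phi>) = mformula_free \<phi> - {(s, i)}"
| "mformula_free (MInf s i \<phi>) = mformula_free \<phi> - {(s, i)}"

definition msentence :: "('s, 'f) metric_language \<Rightarrow> ('s, 'f) mformula \<Rightarrow> bool" where
  "msentence L \<sigma> \<longleftrightarrow> wf_mformula L \<sigma> \<and> mformula_free \<sigma> = {}"

fun mterm_val :: "('s, 'f, 'x) metric_structure \<Rightarrow> ('s \<times> nat \<Rightarrow> 'x) \<Rightarrow> ('s, 'f) mterm \<Rightarrow> 'x" where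
  "mterm_val M v (MVar s i) = v (s, i)"
| "mterm_val M v (MApp f ts) = interp M f (map (mterm_val M v) ts)"

fun mformula_val ::
    "('s, 'f, 'x) metric_structure \<Rightarrow> ('s \<times> nat \<Rightarrow> 'x) \<Rightarrow> ('s, 'f) mformula \<Rightarrow> real" where
  "mformula_val M v (MDist s t t') = mdist M s (mterm_val M v t) (mterm_val M v t')"
| "mformula_val M v (MConn u \<phi>s) =
    u (\<lambda>i\<in>{..<length \<phi>s}. map (mformula_val M v) \<phi>s ! i)"
| "mformula_val M v (MSup s i \<phi>) = (SUP x\<in>universe M s. mformula_val M (v((s, i) := x)) \<phi>)"
| "mformula_val M v (MInf s i \<phi>) = (INF x\<in>universe M s. mformula_val M (v((s, i) := x)) \<phi>)"

text \<open>The value of a sentence does not depend on the assignment, so any one may be used.\<close>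

definition msentence_val :: "('s, 'f, 'x) metric_structure \<Rightarrow> ('s, 'f) mformula \<Rightarrow> real" where
  "msentence_val M \<sigma> = mformula_val M (\<lambda>_. undefined) \<sigma>"

definition elementarily_equivalent ::
    "('s, 'f) metric_language \<Rightarrow> ('s, 'f, 'x) metric_structure \<Rightarrow> ('s, 'f, 'y) metric_structure \<Rightarrow> bool" where
  "elementarily_equivalent L M N \<longleftrightarrow> (\<forall>\<sigma>. msentence L \<sigma> \<longrightarrow> msentence_val M \<sigma> = msentence_val N \<sigma>)"


section \<open>Tracial von Neumann algebras as metric structures\<close>

text \<open>
  The sort \<open>n\<close>, for a positive integer \<open>n\<close>, is the closed operator norm ball of radius \<open>n\<close>.
  The numerical parameters of a symbol are the radii of the balls it acts on; for
  \<open>VIncl m n\<close> they are the radii of source and target. Scalar multiplication by \<open>c\<close> on the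
  ball of radius \<open>n\<close> has as target the smallest ball of positive integer radius at least
  \<open>cmod c * n\<close>.
\<close>

datatype vN_fun =
    VZero
  | VOne
  | VAdd nat nat
  | VMult nat nat
  | VScale complex nat
  | VAdj nat
  | VIncl nat nat

primrec vN_dom :: "vN_fun \<Rightarrow> nat list" where
  "vN_dom VZero = []"
| "vN_dom VOne = []"
| "vN_dom (VAdd m n) = [m, n]"
| "vN_dom (VMult m n) = [m, n]"
| "vN_dom (VScale c n) = [n]"
| "vN_dom (VAdj n) = [n]"
| "vN_dom (VIncl m n) = [m]"

primrec vN_rng :: "vN_fun \<Rightarrow> nat" where
  "vN_rng VZero = 1"
| "vN_rng VOne = 1"
| "vN_rng (VAdd m n) = m + n"
| "vN_rng (VMult m n) = m * n"
| "vN_rng (VScale c n) = max 1 (nat \<lceil>cmod c * real n\<rceil>)"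
| "vN_rng (VAdj n) = n"
| "vN_rng (VIncl m n) = n"

definition vN_language :: "(nat, vN_fun) metric_language" where
  "vN_language = \<lparr>
     sorts = {n. n > 0},
     funs = {f. (\<forall>n\<in>set (vN_dom f). n > 0) \<and> (\<forall>m n. f = VIncl m n \<longrightarrow> m \<le> n)},
     fun_dom = vN_dom,
     fun_rng = vN_rng\<rparr>"

primrec vN_interp :: "'a set \<Rightarrow> vN_fun \<Rightarrow> 'a operator list \<Rightarrow> 'a operator" where
  "vN_interp A VZero xs = (\<lambda>f x. 0)"
| "vN_interp A VOne xs = identity_op A"
| "vN_interp A (VAdd m n) xs = (\<lambda>f x. (xs ! 0) f x + (xs ! 1) f x)"
| "vN_interp A (VMult m n) xs = (xs ! 0) \<circ> (xs ! 1)"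
| "vN_interp A (VScale c n) xs = (\<lambda>f x. c * (xs ! 0) f x)"
| "vN_interp A (VAdj n) xs = adjoint_op A (xs ! 0)"
| "vN_interp A (VIncl m n) xs = xs ! 0"

definition two_norm :: "'a set \<Rightarrow> ('a operator \<Rightarrow> complex) \<Rightarrow> 'a operator \<Rightarrow> real" where
  "two_norm A \<tau> T = sqrt (Re (\<tau> (adjoint_op A T \<circ> T)))"

text \<open>
  Here \<open>R\<close> is a von Neumann algebra of operators on $\ell^2(A)$ with trace \<open>\<tau>\<close>.
\<close>

definition tracial_structure ::
    "'a set \<Rightarrow> 'a operator set \<Rightarrow> ('a operator \<Rightarrow> complex) \<Rightarrow> (nat, vN_fun, 'a operator) metric_structure" where
  "tracial_structure A R \<tau> = \<lparr>
     universe = (\<lambda>n. {T \<in> R. operator_norm A T \<le> real n}),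
     mdist = (\<lambda>n S T. two_norm A \<tau> (\<lambda>f x. S f x - T f x)),
     interp = vN_interp A\<rparr>"

definition group_vN_structure ::
    "('a, 'm) monoid_scheme \<Rightarrow> (nat, vN_fun, 'a operator) metric_structure" where
  "group_vN_structure G = tracial_structure (carrier G) (group_vN_algebra G) (group_trace G)"

end

theory Submission
  imports Defs "HOL-Library.Function_Algebras"
begin

text \<open>
  The point is that sentences about $L(G)$ can be evaluated on the group algebra
  $\mathbb{C}[G]$, and that elements of $\mathbb{C}[G]$ can be copied to $\mathbb{C}[H]$ by
  playing the game.

  A finite list of coefficients and group terms, evaluated at a tuple \<open>as\<close> of $G$, gives an
  element $x = \sum_i c_i u_{t_i(as)}$ of $\mathbb{C}[G]$, and evaluated at a tuple \<open>bs\<close> of $H$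
  it gives an element of $\mathbb{C}[H]$. Its 2-norm is determined by
  $\|x\|_2^2 = \sum c_i \overline{c_j}$, the sum being over the pairs with
  $t_i(as) = t_j(as)$, hence by the quantifier-free type of \<open>as\<close> (\<open>norm2_formal_val_transfer\<close>).
  The operator norm is the supremum of $\|x y\|_2 / \|y\|_2$ over $y \in \mathbb{C}[G]$, and such a
  \<open>y\<close> is named by finitely many further group elements, so the operator norm is preserved as soon
  as one more move can be played (\<open>op_le_formal_val_transfer\<close>). Algebraic operations act on the
  formal lists. It follows by induction on a formula of quantifier rank less than \<open>n\<close> that its
  values at corresponding elements agree whenever the tuples are \<open>n\<close>-equivalent
  (\<open>formula_transfer\<close>): a quantifier costs one move.

  In the quantifier step the supremum is over the whole ball of $L(G)$. It is replaced by the
  supremum over the ball of $\mathbb{C}[G]$ by means of two facts. Formulas are uniformly continuous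
  in the 2-norm on balls (\<open>uniform_envelope.formula_uniform\<close>), and the ball of $\mathbb{C}[G]$ is
  2-norm dense in that of $L(G)$ (\<open>group.Kaplansky_density\<close>).

  The density theorem is proved without functional calculus. Let $\|T\| \le \rho < 1$. The map
  $S \mapsto (T + S S^* T)/2$ contracts, so there is \<open>S\<close> with $\|S\| \le 1$ and
  $2 S \approx T + S S^* T$, that is, $T \approx 2 (1 + S S^*)^{-1} S$. Choose
  $x \in \mathbb{C}[G]$ close to \<open>S\<close> in the 2-norm, with no control on its operator norm, and
  $y \in \mathbb{C}[G]$ with $(1 + x x^*) y \approx 2 x$ in operator norm. The identity
  $(1 + x x^*)(y - T) \approx 2 (x - S) + (S S^* - x x^*) T$ and the elementary estimate
  \<open>l2_coercive\<close>, that $g + x x^* g = u + x w$ implies $\|g\| \le \|u\| + \|w\|/2$,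
  give both $\|y\| \le 1 + \eta$ and the smallness of $\|y - T\|_2$.

  All operators live in the commutant of the right translations. It is visibly closed under the
  algebraic operations and contains $L(G)$, and the 2-norm on it has the trace properties
  $\|T^*\|_2 = \|T\|_2$ and $\|T S\|_2 \le \|S\| \|T\|_2$.
\<close>

section \<open>The Hilbert space of square-summable functions\<close>

text \<open>
  Scalar multiples of complex functions. Sums and differences of functions, and of operators, are
  the pointwise ones.
\<close>

definition smul :: "complex \<Rightarrow> ('x \<Rightarrow> complex) \<Rightarrow> 'x \<Rightarrow> complex" where
  "smul c f = (\<lambda>x. c * f x)"

text \<open>
The standard basis vectors of $\ell^2$.
\<close>

abbreviation delta :: "'a \<Rightarrow> 'a \<Rightarrow> complex" where
  "delta a \<equiv> indicator {a}"

lemma smul_apply [simp]: "smul c f x = c * f x"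
  by (simp add: smul_def)

lemma smul_simps [simp]: "smul 1 f = f" "smul 0 f = 0" "smul c 0 = 0" "smul c (smul d f) = smul (c * d) f"
  by (auto simp: fun_eq_iff)

lemma smul_add: "smul c (f + g) = smul c f + smul c g" and smul_diff: "smul c (f - g) = smul c f - smul c g"
  by (auto simp: fun_eq_iff algebra_simps)

lemma sum_fun_apply: "sum f I x = (\<Sum>i\<in>I. f i x)"
  by (induction I rule: infinite_finite_induct) auto

lemma l2_zero [simp, intro]: "0 \<in> l2 A"
  by (auto simp: l2_def)

lemma l2_smul [simp, intro]: "f \<in> l2 A \<Longrightarrow> smul c f \<in> l2 A"
  by (auto simp: l2_def norm_mult power_mult_distrib intro: summable_on_cmult_right)

lemma cmod_add_sq_le: "(cmod (a + b))\<^sup>2 \<le> 2 * ((cmod a)\<^sup>2 + (cmod b)\<^sup>2)"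
proof -
  have "(cmod (a + b))\<^sup>2 \<le> (cmod a + cmod b)\<^sup>2"
    by (intro power_mono norm_triangle_ineq) auto
  also have "\<dots> \<le> 2 * ((cmod a)\<^sup>2 + (cmod b)\<^sup>2)"
    using zero_le_power2 [of "cmod a - cmod b"] by (simp add: power2_eq_square algebra_simps)
  finally show ?thesis .
qed

lemma l2_add [simp, intro]:
  assumes "f \<in> l2 A" "g \<in> l2 A"
  shows "f + g \<in> l2 A"
proof -
  have "(\<lambda>x. 2 * ((cmod (f x))\<^sup>2 + (cmod (g x))\<^sup>2)) summable_on A"
    using assms by (intro summable_on_cmult_right summable_on_add) (auto simp: l2_def)
  then have "(\<lambda>x. (cmod (f x + g x))\<^sup>2) summable_on A"
    by (rule summable_on_comparison_test) (use cmod_add_sq_le in auto)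
  then show ?thesis
    using assms by (auto simp: l2_def)
qed

lemma l2_uminus [simp, intro]: "f \<in> l2 A \<Longrightarrow> - f \<in> l2 A"
  by (auto simp: l2_def)

lemma l2_diff [simp, intro]: "f \<in> l2 A \<Longrightarrow> g \<in> l2 A \<Longrightarrow> f - g \<in> l2 A"
  using l2_add [of f A "- g"] by simp

lemma l2_sum [intro]: "(\<And>i. i \<in> I \<Longrightarrow> f i \<in> l2 A) \<Longrightarrow> sum f I \<in> l2 A"
  by (induction I rule: infinite_finite_induct) auto

lemma l2_delta [simp, intro]: "a \<in> A \<Longrightarrow> delta a \<in> l2 A"
  by (rule indicator_in_l2)

lemma l2_outside: "f \<in> l2 A \<Longrightarrow> x \<notin> A \<Longrightarrow> f x = 0"
  by (simp add: l2_def)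

lemma l2_eqI: "f \<in> l2 A \<Longrightarrow> g \<in> l2 A \<Longrightarrow> (\<And>x. x \<in> A \<Longrightarrow> f x = g x) \<Longrightarrow> f = g"
  by (metis ext l2_outside)

lemma l2_norm_nonneg [simp]: "0 \<le> l2_norm A f"
  by (auto simp: l2_norm_def intro: infsum_nonneg)

lemma l2_norm_sq: "(l2_norm A f)\<^sup>2 = (\<Sum>\<^sub>\<infinity>x\<in>A. (cmod (f x))\<^sup>2)"
  by (auto simp: l2_norm_def intro: infsum_nonneg)

lemma l2_prod_abs_summable:
  assumes "f \<in> l2 A" "g \<in> l2 A"
  shows "(\<lambda>x. cmod (f x * cnj (g x))) summable_on A"
proof -
  have "(\<lambda>x. (cmod (f x))\<^sup>2 + (cmod (g x))\<^sup>2) summable_on A"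
    using assms by (intro summable_on_add) (auto simp: l2_def)
  then show ?thesis
  proof (rule summable_on_comparison_test)
    fix x
    have "cmod (f x) * cmod (g x) \<le> (cmod (f x))\<^sup>2 + (cmod (g x))\<^sup>2"
      using zero_le_power2 [of "cmod (f x) - cmod (g x)"] zero_le_power2 [of "cmod (f x)"]
        zero_le_power2 [of "cmod (g x)"]
      unfolding power2_diff by linarith
    then show "cmod (f x * cnj (g x)) \<le> (cmod (f x))\<^sup>2 + (cmod (g x))\<^sup>2"
      by (simp add: norm_mult)
  qed auto
qed

lemma l2_prod_summable: "f \<in> l2 A \<Longrightarrow> g \<in> l2 A \<Longrightarrow> (\<lambda>x. f x * cnj (g x)) summable_on A"
  by (rule abs_summable_summable [OF l2_prod_abs_summable])

lemma l2_inner_add_left: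
  "f \<in> l2 A \<Longrightarrow> g \<in> l2 A \<Longrightarrow> h \<in> l2 A \<Longrightarrow> l2_inner A (f + g) h = l2_inner A f h + l2_inner A g h"
  by (simp add: l2_inner_def ring_distribs infsum_add l2_prod_summable)

lemma l2_inner_smul_left: "l2_inner A (smul c f) h = c * l2_inner A f h"
  by (simp add: l2_inner_def mult.assoc infsum_cmult_right')

lemma l2_inner_cnj: "cnj (l2_inner A f g) = l2_inner A g f"
  by (simp add: l2_inner_def mult.commute flip: infsum_cnj)

lemma l2_inner_add_right:
  "f \<in> l2 A \<Longrightarrow> g \<in> l2 A \<Longrightarrow> h \<in> l2 A \<Longrightarrow> l2_inner A h (f + g) = l2_inner A h f + l2_inner A h g"
  by (subst (1 2 3) l2_inner_cnj [symmetric]) (simp add: l2_inner_add_left)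

lemma l2_inner_smul_right: "l2_inner A f (smul c h) = cnj c * l2_inner A f h"
  by (subst (1 2) l2_inner_cnj [symmetric]) (simp add: l2_inner_smul_left)

lemma l2_inner_zero [simp]: "l2_inner A 0 f = 0" "l2_inner A f 0 = 0"
  by (simp_all add: l2_inner_def)

lemma smul_minus_one: "- f = smul (-1) f" and diff_eq_add_smul: "f - g = f + smul (-1) g"
  by (auto simp: fun_eq_iff)

lemma l2_inner_sum_left:
  assumes "\<And>i. i \<in> I \<Longrightarrow> f i \<in> l2 A" "h \<in> l2 A"
  shows "l2_inner A (sum f I) h = (\<Sum>i\<in>I. l2_inner A (f i) h)"
  using assms by (induction I rule: infinite_finite_induct) (simp_all add: l2_inner_add_left l2_sum)

lemma l2_inner_diff_left:
  "f \<in> l2 A \<Longrightarrow> g \<in> l2 A \<Longrightarrow> h \<in> l2 A \<Longrightarrow> l2_inner A (f - g) h = l2_inner A f h - l2_inner A g h"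
  by (simp add: diff_eq_add_smul l2_inner_add_left l2_inner_smul_left)

lemma l2_inner_self:
  assumes "f \<in> l2 A"
  shows "l2_inner A f f = complex_of_real ((l2_norm A f)\<^sup>2)"
proof -
  have "l2_inner A f f = (\<Sum>\<^sub>\<infinity>x\<in>A. complex_of_real ((cmod (f x))\<^sup>2))"
    unfolding l2_inner_def by (intro infsum_cong) (metis complex_norm_square of_real_power)
  also have "\<dots> = complex_of_real (\<Sum>\<^sub>\<infinity>x\<in>A. (cmod (f x))\<^sup>2)"
    using assms by (intro infsumI has_sum_of_real has_sum_infsum) (auto simp: l2_def)
  finally show ?thesis
    by (simp add: l2_norm_sq)
qed

lemma l2_norm_sq_inner: "f \<in> l2 A \<Longrightarrow> (l2_norm A f)\<^sup>2 = Re (l2_inner A f f)"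
  by (simp add: l2_inner_self)

lemma l2_norm_eq_0D:
  assumes "f \<in> l2 A" "l2_norm A f = 0"
  shows "f = 0"
proof -
  have "(cmod (f x))\<^sup>2 = 0" if "x \<in> A" for x
    using assms that l2_norm_sq [of A f]
    by (intro nonneg_infsum_le_0D [of "\<lambda>x. (cmod (f x))\<^sup>2" A x]) (auto simp: l2_def)
  then show ?thesis
    using assms by (intro l2_eqI [of _ A]) auto
qed

lemma l2_Cauchy_Schwarz:
  assumes f: "f \<in> l2 A" and g: "g \<in> l2 A"
  shows "cmod (l2_inner A f g) \<le> l2_norm A f * l2_norm A g"
proof (cases "l2_norm A f = 0 \<or> l2_norm A g = 0")
  case True
  then show ?thesis
    using l2_norm_eq_0D f g by fastforce
next
  case False
  define a b where "a = l2_norm A f" and "b = l2_norm A g"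
  have ab: "a > 0" "b > 0"
    using False l2_norm_nonneg [of A f] l2_norm_nonneg [of A g] unfolding a_def b_def by linarith+
  have sf: "(\<lambda>x. (cmod (f x))\<^sup>2) summable_on A" and sg: "(\<lambda>x. (cmod (g x))\<^sup>2) summable_on A"
    using f g by (auto simp: l2_def)
  have "cmod (l2_inner A f g) \<le> (\<Sum>\<^sub>\<infinity>x\<in>A. cmod (f x * cnj (g x)))"
    unfolding l2_inner_def by (intro norm_infsum_bound l2_prod_abs_summable f g)
  also have "\<dots> \<le> (\<Sum>\<^sub>\<infinity>x\<in>A. (b / (2 * a)) * (cmod (f x))\<^sup>2 + (a / (2 * b)) * (cmod (g x))\<^sup>2)"
  proof (intro infsum_mono l2_prod_abs_summable f g summable_on_add summable_on_cmult_right sf sg)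
    fix x
    have "0 \<le> (b * cmod (f x) - a * cmod (g x))\<^sup>2 / (2 * a * b)"
      using ab by simp
    also have "\<dots> = (b / (2 * a)) * (cmod (f x))\<^sup>2 + (a / (2 * b)) * (cmod (g x))\<^sup>2 - cmod (f x) * cmod (g x)"
      using ab by (simp add: field_simps power2_eq_square)
    finally show "cmod (f x * cnj (g x)) \<le> (b / (2 * a)) * (cmod (f x))\<^sup>2 + (a / (2 * b)) * (cmod (g x))\<^sup>2"
      by (simp add: norm_mult)
  qed
  also have "\<dots> = (b / (2 * a)) * a\<^sup>2 + (a / (2 * b)) * b\<^sup>2"
    by (subst infsum_add) (simp_all only: summable_on_cmult_right sf sg infsum_cmult_right' a_def b_def l2_norm_sq)
  also have "\<dots> = a * b"
    using ab by (simp add: field_simps power2_eq_square)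
  finally show ?thesis
    by (simp add: a_def b_def)
qed

lemma l2_norm_add_sq:
  assumes "f \<in> l2 A" "g \<in> l2 A"
  shows "(l2_norm A (f + g))\<^sup>2 = (l2_norm A f)\<^sup>2 + 2 * Re (l2_inner A f g) + (l2_norm A g)\<^sup>2"
proof -
  have "Re (l2_inner A g f) = Re (l2_inner A f g)"
    by (subst l2_inner_cnj [symmetric]) simp
  then show ?thesis
    using assms by (simp add: l2_norm_sq_inner l2_inner_add_left l2_inner_add_right)
qed

lemma l2_norm_triangle:
  assumes "f \<in> l2 A" "g \<in> l2 A"
  shows "l2_norm A (f + g) \<le> l2_norm A f + l2_norm A g"
proof (rule power2_le_imp_le)
  have "Re (l2_inner A f g) \<le> l2_norm A f * l2_norm A g"
    using l2_Cauchy_Schwarz [OF assms] complex_Re_le_cmod [of "l2_inner A f g"] by linarith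
  then show "(l2_norm A (f + g))\<^sup>2 \<le> (l2_norm A f + l2_norm A g)\<^sup>2"
    by (simp add: l2_norm_add_sq assms power2_sum)
qed simp

lemma l2_norm_smul [simp]: "l2_norm A (smul c f) = cmod c * l2_norm A f"
  by (simp add: l2_norm_def norm_mult power_mult_distrib infsum_cmult_right' real_sqrt_mult)

lemma l2_norm_zero [simp]: "l2_norm A 0 = 0"
  by (simp add: l2_norm_def)

lemma l2_norm_minus [simp]: "l2_norm A (- f) = l2_norm A f"
  by (simp add: smul_minus_one)

lemma l2_norm_diff_triangle:
  assumes "f \<in> l2 A" "g \<in> l2 A"
  shows "l2_norm A (f - g) \<le> l2_norm A f + l2_norm A g"
  using l2_norm_triangle [of f A "- g"] assms by simp

lemma l2_norm_minus_commute: "l2_norm A (f - g) = l2_norm A (g - f)"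
  using l2_norm_minus [of A "f - g"] by simp

lemma l2_inner_delta_right:
  assumes "a \<in> A"
  shows "l2_inner A f (delta a) = f a"
proof -
  have "l2_inner A f (delta a) = (\<Sum>\<^sub>\<infinity>x\<in>{a}. f x)"
    unfolding l2_inner_def by (rule infsum_cong_neutral) (use assms in auto)
  then show ?thesis by simp
qed

lemma l2_norm_delta [simp]: "a \<in> A \<Longrightarrow> l2_norm A (delta a) = 1"
  using l2_norm_sq_inner [of "delta a" A] l2_norm_nonneg [of A "delta a"]
  by (simp add: l2_inner_delta_right abs_if power2_eq_1_iff split: if_splits)

lemma truncate_eq_sum: "finite F \<Longrightarrow> (\<lambda>x. if x \<in> F then f x else 0) = (\<Sum>a\<in>F. smul (f a) (delta a))"
  by (auto simp: fun_eq_iff sum_fun_apply indicator_def if_distrib sum.If_cases cong: if_cong)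

text \<open>
Finitely supported functions are dense.
\<close>

lemma l2_approx_finite:
  assumes f: "f \<in> l2 A" and "\<epsilon> > 0"
  obtains F where "finite F" "F \<subseteq> A" "l2_norm A (f - (\<Sum>a\<in>F. smul (f a) (delta a))) < \<epsilon>"
proof -
  let ?h = "\<lambda>x. (cmod (f x))\<^sup>2"
  have s: "?h summable_on A"
    using f by (simp add: l2_def)
  obtain F where F: "finite F" "F \<subseteq> A" "dist (sum ?h F) (infsum ?h A) \<le> \<epsilon>\<^sup>2 / 2"
    using infsum_finite_approximation [OF s, of "\<epsilon>\<^sup>2 / 2"] \<open>\<epsilon> > 0\<close> by auto
  have "(l2_norm A (f - (\<Sum>a\<in>F. smul (f a) (delta a))))\<^sup>2 = infsum ?h (A - F)"
    unfolding l2_norm_sq truncate_eq_sum [OF F(1), symmetric]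
    by (rule infsum_cong_neutral) auto
  also have "\<dots> = infsum ?h A - sum ?h F"
    using F s by (subst infsum_Diff) auto
  also have "\<dots> < \<epsilon>\<^sup>2"
    using F(3) \<open>\<epsilon> > 0\<close> zero_less_power [of \<epsilon> 2] unfolding dist_real_def by linarith
  finally have "l2_norm A (f - (\<Sum>a\<in>F. smul (f a) (delta a))) < \<epsilon>"
    using \<open>\<epsilon> > 0\<close> by (simp add: power_less_imp_less_base)
  then show ?thesis
    using that F by blast
qed

section \<open>Bounded operators and their adjoints\<close>

text \<open>
Scalar multiples of operators.
\<close>

abbreviation op_smul :: "complex \<Rightarrow> 'a operator \<Rightarrow> 'a operator" where
  "op_smul c T \<equiv> (\<lambda>f. smul c (T f))"

text \<open>
  The bound $\|T\| \le K$ for the operator norm, stated without a supremum; for nonnegative \<open>K\<close>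
  and bounded \<open>T\<close> it says that the operator norm is at most \<open>K\<close>.
\<close>

definition op_le :: "'a set \<Rightarrow> 'a operator \<Rightarrow> real \<Rightarrow> bool" where
  "op_le A T K \<longleftrightarrow> (\<forall>f\<in>l2 A. l2_norm A (T f) \<le> K * l2_norm A f)"

lemma op_leD: "op_le A T K \<Longrightarrow> f \<in> l2 A \<Longrightarrow> l2_norm A (T f) \<le> K * l2_norm A f"
  by (simp add: op_le_def)

lemma bop_iff: "T \<in> bounded_operators A \<longleftrightarrow>
    (\<forall>f\<in>l2 A. T f \<in> l2 A) \<and> (\<forall>f. f \<notin> l2 A \<longrightarrow> T f = 0) \<and>
    (\<forall>f\<in>l2 A. \<forall>g\<in>l2 A. T (f + g) = T f + T g) \<and>
    (\<forall>c. \<forall>f\<in>l2 A. T (smul c f) = smul c (T f)) \<and> (\<exists>K. op_le A T K)"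
  unfolding bounded_operators_def plus_fun_def zero_fun_def smul_def op_le_def by simp

lemma bop_l2 [simp, intro]: "T \<in> bounded_operators A \<Longrightarrow> T f \<in> l2 A"
  by (cases "f \<in> l2 A") (auto simp: bop_iff)

lemma bop_outside: "T \<in> bounded_operators A \<Longrightarrow> f \<notin> l2 A \<Longrightarrow> T f = 0"
  and bop_add: "T \<in> bounded_operators A \<Longrightarrow> f \<in> l2 A \<Longrightarrow> g \<in> l2 A \<Longrightarrow> T (f + g) = T f + T g"
  and bop_smul: "T \<in> bounded_operators A \<Longrightarrow> f \<in> l2 A \<Longrightarrow> T (smul c f) = smul c (T f)"
  by (auto simp: bop_iff)

lemma bop_diff: "T \<in> bounded_operators A \<Longrightarrow> f \<in> l2 A \<Longrightarrow> g \<in> l2 A \<Longrightarrow> T (f - g) = T f - T g"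
  using bop_add [of T A f "smul (-1) g"] bop_smul [of T A g "-1"] by (simp only: diff_eq_add_smul l2_smul)

lemma bop_zero: "T \<in> bounded_operators A \<Longrightarrow> T 0 = 0"
  using bop_smul [of T A 0 0] by simp

lemma bop_sum:
  assumes "T \<in> bounded_operators A" "\<And>i. i \<in> I \<Longrightarrow> f i \<in> l2 A"
  shows "T (sum f I) = (\<Sum>i\<in>I. T (f i))"
  using assms(2)
  by (induction I rule: infinite_finite_induct)
    (simp_all add: bop_add [OF assms(1)] bop_zero [OF assms(1)] l2_sum)

lemma op_le_mono: "op_le A T K \<Longrightarrow> K \<le> L \<Longrightarrow> op_le A T L"
  unfolding op_le_def by (meson l2_norm_nonneg mult_right_mono order_trans)

lemma bop_bound:
  assumes "T \<in> bounded_operators A"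
  obtains K where "K \<ge> 1" "op_le A T K"
  using assms op_le_mono [of A T _ "max 1 _"] unfolding bop_iff
  by (metis max.cobounded1 max.cobounded2)

lemma bop_eqI:
  assumes "S \<in> bounded_operators A" "T \<in> bounded_operators A" "\<And>f. f \<in> l2 A \<Longrightarrow> S f = T f"
  shows "S = T"
  using assms bop_outside by (metis ext)

lemma op_le_zero: "K \<ge> 0 \<Longrightarrow> op_le A 0 K"
  by (simp add: op_le_def)

lemma op_le_identity: "op_le A (identity_op A) 1"
  by (simp add: op_le_def identity_op_def)

lemma op_le_add:
  assumes "S \<in> bounded_operators A" "T \<in> bounded_operators A" "op_le A S K" "op_le A T L"
  shows "op_le A (S + T) (K + L)"
proof -
  have "l2_norm A (S f + T f) \<le> (K + L) * l2_norm A f" if "f \<in> l2 A" for f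
    using assms l2_norm_triangle [of "S f" A "T f"] op_leD [OF assms(3) that] op_leD [OF assms(4) that]
    by (simp add: ring_distribs)
  then show ?thesis by (simp add: op_le_def)
qed

lemma op_le_op_smul: "op_le A T K \<Longrightarrow> op_le A (op_smul c T) (cmod c * K)"
  by (simp add: op_le_def mult.assoc mult_left_mono)

lemma op_le_comp:
  assumes "T \<in> bounded_operators A" "op_le A S K" "op_le A T L" "K \<ge> 0"
  shows "op_le A (S \<circ> T) (K * L)"
proof -
  have "l2_norm A (S (T f)) \<le> K * L * l2_norm A f" if "f \<in> l2 A" for f
    using op_leD [OF assms(2), of "T f"] mult_left_mono [OF op_leD [OF assms(3) that] \<open>K \<ge> 0\<close>] assms(1)
    by simp
  then show ?thesis by (simp add: op_le_def)
qed

lemma bop_0 [simp, intro]: "0 \<in> bounded_operators A"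
  using op_le_zero [of 1] by (auto simp: bop_iff)

lemma bop_identity [simp, intro]: "identity_op A \<in> bounded_operators A"
  using op_le_identity [of A] by (auto simp: bop_iff identity_op_def zero_fun_def)

lemma bop_plus [simp, intro]:
  assumes "S \<in> bounded_operators A" "T \<in> bounded_operators A"
  shows "S + T \<in> bounded_operators A"
proof -
  obtain K L where "op_le A S K" "op_le A T L"
    using assms by (auto simp: bop_iff)
  then show ?thesis
    using op_le_add [OF assms] assms unfolding bop_iff by (auto simp: smul_add algebra_simps)
qed

lemma bop_op_smul [simp, intro]:
  assumes "T \<in> bounded_operators A"
  shows "op_smul c T \<in> bounded_operators A"
proof -
  obtain K where "op_le A T K"
    using assms by (auto simp: bop_iff)
  from op_le_op_smul [OF this, of c] show ?thesis
    using assms unfolding bop_iff by (auto simp: smul_add mult.commute)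
qed

lemma bop_comp [simp, intro]:
  assumes "S \<in> bounded_operators A" "T \<in> bounded_operators A"
  shows "S \<circ> T \<in> bounded_operators A"
proof -
  obtain K L where "K \<ge> 1" "op_le A S K" "op_le A T L"
    using assms bop_bound by metis
  then have "op_le A (S \<circ> T) (K * L)"
    using op_le_comp assms by fastforce
  then show ?thesis
    using assms unfolding bop_iff by (auto simp: bop_zero [OF assms(1)])
qed

lemma operator_diff_eq: "S - T = S + op_smul (-1) T" for S T :: "'a operator"
  by (auto simp: fun_eq_iff)

lemma bop_minus [simp, intro]:
  "S \<in> bounded_operators A \<Longrightarrow> T \<in> bounded_operators A \<Longrightarrow> S - T \<in> bounded_operators A"
  unfolding operator_diff_eq by (intro bop_plus bop_op_smul)

lemma op_le_diff:
  assumes "S \<in> bounded_operators A" "T \<in> bounded_operators A" "op_le A S K" "op_le A T L"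
  shows "op_le A (S - T) (K + L)"
  unfolding operator_diff_eq
  using op_le_add [of S A "op_smul (-1) T" K L] op_le_op_smul [of A T L "-1"] assms by auto

lemma operator_norm_le_iff:
  assumes T: "T \<in> bounded_operators A" and K: "K \<ge> 0"
  shows "operator_norm A T \<le> K \<longleftrightarrow> op_le A T K"
proof
  assume le: "operator_norm A T \<le> K"
  obtain L where L: "L \<ge> 1" "op_le A T L"
    using bop_bound [OF T] by blast
  have bdd: "bdd_above ((\<lambda>f. l2_norm A (T f)) ` {f \<in> l2 A. l2_norm A f \<le> 1})"
  proof (rule bdd_aboveI2)
    fix f assume "f \<in> {f \<in> l2 A. l2_norm A f \<le> 1}"
    then show "l2_norm A (T f) \<le> L"
      using op_leD [OF L(2), of f] mult_left_mono [of "l2_norm A f" 1 L] L(1)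
      by (simp add: order_trans)
  qed
  show "op_le A T K"
    unfolding op_le_def
  proof
    fix f assume f: "f \<in> l2 A"
    show "l2_norm A (T f) \<le> K * l2_norm A f"
    proof (cases "l2_norm A f = 0")
      case True
      then show ?thesis
        using l2_norm_eq_0D [OF f] bop_zero [OF T] by simp
    next
      case False
      then have pos: "l2_norm A f > 0"
        using l2_norm_nonneg [of A f] by linarith
      let ?f = "smul (complex_of_real (1 / l2_norm A f)) f"
      have "l2_norm A (T ?f) \<le> operator_norm A T"
      proof -
        have "?f \<in> {f \<in> l2 A. l2_norm A f \<le> 1}"
          using f pos by (auto simp: norm_divide)
        from cSUP_upper [OF this bdd] show ?thesis
          unfolding operator_norm_def .
      qed
      then have "l2_norm A (T f) / l2_norm A f \<le> K"
        using le pos by (simp add: bop_smul [OF T f] norm_divide)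
      then show ?thesis
        using pos by (simp add: field_simps)
    qed
  qed
next
  assume le: "op_le A T K"
  show "operator_norm A T \<le> K"
    unfolding operator_norm_def
  proof (rule cSUP_least)
    have "0 \<in> {f \<in> l2 A. l2_norm A f \<le> 1}" by simp
    then show "{f \<in> l2 A. l2_norm A f \<le> 1} \<noteq> {}" by blast
    fix f assume "f \<in> {f \<in> l2 A. l2_norm A f \<le> 1}"
    then show "l2_norm A (T f) \<le> K"
      using op_leD [OF le, of f] mult_left_mono [of "l2_norm A f" 1 K] K by (simp add: order_trans)
  qed
qed

text \<open>
An adjointness relation has to be checked on basis vectors only.
\<close>

lemma l2_inner_eq_by_density:
  assumes T: "T \<in> bounded_operators A" and f: "f \<in> l2 A" and g: "g \<in> l2 A"
    and eq: "\<And>a. a \<in> A \<Longrightarrow> l2_inner A (T (delta a)) g = l2_inner A (delta a) h" and h: "h \<in> l2 A"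
  shows "l2_inner A (T f) g = l2_inner A f h"
proof -
  obtain K where K: "K \<ge> 1" "op_le A T K"
    using bop_bound [OF T] by blast
  define C where "C = K * l2_norm A g + l2_norm A h + 1"
  have C: "C > 0"
    using K(1) by (auto simp: C_def intro!: add_nonneg_pos)
  have "cmod (l2_inner A (T f) g - l2_inner A f h) \<le> \<epsilon>" if "\<epsilon> > 0" for \<epsilon>
  proof -
    obtain F where F: "finite F" "F \<subseteq> A" "l2_norm A (f - (\<Sum>a\<in>F. smul (f a) (delta a))) < \<epsilon> / C"
      using l2_approx_finite [OF f, of "\<epsilon> / C"] C \<open>\<epsilon> > 0\<close> by auto
    define p where "p = (\<Sum>a\<in>F. smul (f a) (delta a))"
    have p: "p \<in> l2 A"
      unfolding p_def using F(2) by (intro l2_sum) auto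
    have "l2_inner A (T p) g = l2_inner A p h"
    proof -
      have inA: "a \<in> A" if "a \<in> F" for a
        using that F(2) by blast
      have "T p = (\<Sum>a\<in>F. T (smul (f a) (delta a)))"
        unfolding p_def by (rule bop_sum [OF T]) (simp add: inA)
      then have "l2_inner A (T p) g = (\<Sum>a\<in>F. l2_inner A (T (smul (f a) (delta a))) g)"
        by (simp only:) (rule l2_inner_sum_left, use T g in auto)
      also have "\<dots> = (\<Sum>a\<in>F. l2_inner A (smul (f a) (delta a)) h)"
        by (intro sum.cong refl) (simp only: bop_smul [OF T l2_delta [OF inA]] l2_inner_smul_left eq [OF inA])
      also have "\<dots> = l2_inner A p h"
        unfolding p_def by (rule l2_inner_sum_left [symmetric]) (use h inA in auto)
      finally show ?thesis .
    qed
    then have "l2_inner A (T f) g - l2_inner A f h = l2_inner A (T (f - p)) g - l2_inner A (f - p) h"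
      using f g h p T by (simp add: bop_diff [OF T] l2_inner_diff_left)
    also have "cmod \<dots> \<le> l2_norm A (T (f - p)) * l2_norm A g + l2_norm A (f - p) * l2_norm A h"
      using f g h p T by (intro order_trans [OF norm_triangle_ineq4] add_mono l2_Cauchy_Schwarz) auto
    also have "\<dots> \<le> K * l2_norm A (f - p) * l2_norm A g + l2_norm A (f - p) * l2_norm A h"
      using f p by (intro add_right_mono mult_right_mono op_leD [OF K(2)]) auto
    also have "\<dots> \<le> C * l2_norm A (f - p)"
      by (simp add: C_def algebra_simps)
    also have "\<dots> \<le> \<epsilon>"
      using F(3) C by (simp add: field_simps p_def)
    finally show ?thesis .
  qed
  then have "cmod (l2_inner A (T f) g - l2_inner A f h) = 0"
    by (metis field_le_epsilon add_0 norm_ge_zero norm_le_zero_iff order_antisym)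
  then show ?thesis by simp
qed

text \<open>
  The adjoint has the matrix entries $(S g)(x) = \langle g, T \delta_x \rangle$. That $S g$ is
  square-summable follows by testing the bound of \<open>T\<close> on the truncations of $S g$, so the Riesz
  representation theorem is not needed.
\<close>

lemma adjoint_exists:
  assumes T: "T \<in> bounded_operators A"
  obtains S where "S \<in> bounded_operators A"
    and "\<And>f g. f \<in> l2 A \<Longrightarrow> g \<in> l2 A \<Longrightarrow> l2_inner A (T f) g = l2_inner A f (S g)"
proof -
  obtain K where K: "K \<ge> 1" "op_le A T K"
    using bop_bound [OF T] by blast
  define S :: "'a operator" where
    "S = (\<lambda>g x. if g \<in> l2 A \<and> x \<in> A then l2_inner A g (T (delta x)) else 0)"
  have fin: "(\<Sum>x\<in>F. (cmod (S g x))\<^sup>2) \<le> (K * l2_norm A g)\<^sup>2"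
    if g: "g \<in> l2 A" and F: "finite F" "F \<subseteq> A" for g F
  proof -
    define s where "s = (\<Sum>x\<in>F. (cmod (S g x))\<^sup>2)"
    have s: "s \<ge> 0"
      by (simp add: s_def sum_nonneg)
    define v where "v = (\<Sum>x\<in>F. smul (S g x) (delta x))"
    have v: "v \<in> l2 A"
      unfolding v_def using F by (intro l2_sum) auto
    have "(l2_norm A v)\<^sup>2 = (\<Sum>\<^sub>\<infinity>x\<in>F. (cmod (S g x))\<^sup>2)"
      unfolding l2_norm_sq v_def truncate_eq_sum [OF F(1), symmetric]
      by (rule infsum_cong_neutral) (use F in auto)
    then have nv: "(l2_norm A v)\<^sup>2 = s"
      using F by (simp add: s_def)
    have inA: "a \<in> A" if "a \<in> F" for a
      using that F(2) by blast
    have "T v = (\<Sum>x\<in>F. T (smul (S g x) (delta x)))"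
      unfolding v_def by (rule bop_sum [OF T]) (simp add: inA)
    then have "l2_inner A (T v) g = (\<Sum>x\<in>F. l2_inner A (T (smul (S g x) (delta x))) g)"
      by (simp only:) (rule l2_inner_sum_left, use T g in auto)
    also have "\<dots> = (\<Sum>x\<in>F. S g x * l2_inner A (T (delta x)) g)"
      by (intro sum.cong refl) (simp only: bop_smul [OF T l2_delta [OF inA]] l2_inner_smul_left)
    also have "\<dots> = (\<Sum>x\<in>F. complex_of_real ((cmod (S g x))\<^sup>2))"
    proof (intro sum.cong refl)
      fix x assume "x \<in> F"
      then have "l2_inner A (T (delta x)) g = cnj (S g x)"
        using F g by (auto simp: S_def l2_inner_cnj)
      then show "S g x * l2_inner A (T (delta x)) g = complex_of_real ((cmod (S g x))\<^sup>2)"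
        by (metis complex_norm_square of_real_power)
    qed
    finally have "l2_inner A (T v) g = complex_of_real s"
      by (simp add: s_def)
    then have "s \<le> l2_norm A (T v) * l2_norm A g"
      using l2_Cauchy_Schwarz [of "T v" A g] T g s by simp
    also have "\<dots> \<le> K * l2_norm A v * l2_norm A g"
      by (intro mult_right_mono op_leD [OF K(2) v]) auto
    finally have *: "l2_norm A v * l2_norm A v \<le> K * l2_norm A g * l2_norm A v"
      using nv by (simp add: power2_eq_square mult_ac)
    have "l2_norm A v \<le> K * l2_norm A g"
    proof (cases "l2_norm A v = 0")
      case True
      then show ?thesis using K(1) by simp
    next
      case False
      then have "l2_norm A v > 0"
        using l2_norm_nonneg [of A v] by linarith
      with * show ?thesis by simp
    qed
    then have "(l2_norm A v)\<^sup>2 \<le> (K * l2_norm A g)\<^sup>2"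
      by (intro power_mono) auto
    then show ?thesis
      using nv by (simp add: s_def)
  qed
  have Sl2: "S g \<in> l2 A" for g
  proof (cases "g \<in> l2 A")
    case True
    have "(\<lambda>x. (cmod (S g x))\<^sup>2) summable_on A"
      by (rule nonneg_bdd_above_summable_on)
        (auto intro!: bdd_aboveI [of _ "(K * l2_norm A g)\<^sup>2"] fin [OF True])
    then show ?thesis
      by (auto simp: l2_def S_def)
  next
    case False
    then have "S g = 0"
      by (auto simp: S_def)
    then show ?thesis by simp
  qed
  have bound: "l2_norm A (S g) \<le> K * l2_norm A g" if g: "g \<in> l2 A" for g
  proof (rule power2_le_imp_le)
    show "(l2_norm A (S g))\<^sup>2 \<le> (K * l2_norm A g)\<^sup>2"
      unfolding l2_norm_sq
      using Sl2 [of g] by (intro infsum_le_finite_sums fin [OF g]) (auto simp: l2_def)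
  qed (use K in simp)
  have SB: "S \<in> bounded_operators A"
    unfolding bop_iff
  proof (intro conjI ballI allI impI)
    show "\<exists>K. op_le A S K"
      using bound by (auto simp: op_le_def)
    show "S f \<in> l2 A" for f
      by (rule Sl2)
  qed (use T in \<open>auto simp: S_def fun_eq_iff l2_inner_add_left l2_inner_smul_left\<close>)
  show ?thesis
  proof (rule that [OF SB])
    fix f g assume f: "f \<in> l2 A" and g: "g \<in> l2 A"
    show "l2_inner A (T f) g = l2_inner A f (S g)"
    proof (rule l2_inner_eq_by_density [OF T f g])
      fix a assume a: "a \<in> A"
      have "l2_inner A (delta a) (S g) = cnj (S g a)"
        using a by (metis l2_inner_cnj l2_inner_delta_right)
      then show "l2_inner A (T (delta a)) g = l2_inner A (delta a) (S g)"
        using a g by (simp add: S_def l2_inner_cnj)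
    qed (use Sl2 in simp)
  qed
qed

lemma adjoint_unique:
  assumes "S \<in> bounded_operators A" "S' \<in> bounded_operators A"
    and eq: "\<And>f g. f \<in> l2 A \<Longrightarrow> g \<in> l2 A \<Longrightarrow> l2_inner A f (S g) = l2_inner A f (S' g)"
  shows "S = S'"
proof (rule bop_eqI [OF assms(1,2)])
  fix g assume g: "g \<in> l2 A"
  show "S g = S' g"
  proof (rule l2_eqI [of _ A])
    fix x assume "x \<in> A"
    then show "S g x = S' g x"
      using eq [of "delta x" g] g by (metis l2_inner_cnj l2_inner_delta_right l2_delta)
  qed (use assms in auto)
qed

lemma adjoint_eqI:
  assumes "T \<in> bounded_operators A" "S \<in> bounded_operators A"
    and "\<And>f g. f \<in> l2 A \<Longrightarrow> g \<in> l2 A \<Longrightarrow> l2_inner A (T f) g = l2_inner A f (S g)"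
  shows "adjoint_op A T = S"
  unfolding adjoint_op_def
proof (rule the_equality)
  fix S' assume S': "S' \<in> bounded_operators A \<and>
    (\<forall>f\<in>l2 A. \<forall>g\<in>l2 A. l2_inner A (T f) g = l2_inner A f (S' g))"
  show "S' = S"
    by (rule adjoint_unique [of _ A]) (use assms S' in auto)
qed (use assms in auto)

lemma
  assumes T: "T \<in> bounded_operators A"
  shows bop_adjoint [simp, intro]: "adjoint_op A T \<in> bounded_operators A"
    and l2_inner_adjoint: "f \<in> l2 A \<Longrightarrow> g \<in> l2 A \<Longrightarrow> l2_inner A (T f) g = l2_inner A f (adjoint_op A T g)"
proof -
  obtain S where S: "S \<in> bounded_operators A"
    "\<And>f g. f \<in> l2 A \<Longrightarrow> g \<in> l2 A \<Longrightarrow> l2_inner A (T f) g = l2_inner A f (S g)"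
    using adjoint_exists [OF T] by blast
  then have "adjoint_op A T = S"
    by (intro adjoint_eqI T) auto
  then show "adjoint_op A T \<in> bounded_operators A"
    and "f \<in> l2 A \<Longrightarrow> g \<in> l2 A \<Longrightarrow> l2_inner A (T f) g = l2_inner A f (adjoint_op A T g)"
    using S by auto
qed

lemma l2_inner_adjoint':
  assumes "T \<in> bounded_operators A" "f \<in> l2 A" "g \<in> l2 A"
  shows "l2_inner A (adjoint_op A T f) g = l2_inner A f (T g)"
  using l2_inner_adjoint [OF assms(1,3,2)] by (metis l2_inner_cnj)

lemma adjoint_comp:
  assumes "S \<in> bounded_operators A" "T \<in> bounded_operators A"
  shows "adjoint_op A (S \<circ> T) = adjoint_op A T \<circ> adjoint_op A S"
  by (rule adjoint_eqI) (use assms in \<open>auto simp: l2_inner_adjoint\<close>)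

lemma adjoint_add:
  assumes "S \<in> bounded_operators A" "T \<in> bounded_operators A"
  shows "adjoint_op A (S + T) = adjoint_op A S + adjoint_op A T"
  by (rule adjoint_eqI)
    (use assms in \<open>auto simp: l2_inner_adjoint l2_inner_add_left l2_inner_add_right\<close>)

lemma adjoint_op_smul:
  assumes "T \<in> bounded_operators A"
  shows "adjoint_op A (op_smul c T) = op_smul (cnj c) (adjoint_op A T)"
  by (rule adjoint_eqI)
    (use assms in \<open>auto simp: l2_inner_adjoint l2_inner_smul_left l2_inner_smul_right\<close>)

lemma adjoint_diff:
  assumes "S \<in> bounded_operators A" "T \<in> bounded_operators A"
  shows "adjoint_op A (S - T) = adjoint_op A S - adjoint_op A T"
  using assms by (simp add: operator_diff_eq adjoint_add adjoint_op_smul)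

lemma adjoint_0 [simp]: "adjoint_op A 0 = 0"
  by (rule adjoint_eqI) auto

lemma op_le_adjoint:
  assumes T: "T \<in> bounded_operators A" and K: "op_le A T K" "K \<ge> 0"
  shows "op_le A (adjoint_op A T) K"
  unfolding op_le_def
proof
  fix g assume g: "g \<in> l2 A"
  let ?v = "adjoint_op A T g"
  have v: "?v \<in> l2 A" using T by simp
  have "complex_of_real ((l2_norm A ?v)\<^sup>2) = l2_inner A (T ?v) g"
    by (simp only: l2_inner_adjoint [OF T v g] l2_inner_self [OF v])
  then have "(l2_norm A ?v)\<^sup>2 \<le> l2_norm A (T ?v) * l2_norm A g"
    using l2_Cauchy_Schwarz [of "T ?v" A g] T g
    by (metis abs_of_nonneg bop_l2 norm_of_real zero_le_power2)
  also have "\<dots> \<le> K * l2_norm A ?v * l2_norm A g"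
    by (intro mult_right_mono op_leD [OF K(1) v]) auto
  finally have *: "l2_norm A ?v * l2_norm A ?v \<le> K * l2_norm A g * l2_norm A ?v"
    by (simp add: power2_eq_square mult_ac)
  show "l2_norm A ?v \<le> K * l2_norm A g"
  proof (cases "l2_norm A ?v = 0")
    case True
    then show ?thesis using K by simp
  next
    case False
    then have "l2_norm A ?v > 0"
      using l2_norm_nonneg [of A ?v] by linarith
    with * show ?thesis by simp
  qed
qed

section \<open>Operators commuting with right translations\<close>

context group
begin

abbreviation "A \<equiv> carrier G"

text \<open>
  The right translation by \<open>g\<close> on functions on $G$, with value 0 outside the carrier.
\<close>

definition rtrans :: "'a \<Rightarrow> ('a \<Rightarrow> complex) \<Rightarrow> 'a \<Rightarrow> complex" where
  "rtrans g f = (\<lambda>h. if h \<in> A then f (h \<otimes> g) else 0)"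

text \<open>
  The bounded operators that commute with all right translations. This algebra contains $L(G)$
  (and equals it, which is not needed).
\<close>

definition commutant :: "'a operator set" where
  "commutant = {T \<in> bounded_operators A. \<forall>g\<in>A. \<forall>f\<in>l2 A. T (rtrans g f) = rtrans g (T f)}"

text \<open>
  The 2-norm of the trace, as the norm of the image of the vacuum vector $\delta_e$.
\<close>

definition norm2 :: "'a operator \<Rightarrow> real" where
  "norm2 T = l2_norm A (T (delta \<one>))"

lemma bij_right: "g \<in> A \<Longrightarrow> bij_betw (\<lambda>h. h \<otimes> g) A A"
  by (rule bij_betw_byWitness [where f' = "\<lambda>h. h \<otimes> inv g"]) (auto simp: m_assoc)

lemma bij_left: "g \<in> A \<Longrightarrow> bij_betw (\<lambda>h. g \<otimes> h) A A"
  by (rule bij_betw_byWitness [where f' = "\<lambda>h. inv g \<otimes> h"]) (auto simp: m_assoc [symmetric])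

lemma bij_inv: "bij_betw (\<lambda>h. inv h) A A"
  by (rule bij_betw_byWitness [where f' = "\<lambda>h. inv h"]) auto

lemma rtrans_l2 [simp, intro]:
  assumes g: "g \<in> A" and f: "f \<in> l2 A"
  shows "rtrans g f \<in> l2 A"
proof -
  have "(\<lambda>x. (cmod (f x))\<^sup>2) summable_on A"
    using f by (simp add: l2_def)
  then have "(\<lambda>x. (cmod (f (x \<otimes> g)))\<^sup>2) summable_on A"
    using summable_on_reindex_bij_betw [OF bij_right [OF g], of "\<lambda>x. (cmod (f x))\<^sup>2"] by simp
  then have "(\<lambda>x. (cmod (rtrans g f x))\<^sup>2) summable_on A"
    by (rule summable_on_cong [THEN iffD1, rotated]) (simp add: rtrans_def)
  then show ?thesis
    by (simp add: l2_def rtrans_def)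
qed

lemma rtrans_norm [simp]:
  assumes g: "g \<in> A"
  shows "l2_norm A (rtrans g f) = l2_norm A f"
proof -
  have "(\<Sum>\<^sub>\<infinity>x\<in>A. (cmod (rtrans g f x))\<^sup>2) = (\<Sum>\<^sub>\<infinity>x\<in>A. (cmod (f (x \<otimes> g)))\<^sup>2)"
    by (rule infsum_cong) (simp add: rtrans_def)
  also have "\<dots> = (\<Sum>\<^sub>\<infinity>x\<in>A. (cmod (f x))\<^sup>2)"
    by (rule infsum_reindex_bij_betw [OF bij_right [OF g]])
  finally show ?thesis
    by (simp add: l2_norm_def)
qed

lemma rtrans_inner:
  assumes g: "g \<in> A"
  shows "l2_inner A (rtrans g f) f' = l2_inner A f (rtrans (inv g) f')"
proof -
  have "l2_inner A f (rtrans (inv g) f') = (\<Sum>\<^sub>\<infinity>x\<in>A. f (x \<otimes> g) * cnj (rtrans (inv g) f' (x \<otimes> g)))"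
    unfolding l2_inner_def by (rule infsum_reindex_bij_betw [OF bij_right [OF g], symmetric])
  also have "\<dots> = l2_inner A (rtrans g f) f'"
    unfolding l2_inner_def by (rule infsum_cong) (simp add: rtrans_def g m_assoc)
  finally show ?thesis ..
qed

lemma rtrans_add: "rtrans g (f + f') = rtrans g f + rtrans g f'"
  and rtrans_diff: "rtrans g (f - f') = rtrans g f - rtrans g f'"
  and rtrans_smul: "rtrans g (smul c f) = smul c (rtrans g f)"
  and rtrans_0 [simp]: "rtrans g 0 = 0"
  by (auto simp: rtrans_def fun_eq_iff)

lemma rtrans_delta: "x \<in> A \<Longrightarrow> delta x = rtrans (inv x) (delta \<one>)"
  by (auto simp: rtrans_def fun_eq_iff indicator_def inv_solve_right')

lemma commutantI:
  "T \<in> bounded_operators A \<Longrightarrow> (\<And>g f. g \<in> A \<Longrightarrow> f \<in> l2 A \<Longrightarrow> T (rtrans g f) = rtrans g (T f)) \<Longrightarrow> T \<in> commutant"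
  by (simp add: commutant_def)

lemma commutant_bop [simp, intro]: "T \<in> commutant \<Longrightarrow> T \<in> bounded_operators A"
  and commutant_rtrans: "T \<in> commutant \<Longrightarrow> g \<in> A \<Longrightarrow> f \<in> l2 A \<Longrightarrow> T (rtrans g f) = rtrans g (T f)"
  by (auto simp: commutant_def)

lemma delta_one [simp, intro]: "delta \<one> \<in> l2 A"
  by auto

lemma commutant_0 [simp, intro]: "0 \<in> commutant"
  by (rule commutantI) auto

lemma commutant_identity [simp, intro]: "identity_op A \<in> commutant"
  by (rule commutantI [OF bop_identity]) (auto simp: identity_op_def)

lemma commutant_add [simp, intro]: "S \<in> commutant \<Longrightarrow> T \<in> commutant \<Longrightarrow> S + T \<in> commutant"
  by (rule commutantI) (auto simp: commutant_rtrans rtrans_add)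

lemma commutant_op_smul [simp, intro]: "T \<in> commutant \<Longrightarrow> op_smul c T \<in> commutant"
  by (rule commutantI) (auto simp: commutant_rtrans rtrans_smul)

lemma commutant_diff [simp, intro]: "S \<in> commutant \<Longrightarrow> T \<in> commutant \<Longrightarrow> S - T \<in> commutant"
  unfolding operator_diff_eq by (intro commutant_add commutant_op_smul)

lemma commutant_comp [simp, intro]: "S \<in> commutant \<Longrightarrow> T \<in> commutant \<Longrightarrow> S \<circ> T \<in> commutant"
  by (rule commutantI) (auto simp: commutant_rtrans)

lemma commutant_adjoint [simp, intro]:
  assumes T: "T \<in> commutant"
  shows "adjoint_op A T \<in> commutant"
proof -
  have B: "T \<in> bounded_operators A" using T by simp
  have "adjoint_op A T (rtrans g f) = rtrans g (adjoint_op A T f)" if g: "g \<in> A" and f: "f \<in> l2 A" for g f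
  proof (rule l2_eqI [of _ A])
    fix x assume x: "x \<in> A"
    have "adjoint_op A T (rtrans g f) x = l2_inner A (adjoint_op A T (rtrans g f)) (delta x)"
      by (rule l2_inner_delta_right [OF x, symmetric])
    also have "\<dots> = l2_inner A (rtrans g f) (T (delta x))"
      by (rule l2_inner_adjoint' [OF B]) (use g f x in auto)
    also have "\<dots> = l2_inner A f (T (rtrans (inv g) (delta x)))"
      using commutant_rtrans [OF T, of "inv g" "delta x"] g x by (simp add: rtrans_inner)
    also have "\<dots> = l2_inner A (adjoint_op A T f) (rtrans (inv g) (delta x))"
      by (rule l2_inner_adjoint' [OF B, symmetric]) (use g f x in auto)
    also have "\<dots> = l2_inner A (rtrans g (adjoint_op A T f)) (delta x)"
      by (simp add: rtrans_inner g)
    also have "\<dots> = rtrans g (adjoint_op A T f) x"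
      by (rule l2_inner_delta_right [OF x])
    finally show "adjoint_op A T (rtrans g f) x = rtrans g (adjoint_op A T f) x" .
  qed (use B g f in auto)
  then show ?thesis
    using B by (intro commutantI) auto
qed

lemma norm2_nonneg [simp]: "0 \<le> norm2 T"
  by (simp add: norm2_def)

text \<open>
  The trace property: an operator in the commutant has matrix entries depending on $x y^{-1}$ only,
  so its adjoint sends $\delta_e$ to $x \mapsto \overline{(T \delta_e)(x^{-1})}$.
\<close>

lemma norm2_adjoint:
  assumes T: "T \<in> commutant"
  shows "norm2 (adjoint_op A T) = norm2 T"
proof -
  have B: "T \<in> bounded_operators A" using T by simp
  have "adjoint_op A T (delta \<one>) x = cnj (T (delta \<one>) (inv x))" if x: "x \<in> A" for x
  proof -
    have "adjoint_op A T (delta \<one>) x = l2_inner A (adjoint_op A T (delta \<one>)) (delta x)"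
      by (rule l2_inner_delta_right [OF x, symmetric])
    also have "\<dots> = l2_inner A (delta \<one>) (T (delta x))"
      by (rule l2_inner_adjoint' [OF B]) (use x in auto)
    also have "\<dots> = cnj (l2_inner A (T (delta x)) (delta \<one>))"
      by (simp add: l2_inner_cnj)
    also have "\<dots> = cnj (T (delta x) \<one>)"
      by (simp add: l2_inner_delta_right)
    also have "T (delta x) = rtrans (inv x) (T (delta \<one>))"
      using commutant_rtrans [OF T, of "inv x" "delta \<one>"] x by (simp add: rtrans_delta [OF x])
    also have "\<dots> \<one> = T (delta \<one>) (inv x)"
      using x by (simp add: rtrans_def)
    finally show ?thesis .
  qed
  then have "(\<Sum>\<^sub>\<infinity>x\<in>A. (cmod (adjoint_op A T (delta \<one>) x))\<^sup>2) = (\<Sum>\<^sub>\<infinity>x\<in>A. (cmod (T (delta \<one>) (inv x)))\<^sup>2)"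
    by (intro infsum_cong) simp
  also have "\<dots> = (\<Sum>\<^sub>\<infinity>x\<in>A. (cmod (T (delta \<one>) x))\<^sup>2)"
    by (rule infsum_reindex_bij_betw [OF bij_inv])
  finally show ?thesis
    by (simp add: norm2_def l2_norm_def)
qed

lemma norm2_zero [simp]: "norm2 0 = 0"
  by (simp add: norm2_def)

lemma norm2_op_smul: "norm2 (op_smul c T) = cmod c * norm2 T"
  by (simp add: norm2_def)

lemma norm2_triangle: "S \<in> commutant \<Longrightarrow> T \<in> commutant \<Longrightarrow> norm2 (S + T) \<le> norm2 S + norm2 T"
  by (simp add: norm2_def l2_norm_triangle)

lemma norm2_triangle_diff:
  assumes "S \<in> commutant" "T \<in> commutant" "U \<in> commutant"
  shows "norm2 (S - U) \<le> norm2 (S - T) + norm2 (T - U)"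
  using norm2_triangle [of "S - T" "T - U"] assms by simp

lemma norm2_minus_commute: "norm2 (S - T) = norm2 (T - S)"
  by (simp add: norm2_def l2_norm_minus_commute)

lemma norm2_le: "op_le A T K \<Longrightarrow> norm2 T \<le> K"
  using op_leD [of A T K "delta \<one>"] by (simp add: norm2_def)

lemma norm2_comp_left: "op_le A S K \<Longrightarrow> T \<in> commutant \<Longrightarrow> norm2 (S \<circ> T) \<le> K * norm2 T"
  using op_leD [of A S K "T (delta \<one>)"] by (simp add: norm2_def)

lemma norm2_comp_right:
  assumes S: "S \<in> commutant" and T: "T \<in> commutant" and K: "op_le A S K" "K \<ge> 0"
  shows "norm2 (T \<circ> S) \<le> K * norm2 T"
proof -
  have "norm2 (T \<circ> S) = norm2 (adjoint_op A S \<circ> adjoint_op A T)"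
    using S T by (metis norm2_adjoint commutant_comp commutant_bop adjoint_comp)
  also have "\<dots> \<le> K * norm2 (adjoint_op A T)"
    using S T K by (intro norm2_comp_left op_le_adjoint) auto
  finally show ?thesis
    using T by (simp add: norm2_adjoint)
qed

lemma two_norm_eq_norm2:
  assumes "T \<in> bounded_operators A"
  shows "two_norm A (group_trace G) T = norm2 T"
proof -
  have "group_trace G (adjoint_op A T \<circ> T) = l2_inner A (T (delta \<one>)) (T (delta \<one>))"
    using assms by (simp add: group_trace_def l2_inner_adjoint' )
  then show ?thesis
    using assms by (simp add: two_norm_def norm2_def l2_inner_self)
qed


section \<open>The group algebra\<close>


lemma left_regular_l2:
  assumes g: "g \<in> A" and f: "f \<in> l2 A"
  shows "left_regular G g f \<in> l2 A"
proof -
  have "(\<lambda>x. (cmod (f x))\<^sup>2) summable_on A"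
    using f by (simp add: l2_def)
  then have "(\<lambda>x. (cmod (f (inv g \<otimes> x)))\<^sup>2) summable_on A"
    using summable_on_reindex_bij_betw [OF bij_left [of "inv g"], of "\<lambda>x. (cmod (f x))\<^sup>2"] g by simp
  then have "(\<lambda>x. (cmod (left_regular G g f x))\<^sup>2) summable_on A"
    by (rule summable_on_cong [THEN iffD1, rotated]) (simp add: left_regular_def f)
  then show ?thesis
    by (simp add: l2_def left_regular_def)
qed

lemma op_le_left_regular:
  assumes g: "g \<in> A"
  shows "op_le A (left_regular G g) 1"
proof -
  have "(\<Sum>\<^sub>\<infinity>x\<in>A. (cmod (left_regular G g f x))\<^sup>2) = (\<Sum>\<^sub>\<infinity>x\<in>A. (cmod (f x))\<^sup>2)" if f: "f \<in> l2 A" for f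
  proof -
    have "(\<Sum>\<^sub>\<infinity>x\<in>A. (cmod (left_regular G g f x))\<^sup>2) = (\<Sum>\<^sub>\<infinity>x\<in>A. (cmod (f (inv g \<otimes> x)))\<^sup>2)"
      by (rule infsum_cong) (simp add: left_regular_def f)
    also have "\<dots> = (\<Sum>\<^sub>\<infinity>x\<in>A. (cmod (f x))\<^sup>2)"
      by (rule infsum_reindex_bij_betw [OF bij_left]) (use g in simp)
    finally show ?thesis .
  qed
  then show ?thesis
    by (simp add: op_le_def l2_norm_def)
qed

lemma bop_left_regular:
  assumes g: "g \<in> A"
  shows "left_regular G g \<in> bounded_operators A"
  unfolding bop_iff
proof (intro conjI ballI allI impI)
  show "\<exists>K. op_le A (left_regular G g) K"
    using op_le_left_regular [OF g] by blast
  show "left_regular G g f \<in> l2 A" if "f \<in> l2 A" for f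
    using left_regular_l2 g that by simp
qed (auto simp: left_regular_def fun_eq_iff)

lemma commutant_left_regular [simp, intro]:
  assumes g: "g \<in> A"
  shows "left_regular G g \<in> commutant"
proof -
  have "left_regular G g (rtrans k f) = rtrans k (left_regular G g f)" if k: "k \<in> A" and f: "f \<in> l2 A" for k f
    using g rtrans_l2 [OF k f] f k by (auto simp: left_regular_def rtrans_def m_assoc)
  then show ?thesis
    using bop_left_regular [OF g] by (intro commutantI) auto
qed

lemma left_regular_comp:
  assumes g: "g \<in> A" and h: "h \<in> A"
  shows "left_regular G g \<circ> left_regular G h = left_regular G (g \<otimes> h)"
proof (rule bop_eqI [of _ A])
  fix f assume f: "f \<in> l2 A"
  then show "(left_regular G g \<circ> left_regular G h) f = left_regular G (g \<otimes> h) f"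
    using left_regular_l2 [OF h f] g h
    by (auto simp: left_regular_def fun_eq_iff inv_mult_group m_assoc)
qed (use assms in \<open>auto intro: bop_left_regular\<close>)

lemma adjoint_left_regular:
  assumes g: "g \<in> A"
  shows "adjoint_op A (left_regular G g) = left_regular G (inv g)"
proof (rule adjoint_eqI)
  fix f h assume f: "f \<in> l2 A" and h: "h \<in> l2 A"
  have "l2_inner A (left_regular G g f) h =
      (\<Sum>\<^sub>\<infinity>x\<in>A. left_regular G g f (g \<otimes> x) * cnj (h (g \<otimes> x)))"
    unfolding l2_inner_def by (rule infsum_reindex_bij_betw [OF bij_left [OF g], symmetric])
  also have "\<dots> = l2_inner A f (left_regular G (inv g) h)"
    unfolding l2_inner_def
    by (rule infsum_cong) (use g f h in \<open>simp add: left_regular_def m_assoc [symmetric]\<close>)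
  finally show "l2_inner A (left_regular G g f) h = l2_inner A f (left_regular G (inv g) h)" .
qed (use g in \<open>auto intro: bop_left_regular\<close>)

end

text \<open>
  The element $\sum c_i u_{g_i}$ of the group algebra given by a list of pairs $(c_i, g_i)$;
  group elements may occur repeatedly.
\<close>

primrec gcomb :: "('a, 'm) monoid_scheme \<Rightarrow> (complex \<times> 'a) list \<Rightarrow> 'a operator" where
  "gcomb G [] = 0"
| "gcomb G (x # p) = op_smul (fst x) (left_regular G (snd x)) + gcomb G p"

text \<open>
Lists for products, adjoints and scalar multiples of group algebra elements.
\<close>

definition gmult :: "('a, 'm) monoid_scheme \<Rightarrow> (complex \<times> 'a) list \<Rightarrow> (complex \<times> 'a) list \<Rightarrow> (complex \<times> 'a) list" where
  "gmult G p q = concat (map (\<lambda>x. map (\<lambda>y. (fst x * fst y, snd x \<otimes>\<^bsub>G\<^esub> snd y)) q) p)"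

definition gadj :: "('a, 'm) monoid_scheme \<Rightarrow> (complex \<times> 'a) list \<Rightarrow> (complex \<times> 'a) list" where
  "gadj G p = map (\<lambda>x. (cnj (fst x), inv\<^bsub>G\<^esub> (snd x))) p"

definition gscale :: "complex \<Rightarrow> (complex \<times> 'x) list \<Rightarrow> (complex \<times> 'x) list" where
  "gscale c p = map (\<lambda>x. (c * fst x, snd x)) p"

lemma gcomb_append: "gcomb G (p @ q) = gcomb G p + gcomb G q"
  by (induction p) (auto simp: add.assoc)

lemma gcomb_gscale: "gcomb G (gscale c p) = op_smul c (gcomb G p)"
  by (induction p) (auto simp: gscale_def smul_add fun_eq_iff algebra_simps)

context group
begin

text \<open>
The group elements in the list belong to the carrier.
\<close>

definition supported :: "(complex \<times> 'a) list \<Rightarrow> bool" where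
  "supported p \<longleftrightarrow> snd ` set p \<subseteq> A"

lemma supported_simps [simp]: "supported []" "supported (x # p) \<longleftrightarrow> snd x \<in> A \<and> supported p"
  "supported (p @ q) \<longleftrightarrow> supported p \<and> supported q" "supported (gscale c p) \<longleftrightarrow> supported p"
  by (auto simp: supported_def gscale_def image_image)

lemma supported_gmult [simp]: "supported p \<Longrightarrow> supported q \<Longrightarrow> supported (gmult G p q)"
  and supported_gadj [simp]: "supported p \<Longrightarrow> supported (gadj G p)"
  by (fastforce simp: supported_def gmult_def gadj_def)+

lemma commutant_gcomb [simp, intro]: "supported p \<Longrightarrow> gcomb G p \<in> commutant"
  by (induction p) auto

lemma gcomb_gadj: "supported p \<Longrightarrow> gcomb G (gadj G p) = adjoint_op A (gcomb G p)"
  by (induction p) (auto simp: gadj_def adjoint_add adjoint_op_smul adjoint_left_regular)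

lemma gcomb_mult_single:
  assumes "supported q" "g \<in> A"
  shows "gcomb G (map (\<lambda>y. (c * fst y, g \<otimes> snd y)) q) = op_smul c (left_regular G g) \<circ> gcomb G q"
  using assms(1)
proof (induction q)
  case Nil
  show ?case
    using bop_zero [OF bop_left_regular [OF assms(2)]] by (intro ext) (simp only: comp_apply gcomb.simps list.map zero_fun_apply [where x = "_ :: 'a \<Rightarrow> complex"] smul_simps)
next
  case (Cons y q)
  have T: "op_smul c (left_regular G g) \<in> bounded_operators A"
    using assms by auto
  have "(op_smul c (left_regular G g) \<circ> gcomb G (y # q)) f =
      gcomb G (map (\<lambda>y. (c * fst y, g \<otimes> snd y)) (y # q)) f" for f
  proof -
    have y: "snd y \<in> A" and q: "supported q"
      using Cons.prems by auto
    have "left_regular G g (smul (fst y) (left_regular G (snd y) f)) =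
        smul (fst y) (left_regular G (g \<otimes> snd y) f)"
      using bop_smul [OF bop_left_regular [OF assms(2)] bop_l2 [OF bop_left_regular [OF y]], of "fst y" f]
        left_regular_comp [OF assms(2) y] by (metis comp_apply)
    moreover have "left_regular G g (smul (fst y) (left_regular G (snd y) f) + gcomb G q f) =
        left_regular G g (smul (fst y) (left_regular G (snd y) f)) + left_regular G g (gcomb G q f)"
      by (rule bop_add [OF bop_left_regular [OF assms(2)]])
        (use y q in \<open>auto intro!: l2_smul bop_l2 [OF bop_left_regular]\<close>)
    moreover have "gcomb G (map (\<lambda>y. (c * fst y, g \<otimes> snd y)) q) f = smul c (left_regular G g (gcomb G q f))"
      by (simp only: Cons.IH [OF q] comp_apply)
    ultimately show ?thesis
      by (simp add: smul_add)
  qed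
  then show ?case
    by (metis ext)
qed

lemma gcomb_gmult:
  assumes "supported p" "supported q"
  shows "gcomb G (gmult G p q) = gcomb G p \<circ> gcomb G q"
  using assms
proof (induction p)
  case Nil
  then show ?case by (auto simp: gmult_def fun_eq_iff)
next
  case (Cons x p)
  have "gmult G (x # p) q = map (\<lambda>y. (fst x * fst y, snd x \<otimes> snd y)) q @ gmult G p q"
    by (simp add: gmult_def)
  then show ?case
    using Cons by (simp add: gcomb_append gcomb_mult_single fun_eq_iff)
qed

lemma gcomb_in_group_algebra:
  assumes "supported p"
  shows "gcomb G p \<in> group_algebra G"
proof -
  have "\<exists>F c. gcomb G p = (\<lambda>f x. \<Sum>g\<in>F. c g * left_regular G g f x) \<and> finite F \<and> F \<subseteq> A"
    using assms
  proof (induction p)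
    case Nil
    show ?case
      by (rule exI [of _ "{}"]) (auto simp: fun_eq_iff)
  next
    case (Cons y p)
    then obtain F c where F: "gcomb G p = (\<lambda>f x. \<Sum>g\<in>F. c g * left_regular G g f x)" "finite F" "F \<subseteq> A"
      by auto
    define c' where "c' = (\<lambda>g. (if g = snd y then fst y else 0) + (if g \<in> F then c g else 0))"
    have "gcomb G (y # p) f x = (\<Sum>g\<in>insert (snd y) F. c' g * left_regular G g f x)" for f x
    proof -
      have "(\<Sum>g\<in>insert (snd y) F. c' g * left_regular G g f x) =
          (\<Sum>g\<in>insert (snd y) F. (if g = snd y then fst y * left_regular G g f x else 0)) +
          (\<Sum>g\<in>insert (snd y) F. (if g \<in> F then c g * left_regular G g f x else 0))"
        unfolding sum.distrib [symmetric] by (rule sum.cong) (auto simp: c'_def ring_distribs)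
      moreover have "(\<Sum>g\<in>insert (snd y) F. (if g \<in> F then c g * left_regular G g f x else 0)) =
          (\<Sum>g\<in>F. c g * left_regular G g f x)"
        by (rule sum.mono_neutral_cong_right) (use F in auto)
      ultimately show ?thesis
        using F by simp
    qed
    moreover have "insert (snd y) F \<subseteq> A"
      using Cons.prems F(3) by simp
    ultimately show ?case
      using F(2) by (intro exI [of _ "insert (snd y) F"] exI [of _ c']) (auto simp del: gcomb.simps)
  qed
  then show ?thesis
    by (auto simp: group_algebra_def)
qed

lemma group_algebra_commutant: "group_algebra G \<subseteq> commutant"
proof
  fix T assume "T \<in> group_algebra G"
  then obtain F c where T: "T = (\<lambda>f x. \<Sum>g\<in>F. c g * left_regular G g f x)" "finite F" "F \<subseteq> A"
    by (auto simp: group_algebra_def)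
  have "(\<lambda>f x. \<Sum>g\<in>F. c g * left_regular G g f x) \<in> commutant"
    using T(2,3)
  proof (induction F)
    case empty
    then show ?case
      using commutant_0 by (simp add: zero_fun_def)
  next
    case (insert g F)
    have "(\<lambda>f x. \<Sum>g\<in>insert g F. c g * left_regular G g f x) =
        op_smul (c g) (left_regular G g) + (\<lambda>f x. \<Sum>g\<in>F. c g * left_regular G g f x)"
      using insert by (auto simp: fun_eq_iff)
    then show ?case
      using insert by auto
  qed
  then show "T \<in> commutant"
    using T by simp
qed


section \<open>The group von Neumann algebra between the group algebra and the commutant\<close>

lemma topspace_sot: "topspace (strong_operator_topology A) = bounded_operators A"
proof -
  have "T \<in> topspace (strong_operator_topology A)" if T: "T \<in> bounded_operators A" for T
  proof -
    have "{T' \<in> bounded_operators A. l2_norm A (\<lambda>x. T' 0 x - T 0 x) < 1} \<in>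
      {{T \<in> bounded_operators A. l2_norm A (\<lambda>x. T f x - S f x) < \<epsilon>} | S f \<epsilon>.
        S \<in> bounded_operators A \<and> f \<in> l2 A \<and> \<epsilon> > 0}"
      by (rule CollectI, intro exI [of _ T] exI [of _ "0 :: 'a \<Rightarrow> complex"] exI [of _ "1 :: real"])
        (use T in simp)
    moreover have "T \<in> {T' \<in> bounded_operators A. l2_norm A (\<lambda>x. T' 0 x - T 0 x) < 1}"
      using T by (simp add: l2_norm_def)
    ultimately show ?thesis
      unfolding strong_operator_topology_def topology_generated_by_topspace by blast
  qed
  moreover have "topspace (strong_operator_topology A) \<subseteq> bounded_operators A"
    unfolding strong_operator_topology_def topology_generated_by_topspace by auto
  ultimately show ?thesis by blast
qed

lemma openin_sot:
  assumes "S \<in> bounded_operators A" "f \<in> l2 A" "\<epsilon> > 0"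
  shows "openin (strong_operator_topology A) {T \<in> bounded_operators A. l2_norm A (T f - S f) < \<epsilon>}"
  unfolding strong_operator_topology_def fun_diff_def
  by (rule topology_generated_by_Basis) (use assms in blast)

lemma gcomb_in_vN:
  assumes "supported p"
  shows "gcomb G p \<in> group_vN_algebra G"
proof -
  have "group_algebra G \<subseteq> topspace (strong_operator_topology A)"
    using group_algebra_commutant by (auto simp: topspace_sot)
  then have "group_algebra G \<subseteq> group_vN_algebra G"
    unfolding group_vN_algebra_def by (rule closure_of_subset)
  then show ?thesis
    using gcomb_in_group_algebra [OF assms] by blast
qed

text \<open>
  Commuting with right translations is preserved by limits in the strong operator topology.
\<close>

lemma vN_in_commutant: "group_vN_algebra G \<subseteq> commutant"
proof
  fix T assume T: "T \<in> group_vN_algebra G"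
  have B: "T \<in> bounded_operators A"
    using T by (simp add: group_vN_algebra_def in_closure_of topspace_sot)
  have "T (rtrans g f) = rtrans g (T f)" if g: "g \<in> A" and f: "f \<in> l2 A" for g f
  proof -
    have le: "l2_norm A (T (rtrans g f) - rtrans g (T f)) \<le> 0 + \<epsilon>" if "\<epsilon> > 0" for \<epsilon>
    proof -
      let ?U = "\<lambda>f. {T' \<in> bounded_operators A. l2_norm A (T' f - T f) < \<epsilon> / 2}"
      have "openin (strong_operator_topology A) (?U f \<inter> ?U (rtrans g f))"
        using B g f \<open>\<epsilon> > 0\<close> by (intro openin_Int openin_sot) auto
      moreover have "T \<in> ?U f \<inter> ?U (rtrans g f)"
        using B \<open>\<epsilon> > 0\<close> by simp
      ultimately obtain S where S: "S \<in> group_algebra G" "S \<in> ?U f \<inter> ?U (rtrans g f)"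
        using T unfolding group_vN_algebra_def in_closure_of by meson
      have SC: "S \<in> commutant"
        using S(1) group_algebra_commutant by blast
      have "T (rtrans g f) - rtrans g (T f) = (T (rtrans g f) - S (rtrans g f)) + rtrans g (S f - T f)"
        by (simp add: commutant_rtrans [OF SC g f] rtrans_diff)
      then have "l2_norm A (T (rtrans g f) - rtrans g (T f)) \<le>
          l2_norm A (T (rtrans g f) - S (rtrans g f)) + l2_norm A (rtrans g (S f - T f))"
        using l2_norm_triangle [of "T (rtrans g f) - S (rtrans g f)" A "rtrans g (S f - T f)"] g f B SC
      by (simp only:) auto
      also have "\<dots> \<le> \<epsilon> / 2 + \<epsilon> / 2"
        using S(2) g by (intro add_mono) (auto simp: l2_norm_minus_commute [of A "T (rtrans g f)"])
      finally show ?thesis by simp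
    qed
    have "l2_norm A (T (rtrans g f) - rtrans g (T f)) \<le> 0"
      by (rule field_le_epsilon) (rule le)
    then have "T (rtrans g f) - rtrans g (T f) = 0"
      using g f B by (intro l2_norm_eq_0D [of _ A] order_antisym) auto
    then show ?thesis by simp
  qed
  then show "T \<in> commutant"
    using B by (intro commutantI) auto
qed

end

section \<open>Density of the unit ball of the group algebra\<close>

lemma quadratic_bound:
  fixes g h u w :: real
  assumes "g\<^sup>2 + h\<^sup>2 \<le> u * g + w * h" "0 \<le> u" "0 \<le> w"
  shows "g \<le> u + w / 2"
proof (rule ccontr)
  assume "\<not> g \<le> u + w / 2"
  then have g: "g > u + w / 2" by simp
  have "w * h - h\<^sup>2 \<le> (w / 2)\<^sup>2"
    using zero_le_power2 [of "h - w / 2"] by (simp add: power2_eq_square algebra_simps)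
  then have "g * (g - u) \<le> (w / 2)\<^sup>2"
    using assms(1) by (simp add: power2_eq_square algebra_simps)
  moreover have "(w / 2) * (w / 2) < g * (g - u)"
    by (rule mult_strict_mono') (use g assms in linarith)+
  ultimately show False
    by (simp add: power2_eq_square)
qed

text \<open>
  The estimates $\|(1 + x x^*)^{-1}\| \le 1$ and $\|(1 + x x^*)^{-1} x\| \le 1/2$ in one statement that
  does not mention inverses. It follows by pairing the equation with \<open>g\<close>, because
  $\langle g + x x^* g, g \rangle = \|g\|^2 + \|x^* g\|^2$.
\<close>

lemma l2_coercive:
  assumes x: "x \<in> bounded_operators A" and l2: "g \<in> l2 A" "u \<in> l2 A" "w \<in> l2 A"
    and eq: "g + x (adjoint_op A x g) = u + x w"
  shows "l2_norm A g \<le> l2_norm A u + l2_norm A w / 2"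
proof (rule quadratic_bound)
  let ?h = "adjoint_op A x g"
  have h: "?h \<in> l2 A" and xh: "x ?h \<in> l2 A" and xw: "x w \<in> l2 A"
    using x by auto
  have "complex_of_real ((l2_norm A g)\<^sup>2 + (l2_norm A ?h)\<^sup>2) = l2_inner A (g + x ?h) g"
    by (simp only: l2_inner_add_left [OF l2(1) xh l2(1)] l2_inner_adjoint [OF x h l2(1)]
        l2_inner_self [OF l2(1)] l2_inner_self [OF h] of_real_add)
  also have "\<dots> = l2_inner A u g + l2_inner A w ?h"
    by (simp only: eq l2_inner_add_left [OF l2(2) xw l2(1)] l2_inner_adjoint [OF x l2(3,1)])
  finally have "(l2_norm A g)\<^sup>2 + (l2_norm A ?h)\<^sup>2 = Re (l2_inner A u g) + Re (l2_inner A w ?h)"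
    by (metis Re_complex_of_real plus_complex.sel(1))
  also have "\<dots> \<le> l2_norm A u * l2_norm A g + l2_norm A w * l2_norm A ?h"
    using l2 h by (intro add_mono order_trans [OF complex_Re_le_cmod l2_Cauchy_Schwarz])
  finally show "(l2_norm A g)\<^sup>2 + (l2_norm A ?h)\<^sup>2 \<le> l2_norm A u * l2_norm A g + l2_norm A w * l2_norm A ?h" .
qed auto

text \<open>
  With $a = (1 + x x^*) v$, the bounds $\|v\|^2 \le {\rm Re} \langle v, a \rangle$ and
  $\|a\| \le (1 + K^2) \|v\|$ make $1 - (1 + x x^*)/c$ a strict contraction for
  $c = (1 + K^2)^2$.
\<close>

lemma l2_contraction:
  assumes x: "x \<in> bounded_operators A" and K: "op_le A x K" "K \<ge> 1" and v: "v \<in> l2 A"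
  defines "c \<equiv> (1 + K * K)\<^sup>2"
  shows "l2_norm A (v - smul (complex_of_real (1 / c)) (v + x (adjoint_op A x v))) \<le> sqrt (1 - 1 / c) * l2_norm A v"
proof (rule power2_le_imp_le)
  define a where "a = v + x (adjoint_op A x v)"
  have c: "c \<ge> 1"
    unfolding c_def using K(2) by (intro one_le_power) auto
  have h: "adjoint_op A x v \<in> l2 A" and xh: "x (adjoint_op A x v) \<in> l2 A" and a: "a \<in> l2 A"
    using x v by (auto simp: a_def)
  have "l2_norm A a \<le> l2_norm A v + l2_norm A (x (adjoint_op A x v))"
    unfolding a_def by (rule l2_norm_triangle [OF v xh])
  also have "l2_norm A (x (adjoint_op A x v)) \<le> K * (K * l2_norm A v)"
    using op_leD [OF K(1) h] op_leD [OF op_le_adjoint [OF x K(1)] v] K(2)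
      mult_left_mono [of "l2_norm A (adjoint_op A x v)" "K * l2_norm A v" K] by linarith
  finally have "l2_norm A a \<le> (1 + K * K) * l2_norm A v"
    by (simp add: algebra_simps)
  then have na: "(l2_norm A a)\<^sup>2 \<le> c * (l2_norm A v)\<^sup>2"
    unfolding c_def power_mult_distrib [symmetric] by (intro power_mono) auto
  have "l2_inner A v (x (adjoint_op A x v)) = l2_inner A (adjoint_op A x v) (adjoint_op A x v)"
    by (rule l2_inner_adjoint' [OF x v h, symmetric])
  then have "l2_inner A v a = complex_of_real ((l2_norm A v)\<^sup>2 + (l2_norm A (adjoint_op A x v))\<^sup>2)"
    unfolding a_def
    by (simp only: l2_inner_add_right [OF v xh v] l2_inner_self [OF v] l2_inner_self [OF h] of_real_add)
  then have va: "Re (l2_inner A v a) \<ge> (l2_norm A v)\<^sup>2"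
    by simp
  have "(l2_norm A (v - smul (complex_of_real (1 / c)) a))\<^sup>2 =
      (l2_norm A (v + smul (complex_of_real (- 1 / c)) a))\<^sup>2"
    by (simp add: diff_eq_add_smul)
  also have "\<dots> = (l2_norm A v)\<^sup>2 - 2 / c * Re (l2_inner A v a) + (1 / c)\<^sup>2 * (l2_norm A a)\<^sup>2"
    using v a c by (simp add: l2_norm_add_sq l2_inner_smul_right power_mult_distrib norm_divide power_divide del: of_real_divide)
  also have "\<dots> \<le> (l2_norm A v)\<^sup>2 - 2 / c * (l2_norm A v)\<^sup>2 + (1 / c)\<^sup>2 * (c * (l2_norm A v)\<^sup>2)"
    using va na c by (intro add_mono diff_mono mult_left_mono) auto
  also have "\<dots> = (1 - 1 / c) * (l2_norm A v)\<^sup>2"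
    using c by (simp add: field_simps power2_eq_square)
  also have "\<dots> = (sqrt (1 - 1 / c) * l2_norm A v)\<^sup>2"
    using c by (simp add: power_mult_distrib)
  finally show "(l2_norm A (v - smul (complex_of_real (1 / c)) (v + x (adjoint_op A x v))))\<^sup>2 \<le> (sqrt (1 - 1 / c) * l2_norm A v)\<^sup>2"
    by (simp add: a_def)
  show "0 \<le> sqrt (1 - 1 / c) * l2_norm A v"
    using c by (intro mult_nonneg_nonneg) auto
qed

context group
begin

text \<open>
The group algebra, described by lists.
\<close>

definition galg :: "'a operator set" where
  "galg = {gcomb G p | p. supported p}"

lemma galg_gcomb [intro]: "supported p \<Longrightarrow> gcomb G p \<in> galg"
  by (auto simp: galg_def)

lemma galgE: "T \<in> galg \<Longrightarrow> (\<And>p. T = gcomb G p \<Longrightarrow> supported p \<Longrightarrow> thesis) \<Longrightarrow> thesis"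
  by (auto simp: galg_def)

lemma galg_commutant: "T \<in> galg \<Longrightarrow> T \<in> commutant"
  by (auto simp: galg_def)

lemma galg_0: "0 \<in> galg"
  using galg_gcomb [of "[]"] by simp

lemma galg_add: "S \<in> galg \<Longrightarrow> T \<in> galg \<Longrightarrow> S + T \<in> galg"
  by (elim galgE) (simp add: galg_gcomb flip: gcomb_append)

lemma galg_op_smul: "T \<in> galg \<Longrightarrow> op_smul c T \<in> galg"
  by (elim galgE) (simp only: gcomb_gscale [symmetric], simp add: galg_gcomb)

lemma galg_diff: "S \<in> galg \<Longrightarrow> T \<in> galg \<Longrightarrow> S - T \<in> galg"
  unfolding operator_diff_eq by (intro galg_add galg_op_smul)

lemma galg_comp: "S \<in> galg \<Longrightarrow> T \<in> galg \<Longrightarrow> S \<circ> T \<in> galg"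
  by (elim galgE) (simp add: galg_gcomb flip: gcomb_gmult)

lemma galg_adjoint: "T \<in> galg \<Longrightarrow> adjoint_op A T \<in> galg"
  by (elim galgE) (simp add: galg_gcomb flip: gcomb_gadj)

lemma gcomb_delta_one:
  assumes "distinct xs" "set xs \<subseteq> A"
  shows "gcomb G (map (\<lambda>a. (c a, a)) xs) (delta \<one>) = (\<Sum>a\<in>set xs. smul (c a) (delta a))"
  using assms
proof (induction xs)
  case (Cons a xs)
  then have "left_regular G a (delta \<one>) = delta a"
    using left_regular_indicator [OF is_group, of a \<one>] by simp
  with Cons show ?case by simp
qed simp

lemma galg_dense_norm2:
  assumes "T \<in> commutant" "\<epsilon> > 0"
  obtains x where "x \<in> galg" "norm2 (x - T) < \<epsilon>"
proof -
  have l2: "T (delta \<one>) \<in> l2 A"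
    using assms(1) by auto
  obtain F where F: "finite F" "F \<subseteq> A" "l2_norm A (T (delta \<one>) - (\<Sum>a\<in>F. smul (T (delta \<one>) a) (delta a))) < \<epsilon>"
    by (rule l2_approx_finite [OF l2 assms(2)])
  obtain xs where xs: "distinct xs" "set xs = F"
    using finite_distinct_list [OF F(1)] by blast
  let ?p = "map (\<lambda>a. (T (delta \<one>) a, a)) xs"
  have "supported ?p"
    using xs F(2) by (auto simp: supported_def)
  moreover have "norm2 (gcomb G ?p - T) < \<epsilon>"
    using gcomb_delta_one [of xs "T (delta \<one>)"] xs F
    by (simp add: norm2_def l2_norm_minus_commute [of A _ "T (delta \<one>)"])
  ultimately show ?thesis
    using that by blast
qed

text \<open>
  The iterates, starting from 0, for the fixed point equation $2 S = T + S S^* T$.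
\<close>

primrec cayley_iter :: "'a operator \<Rightarrow> nat \<Rightarrow> 'a operator" where
  "cayley_iter T 0 = 0"
| "cayley_iter T (Suc k) = op_smul (1 / 2) (T + (cayley_iter T k \<circ> (adjoint_op A (cayley_iter T k) \<circ> T)))"

lemma cayley_iter:
  assumes T: "T \<in> commutant" and \<rho>: "op_le A T \<rho>" "0 \<le> \<rho>" "\<rho> \<le> 1"
  shows "cayley_iter T k \<in> commutant" "op_le A (cayley_iter T k) 1"
proof (induction k)
  case 0
  have "cayley_iter T 0 \<in> commutant" "op_le A (cayley_iter T 0) 1"
    by (simp_all add: op_le_zero)
  then show "cayley_iter T 0 \<in> commutant" "op_le A (cayley_iter T 0) 1" .
next
  case (Suc k)
  { case 1
    have "op_smul (1 / 2) (T + (cayley_iter T k \<circ> (adjoint_op A (cayley_iter T k) \<circ> T))) \<in> commutant"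
      using Suc T by (intro commutant_op_smul commutant_add commutant_comp commutant_adjoint)
    then show ?case by (simp only: cayley_iter.simps) }
  { case 2
    have "op_le A (op_smul (1 / 2) (T + (cayley_iter T k \<circ> (adjoint_op A (cayley_iter T k) \<circ> T))))
        (cmod (1 / 2) * (\<rho> + 1 * (1 * \<rho>)))"
      using T Suc \<rho> by (intro op_le_op_smul op_le_add op_le_comp op_le_adjoint) auto
    then have "op_le A (cayley_iter T (Suc k)) (cmod (1 / 2) * (\<rho> + 1 * (1 * \<rho>)))"
      by (simp only: cayley_iter.simps)
    then show ?case
      by (rule op_le_mono) (use \<rho> in simp) }
qed

lemma cayley_iter_diff:
  assumes T: "T \<in> commutant" and \<rho>: "op_le A T \<rho>" "0 \<le> \<rho>" "\<rho> \<le> 1"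
  shows "op_le A (cayley_iter T (Suc k) - cayley_iter T k) (\<rho> ^ k)"
proof (induction k)
  case 0
  show ?case
  proof -
    have "cayley_iter T (Suc 0) - cayley_iter T 0 = cayley_iter T (Suc 0)"
      by (simp only: cayley_iter.simps(1) diff_zero)
    with cayley_iter(2) [OF assms, of "Suc 0"] show ?thesis
      by (simp only: power_0)
  qed
next
  case (Suc k)
  define S S' where "S = cayley_iter T k" and "S' = cayley_iter T (Suc k)"
  have S: "S \<in> commutant" "op_le A S 1" and S': "S' \<in> commutant" "op_le A S' 1"
    unfolding S_def S'_def using cayley_iter [OF assms] by blast+
  have B: "S \<in> bounded_operators A" "S' \<in> bounded_operators A" "T \<in> bounded_operators A"
    using S S' T by auto
  let ?D = "S' - S"
  let ?R = "op_smul (1 / 2) ((?D \<circ> (adjoint_op A S' \<circ> T)) + (S \<circ> (adjoint_op A ?D \<circ> T)))"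
  have "cayley_iter T (Suc (Suc k)) - cayley_iter T (Suc k) = ?R"
  proof (rule ext)
    fix f
    let ?v = "T f"
    have v: "?v \<in> l2 A"
      using B by auto
    have 1: "adjoint_op A ?D ?v = adjoint_op A S' ?v - adjoint_op A S ?v"
      using adjoint_diff [OF B(2,1)] by simp
    have 2: "S (adjoint_op A S' ?v - adjoint_op A S ?v) = S (adjoint_op A S' ?v) - S (adjoint_op A S ?v)"
      by (rule bop_diff [OF B(1)]) (use B in auto)
    have "(cayley_iter T (Suc (Suc k)) - cayley_iter T (Suc k)) f =
        smul (1 / 2) (T f + S' (adjoint_op A S' ?v)) - smul (1 / 2) (T f + S (adjoint_op A S ?v))"
      by (simp add: S_def S'_def)
    also have "\<dots> = smul (1 / 2) ((S' (adjoint_op A S' ?v) - S (adjoint_op A S' ?v)) +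
        (S (adjoint_op A S' ?v) - S (adjoint_op A S ?v)))"
      by (simp add: smul_diff [symmetric])
    also have "\<dots> = ?R f"
      by (simp only: comp_apply plus_fun_apply minus_apply 1 2)
    finally show "(cayley_iter T (Suc (Suc k)) - cayley_iter T (Suc k)) f = ?R f" .
  qed
  moreover have "op_le A ?R (cmod (1 / 2) * (\<rho> ^ k * (1 * \<rho>) + 1 * (\<rho> ^ k * \<rho>)))"
  proof -
    have D: "op_le A ?D (\<rho> ^ k)"
      using Suc.IH by (simp only: S_def S'_def)
    show ?thesis
      using S S' B T \<rho> D
      by (intro op_le_op_smul op_le_add op_le_comp op_le_adjoint bop_comp bop_adjoint bop_minus) auto
  qed
  ultimately have "op_le A (cayley_iter T (Suc (Suc k)) - cayley_iter T (Suc k))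
      (cmod (1 / 2) * (\<rho> ^ k * (1 * \<rho>) + 1 * (\<rho> ^ k * \<rho>)))"
    by (simp only:)
  then show ?case
    by (rule op_le_mono) (simp add: norm_divide)
qed

text \<open>
  The iterates, starting from 0, for the linear equation $(1 + x x^*) y = 2 x$ with step \<open>1 / c\<close>.
  They are polynomials in $x$ and $x^*$ and stay in the group algebra.
\<close>

primrec resolvent_iter :: "'a operator \<Rightarrow> real \<Rightarrow> nat \<Rightarrow> 'a operator" where
  "resolvent_iter x c 0 = 0"
| "resolvent_iter x c (Suc j) = resolvent_iter x c j + op_smul (complex_of_real (1 / c))
     (op_smul 2 x - (resolvent_iter x c j + (x \<circ> (adjoint_op A x \<circ> resolvent_iter x c j))))"

lemma resolvent_approx:
  assumes x: "x \<in> galg" and "\<eta> > 0"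
  obtains y where "y \<in> galg" "op_le A (op_smul 2 x - (y + (x \<circ> (adjoint_op A x \<circ> y)))) \<eta>"
proof -
  have xB: "x \<in> bounded_operators A"
    using x by (auto dest: galg_commutant)
  obtain K where K: "K \<ge> 1" "op_le A x K"
    using bop_bound [OF xB] by blast
  define c where "c = (1 + K * K)\<^sup>2"
  have c: "c > 1"
    unfolding c_def using K(1) by (intro one_less_power) (auto simp: zero_less_mult_iff)
  define q where "q = sqrt (1 - 1 / c)"
  have q: "0 \<le> q" "q < 1"
    using c by (auto simp: q_def field_simps)
  let ?y = "resolvent_iter x c"
  define d where "d j = op_smul 2 x - (?y j + (x \<circ> (adjoint_op A x \<circ> ?y j)))" for j
  have yA: "?y j \<in> galg" for j
  proof (induction j)
    case 0
    have "?y 0 \<in> galg"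
      by (simp only: resolvent_iter.simps galg_0)
    then show ?case .
  next
    case (Suc j)
    have "?y (Suc j) \<in> galg"
      unfolding resolvent_iter.simps
      by (intro galg_add galg_op_smul galg_diff galg_comp galg_adjoint x Suc)
    then show ?case .
  qed
  then have yB: "?y j \<in> bounded_operators A" for j
    by (auto dest: galg_commutant)
  have dB: "d j \<in> bounded_operators A" for j
    unfolding d_def using xB yB by auto
  have bound: "op_le A (d j) (q ^ j * (2 * K))" for j
  proof (induction j)
    case 0
    have "d 0 = op_smul 2 x"
      unfolding d_def using bop_zero [OF xB] bop_zero [OF bop_adjoint [OF xB]]
      by (intro ext) (simp only: resolvent_iter.simps comp_apply plus_fun_apply minus_apply zero_fun_apply [where x = "_ :: 'a \<Rightarrow> complex"], simp)
    with op_le_op_smul [OF K(2), of 2] have "op_le A (d 0) (cmod 2 * K)"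
      by (simp only:)
    then show ?case
      by (rule op_le_mono) simp
  next
    case (Suc j)
    have step: "d (Suc j) f = d j f - smul (complex_of_real (1 / c)) (d j f + x (adjoint_op A x (d j f)))" for f
    proof -
      let ?s = "smul (complex_of_real (1 / c))"
      have m: "?y j f \<in> l2 A" "d j f \<in> l2 A" "?s (d j f) \<in> l2 A"
        using yB dB by auto
      have 1: "?y (Suc j) f = ?y j f + ?s (d j f)"
        by (simp add: d_def)
      have 2: "adjoint_op A x (?y j f + ?s (d j f)) = adjoint_op A x (?y j f) + ?s (adjoint_op A x (d j f))"
        using m xB by (simp only: bop_add [OF bop_adjoint [OF xB] m(1,3)] bop_smul [OF bop_adjoint [OF xB] m(2)])
      have m': "adjoint_op A x (?y j f) \<in> l2 A" "adjoint_op A x (d j f) \<in> l2 A" "?s (adjoint_op A x (d j f)) \<in> l2 A"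
        using xB by auto
      have 3: "x (adjoint_op A x (?y j f) + ?s (adjoint_op A x (d j f))) =
          x (adjoint_op A x (?y j f)) + ?s (x (adjoint_op A x (d j f)))"
        using m' xB by (simp only: bop_add [OF xB m'(1,3)] bop_smul [OF xB m'(2)])
      have "d (Suc j) f = smul 2 (x f) - (?y (Suc j) f + x (adjoint_op A x (?y (Suc j) f)))"
        by (simp only: d_def comp_apply plus_fun_apply minus_apply)
      also have "\<dots> = smul 2 (x f) - (?y j f + ?s (d j f) + (x (adjoint_op A x (?y j f)) + ?s (x (adjoint_op A x (d j f)))))"
        by (simp only: 1 2 3)
      also have "\<dots> = (smul 2 (x f) - (?y j f + x (adjoint_op A x (?y j f)))) - ?s (d j f + x (adjoint_op A x (d j f)))"
        by (simp only: smul_add) (simp add: algebra_simps)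
      also have "smul 2 (x f) - (?y j f + x (adjoint_op A x (?y j f))) = d j f"
        by (simp only: d_def comp_apply plus_fun_apply minus_apply)
      finally show ?thesis .
    qed
    have "l2_norm A (d (Suc j) f) \<le> q ^ Suc j * (2 * K) * l2_norm A f" if f: "f \<in> l2 A" for f
    proof -
      have "d j f \<in> l2 A"
        using dB by auto
      from l2_contraction [OF xB K(2,1) this]
      have "l2_norm A (d (Suc j) f) \<le> q * l2_norm A (d j f)"
        unfolding step q_def c_def by simp
      also have "\<dots> \<le> q * (q ^ j * (2 * K) * l2_norm A f)"
        using q by (intro mult_left_mono op_leD [OF Suc f]) auto
      finally show ?thesis by (simp add: mult_ac)
    qed
    then show ?case
      by (simp add: op_le_def)
  qed
  have "(\<lambda>j. q ^ j * (2 * K)) \<longlonglongrightarrow> 0 * (2 * K)"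
    by (intro tendsto_mult LIMSEQ_power_zero tendsto_const) (use q in auto)
  then have "\<forall>\<^sub>F j in sequentially. q ^ j * (2 * K) < \<eta>"
    using \<open>\<eta> > 0\<close> by (intro order_tendstoD) auto
  then obtain j where "q ^ j * (2 * K) < \<eta>"
    by (auto simp: eventually_sequentially)
  then have "op_le A (d j) \<eta>"
    using bound [of j] op_le_mono less_imp_le by blast
  then show ?thesis
    using that yA unfolding d_def by blast
qed

text \<open>
  The unit ball of the group algebra is dense, in the 2-norm, in the unit ball of the commutant.
\<close>

theorem Kaplansky_density_unit:
  assumes T: "T \<in> commutant" "op_le A T 1" and "\<epsilon> > 0"
  obtains y where "y \<in> galg" "op_le A y 1" "norm2 (y - T) < \<epsilon>"
proof -
  define e where "e = min (1 / 2) (\<epsilon> / 10)"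
  have e: "0 < e" "e \<le> 1 / 2" "10 * e \<le> \<epsilon>"
    using \<open>\<epsilon> > 0\<close> by (auto simp: e_def)
  \<comment> \<open>Shrinking \<open>T\<close> slightly makes the iteration for \<open>S\<close> contract.\<close>
  define \<rho> where "\<rho> = 1 - e"
  have \<rho>: "0 \<le> \<rho>" "\<rho> < 1" "\<rho> \<le> 1"
    using e by (auto simp: \<rho>_def)
  define T' where "T' = op_smul (complex_of_real \<rho>) T"
  have T': "T' \<in> commutant" "op_le A T' \<rho>"
    using T op_le_op_smul [OF T(2), of "complex_of_real \<rho>"] \<rho> by (auto simp: T'_def)
  have "norm2 (T' - T) = norm2 (op_smul (complex_of_real (- e)) T)"
    by (rule arg_cong [of _ _ norm2]) (auto simp: T'_def \<rho>_def fun_eq_iff algebra_simps)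
  also have "\<dots> \<le> e"
    using norm2_le [OF T(2)] e by (simp add: norm2_op_smul del: of_real_minus)
  finally have TT': "norm2 (T' - T) \<le> e" .
  have "(\<lambda>k. 2 * \<rho> ^ k) \<longlonglongrightarrow> 2 * 0"
    by (intro tendsto_mult LIMSEQ_power_zero tendsto_const) (use \<rho> in auto)
  then have "\<forall>\<^sub>F k in sequentially. 2 * \<rho> ^ k < e"
    using e by (intro order_tendstoD) auto
  then obtain k where k: "2 * \<rho> ^ k < e"
    by (auto simp: eventually_sequentially)
  define S where "S = cayley_iter T' k"
  define E where "E = op_smul 2 (cayley_iter T' (Suc k) - S)"
  have S: "S \<in> commutant" "op_le A S 1"
    using cayley_iter [OF T' \<rho>(1,3)] by (auto simp: S_def)
  have EC: "E \<in> commutant"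
    unfolding E_def S_def using cayley_iter [OF T' \<rho>(1,3)] by blast
  have "op_le A E (cmod 2 * \<rho> ^ k)"
    unfolding E_def S_def by (intro op_le_op_smul cayley_iter_diff T' \<rho>)
  then have E: "op_le A E e"
    by (rule op_le_mono) (use k in simp)
  obtain x where x: "x \<in> galg" "norm2 (x - S) < e"
    using galg_dense_norm2 [OF S(1) e(1)] by blast
  obtain y where y: "y \<in> galg" and yd: "op_le A (op_smul 2 x - (y + (x \<circ> (adjoint_op A x \<circ> y)))) e"
    using resolvent_approx [OF x(1) e(1)] by blast
  define d where "d = op_smul 2 x - (y + (x \<circ> (adjoint_op A x \<circ> y)))"
  have xC: "x \<in> commutant" and yC: "y \<in> commutant"
    using x y by (auto dest: galg_commutant)
  then have dC: "d \<in> commutant"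
    unfolding d_def by (intro commutant_diff commutant_add commutant_comp commutant_adjoint commutant_op_smul)
  note d = yd [folded d_def]
  have B: "x \<in> bounded_operators A" "y \<in> bounded_operators A" "d \<in> bounded_operators A"
    "S \<in> bounded_operators A" "T' \<in> bounded_operators A" "E \<in> bounded_operators A"
    using xC yC dC S T' EC by auto
  have deq: "y f + x (adjoint_op A x (y f)) = smul 2 (x f) - d f" for f
    by (simp add: d_def)
  have ybound: "op_le A y (1 + e)"
    unfolding op_le_def
  proof
    fix f assume f: "f \<in> l2 A"
    have "y f + x (adjoint_op A x (y f)) = - d f + x (smul 2 f)"
      unfolding deq bop_smul [OF B(1) f] by simp
    from l2_coercive [OF B(1) _ _ _ this] have "l2_norm A (y f) \<le> l2_norm A (- d f) + l2_norm A (smul 2 f) / 2"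
      using B f by blast
    then show "l2_norm A (y f) \<le> (1 + e) * l2_norm A f"
      using op_leD [OF d f] by (simp add: ring_distribs)
  qed
  have ynear: "norm2 (y - T') \<le> 6 * e"
  proof -
    let ?\<delta> = "delta \<one>"
    let ?X = "x - S"
    have X: "?X \<in> commutant"
      using xC S by blast
    have aX: "adjoint_op A ?X \<in> commutant" "adjoint_op A S \<in> commutant"
      using X S by blast+
    define g where "g = (y - T') ?\<delta>"
    define t where "t = T' ?\<delta>"
    have t: "t \<in> l2 A"
      using B by (auto simp: t_def)
    define u where "u = smul 2 (?X ?\<delta>) - d ?\<delta> - E ?\<delta> - ?X (adjoint_op A S t)"
    define w where "w = - (adjoint_op A ?X t)"
    have l2: "g \<in> l2 A" "u \<in> l2 A" "w \<in> l2 A"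
      unfolding g_def u_def w_def using B X aX by (auto intro!: l2_diff l2_smul l2_uminus bop_l2)
    have m: "adjoint_op A x t \<in> l2 A" "adjoint_op A S t \<in> l2 A" "adjoint_op A x (y ?\<delta>) \<in> l2 A"
      using B by auto
    have Et: "E ?\<delta> = t + S (adjoint_op A S t) - smul 2 (S ?\<delta>)"
      by (simp add: E_def S_def t_def smul_diff)
    have gt: "g = y ?\<delta> - t"
      by (simp only: g_def t_def minus_apply)
    have ax: "adjoint_op A x g = adjoint_op A x (y ?\<delta>) - adjoint_op A x t"
      unfolding gt by (rule bop_diff) (use B t in auto)
    have xg: "x (adjoint_op A x g) = x (adjoint_op A x (y ?\<delta>)) - x (adjoint_op A x t)"
      unfolding ax by (rule bop_diff [OF B(1) m(3,1)])
    have aw: "w = adjoint_op A S t - adjoint_op A x t"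
      unfolding w_def adjoint_diff [OF B(1,4)] by simp
    have xw: "x w = x (adjoint_op A S t) - x (adjoint_op A x t)"
      unfolding aw by (rule bop_diff [OF B(1) m(2,1)])
    have "g + x (adjoint_op A x g) = (y ?\<delta> + x (adjoint_op A x (y ?\<delta>))) - t - x (adjoint_op A x t)"
      unfolding xg by (simp add: g_def t_def)
    also have "\<dots> = smul 2 (x ?\<delta>) - d ?\<delta> - t - x (adjoint_op A x t)"
      unfolding deq ..
    also have "\<dots> = u + x w"
      by (intro ext) (simp add: u_def xw Et algebra_simps)
    finally have "l2_norm A g \<le> l2_norm A u + l2_norm A w / 2"
      by (rule l2_coercive [OF B(1) l2])
    moreover have "l2_norm A u \<le> 2 * e + e + e + e"
    proof -
      have "l2_norm A (?X (adjoint_op A S t)) = norm2 (?X \<circ> (adjoint_op A S \<circ> T'))"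
        by (simp add: norm2_def t_def)
      also have "\<dots> \<le> (1 * \<rho>) * norm2 ?X"
        using X aX T' S \<rho> B by (intro norm2_comp_right op_le_comp op_le_adjoint) auto
      also have "\<dots> \<le> 1 * norm2 ?X"
        using \<rho> by (intro mult_right_mono) auto
      finally have 1: "l2_norm A (?X (adjoint_op A S t)) \<le> e"
        using x(2) by simp
      have 2: "l2_norm A (smul 2 (?X ?\<delta>)) \<le> 2 * e" "l2_norm A (d ?\<delta>) \<le> e" "l2_norm A (E ?\<delta>) \<le> e"
        using x(2) norm2_le [OF d] norm2_le [OF E] by (simp_all add: norm2_def)
      have m': "?X ?\<delta> \<in> l2 A" "d ?\<delta> \<in> l2 A" "E ?\<delta> \<in> l2 A" "?X (adjoint_op A S t) \<in> l2 A"
        using X B by (auto intro!: bop_l2)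
      show ?thesis
        unfolding u_def using m' 1 2
        by (intro order_trans [OF l2_norm_diff_triangle] add_mono l2_diff l2_smul)
    qed
    moreover have "l2_norm A w \<le> e"
    proof -
      have "l2_norm A w = norm2 (adjoint_op A ?X \<circ> T')"
        by (simp add: w_def norm2_def t_def)
      also have "\<dots> \<le> \<rho> * norm2 (adjoint_op A ?X)"
        using aX T' \<rho> by (intro norm2_comp_right) auto
      also have "\<dots> \<le> 1 * norm2 ?X"
        unfolding norm2_adjoint [OF X] using \<rho> by (intro mult_right_mono) auto
      finally show ?thesis
        using x(2) by simp
    qed
    ultimately show ?thesis
      using e by (simp add: norm2_def g_def)
  qed
  \<comment> \<open>The norm of \<open>y\<close> may exceed 1 by \<open>e\<close>; rescaling corrects this at a 2-norm cost of \<open>e\<close>.\<close>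
  define y' where "y' = op_smul (complex_of_real (1 / (1 + e))) y"
  have y'A: "y' \<in> galg"
    unfolding y'_def by (rule galg_op_smul [OF y])
  have "op_le A y' (cmod (complex_of_real (1 / (1 + e))) * (1 + e))"
    unfolding y'_def by (rule op_le_op_smul [OF ybound])
  then have y'1: "op_le A y' 1"
    using e by (simp add: norm_divide del: of_real_divide)
  have "norm2 (y' - y) = norm2 (op_smul (complex_of_real (1 / (1 + e) - 1)) y)"
    by (rule arg_cong [of _ _ norm2]) (auto simp: y'_def fun_eq_iff algebra_simps)
  also have "\<dots> = e / (1 + e) * norm2 y"
  proof -
    have "\<bar>1 / (1 + e) - 1\<bar> = e / (1 + e)"
      using e by (simp add: field_simps)
    then show ?thesis
      by (simp only: norm2_op_smul norm_of_real)
  qed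
  also have "\<dots> \<le> e / (1 + e) * (1 + e)"
    using e norm2_le [OF ybound] by (intro mult_left_mono) auto
  finally have yy': "norm2 (y' - y) \<le> e"
    using e by simp
  have y'C: "y' \<in> commutant"
    using y'A by (rule galg_commutant)
  have "norm2 (y' - T) \<le> norm2 (y' - y) + (norm2 (y - T') + norm2 (T' - T))"
    using y'C yC T T' by (intro order_trans [OF norm2_triangle_diff [of y' y T]] add_left_mono norm2_triangle_diff) auto
  then have "norm2 (y' - T) < \<epsilon>"
    using yy' ynear TT' e by linarith
  then show ?thesis
    using that y'A y'1 by blast
qed

theorem Kaplansky_density:
  assumes T: "T \<in> commutant" "op_le A T K" and K: "K > 0" and "\<epsilon> > 0"
  obtains p where "supported p" "op_le A (gcomb G p) K" "norm2 (gcomb G p - T) < \<epsilon>"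
proof -
  let ?c = "complex_of_real (1 / K)" and ?d = "complex_of_real K"
  have "op_le A (op_smul ?c T) (cmod ?c * K)"
    by (rule op_le_op_smul [OF T(2)])
  then have "op_le A (op_smul ?c T) 1"
    using K by (simp add: norm_divide)
  then obtain y where y: "y \<in> galg" "op_le A y 1" "norm2 (y - op_smul ?c T) < \<epsilon> / K"
    using Kaplansky_density_unit [of "op_smul ?c T" "\<epsilon> / K"] T K \<open>\<epsilon> > 0\<close> by auto
  have "norm2 (op_smul ?d y - T) = norm2 (op_smul ?d (y - op_smul ?c T))"
  proof -
    have "op_smul ?d y - T = op_smul ?d (y - op_smul ?c T)"
      using K by (intro ext) (simp add: field_simps)
    then show ?thesis by (simp only:)
  qed
  also have "\<dots> = K * norm2 (y - op_smul ?c T)"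
    using K by (simp only: norm2_op_smul norm_of_real abs_of_pos)
  also have "\<dots> < \<epsilon>"
    using y(3) K by (simp add: field_simps)
  finally have "norm2 (op_smul ?d y - T) < \<epsilon>" .
  moreover have "op_le A (op_smul ?d y) K"
    using op_le_op_smul [OF y(2), of ?d] K by simp
  moreover obtain p where p: "op_smul ?d y = gcomb G p" "supported p"
    by (rule galgE [OF galg_op_smul [OF y(1)]])
  ultimately show ?thesis
    using that [OF p(2)] by (simp only: p(1))
qed

end

section \<open>Uniform continuity of formulas of continuous logic\<close>

text \<open>
  A connective is continuous for the product topology on extensional functions. On a box, which is
  compact, the distances of the coordinates control the distance in the metric of
  \<^typ>\<open>nat \<Rightarrow> real\<close>, because all coordinates from \<open>n\<close> on are \<^term>\<open>undefined\<close>.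
\<close>

lemma connective_bounded_uniform:
  fixes u :: "(nat \<Rightarrow> real) \<Rightarrow> real" and n :: nat and B :: real
  assumes u: "continuous_map (powertop_real {..<n}) euclideanreal u"
  defines "K \<equiv> PiE {..<n} (\<lambda>_. {-B..B})"
  shows "\<exists>C. \<forall>x\<in>K. \<bar>u x\<bar> \<le> C"
    and "\<epsilon> > 0 \<Longrightarrow> \<exists>\<delta>>0. \<forall>x\<in>K. \<forall>y\<in>K. (\<forall>i<n. \<bar>x i - y i\<bar> < \<delta>) \<longrightarrow> \<bar>u x - u y\<bar> < \<epsilon>"
proof -
  have "K = PiE UNIV (\<lambda>i. if i < n then {-B..B} else {undefined})"
  proof (rule Set.set_eqI)
    fix x :: "nat \<Rightarrow> real"
    have "x \<in> K \<longleftrightarrow> (\<forall>i<n. x i \<in> {-B..B}) \<and> (\<forall>i. \<not> i < n \<longrightarrow> x i = undefined)"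
      by (simp add: K_def PiE_iff extensional_def Ball_def)
    also have "\<dots> \<longleftrightarrow> (\<forall>i. x i \<in> (if i < n then {-B..B} else {undefined}))"
      by (metis singleton_iff)
    finally show "x \<in> K \<longleftrightarrow> x \<in> PiE UNIV (\<lambda>i. if i < n then {-B..B} else {undefined})"
      by (simp only: PiE_UNIV_domain Pi_iff ball_UNIV)
  qed
  moreover have "compactin (product_topology (\<lambda>i. euclidean) UNIV)
      (PiE UNIV (\<lambda>i::nat. if i < n then {-B..B} else {undefined::real}))"
    unfolding compactin_PiE by auto
  ultimately have comp: "compact K"
    by (simp add: euclidean_product_topology)
  have "continuous_map (top_of_set K) (powertop_real {..<n}) (\<lambda>x. x)"
    unfolding continuous_map_componentwise
  proof
    show "(\<lambda>x. x) ` topspace (top_of_set K) \<subseteq> extensional {..<n}"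
      by (auto simp: K_def PiE_def)
    show "\<forall>k\<in>{..<n}. continuous_map (top_of_set K) euclideanreal (\<lambda>x. x k)"
      by (auto intro: continuous_on_subset [OF continuous_on_product_coordinates])
  qed
  from continuous_map_compose [OF this u] have cont: "continuous_on K u"
    by (simp add: o_def)
  show "\<exists>C. \<forall>x\<in>K. \<bar>u x\<bar> \<le> C"
    using compact_imp_bounded [OF compact_continuous_image [OF cont comp]]
    by (auto simp: bounded_iff)
  assume "\<epsilon> > 0"
  have "uniformly_continuous_on K u"
    by (rule compact_uniformly_continuous [OF cont comp])
  then obtain \<eta> where \<eta>: "\<eta> > 0" "\<And>x y. x \<in> K \<Longrightarrow> y \<in> K \<Longrightarrow> dist y x < \<eta> \<Longrightarrow> dist (u y) (u x) < \<epsilon>"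
    using \<open>\<epsilon> > 0\<close> unfolding uniformly_continuous_on_def by meson
  obtain N where N: "(1 / 2 :: real) ^ N < \<eta> / 2"
    using real_arch_pow_inv [of "\<eta> / 2" "1 / 2"] \<eta>(1) by auto
  have "\<bar>u x - u y\<bar> < \<epsilon>" if x: "x \<in> K" and y: "y \<in> K" and xy: "\<forall>i<n. \<bar>x i - y i\<bar> < \<eta> / 4" for x y
  proof -
    have "dist (x i) (y i) < \<eta> / 4" for i
    proof (cases "i < n")
      case True
      then show ?thesis using xy by (simp add: dist_real_def)
    next
      case False
      then have "x i = undefined" "y i = undefined"
        using x y unfolding K_def by (auto simp: PiE_def extensional_def)
      then show ?thesis using \<eta>(1) by simp
    qed
    then have "Max {dist (x (from_nat m)) (y (from_nat m)) |m. m \<le> N} < \<eta> / 4"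
      by (subst Max_less_iff) auto
    then have "dist x y < \<eta>"
      using dist_fun_le_dist_first_terms [of x y N] N by linarith
    then show ?thesis
      using \<eta>(2) [OF y x] by (simp add: dist_real_def)
  qed
  then show "\<exists>\<delta>>0. \<forall>x\<in>K. \<forall>y\<in>K. (\<forall>i<n. \<bar>x i - y i\<bar> < \<delta>) \<longrightarrow> \<bar>u x - u y\<bar> < \<epsilon>"
    using \<eta>(1) by (intro exI [of _ "\<eta> / 4"]) auto
qed

lemma finite_uniform_delta:
  fixes P :: "'x \<Rightarrow> real \<Rightarrow> bool"
  assumes "finite X" "\<And>x. x \<in> X \<Longrightarrow> \<exists>\<delta>>0. P x \<delta>"
    and mono: "\<And>x \<delta> \<delta>'. P x \<delta> \<Longrightarrow> \<delta>' \<le> \<delta> \<Longrightarrow> P x \<delta>'"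
  shows "\<exists>\<delta>>0. \<forall>x\<in>X. P x \<delta>"
  using assms(1,2)
proof (induction X)
  case empty
  show ?case by (rule exI [of _ 1]) simp
next
  case (insert x X)
  then obtain \<delta> \<delta>' where "\<delta> > 0" "\<forall>x\<in>X. P x \<delta>" "\<delta>' > 0" "P x \<delta>'"
    by (metis insert_iff)
  then show ?case
    by (intro exI [of _ "min \<delta> \<delta>'"]) (auto intro: mono [OF _ min.cobounded1] mono [OF _ min.cobounded2])
qed

lemma finite_uniform_bound:
  fixes P :: "'x \<Rightarrow> real \<Rightarrow> bool"
  assumes "finite X" "\<And>x. x \<in> X \<Longrightarrow> \<exists>B. P x B"
    and mono: "\<And>x B B'. P x B \<Longrightarrow> B \<le> B' \<Longrightarrow> P x B'"
  shows "\<exists>B. \<forall>x\<in>X. P x B"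
  using assms(1,2)
proof (induction X)
  case (insert x X)
  then obtain B B' where "\<forall>x\<in>X. P x B" "P x B'"
    by (metis insert_iff)
  then show ?case
    by (intro exI [of _ "max B B'"]) (auto intro: mono [OF _ max.cobounded1] mono [OF _ max.cobounded2])
qed simp

lemma cSup_close:
  fixes f g :: "'x \<Rightarrow> real"
  assumes "X \<noteq> {}" "bdd_above (g ` X)" "\<And>x. x \<in> X \<Longrightarrow> f x \<le> g x + \<epsilon>"
  shows "(SUP x\<in>X. f x) \<le> (SUP x\<in>X. g x) + \<epsilon>"
proof (rule cSUP_least [OF assms(1)])
  fix x assume "x \<in> X"
  then show "f x \<le> (SUP x\<in>X. g x) + \<epsilon>"
    using assms(3) cSUP_upper [OF _ assms(2)] by fastforce
qed

lemma cInf_close: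
  fixes f g :: "'x \<Rightarrow> real"
  assumes "X \<noteq> {}" "bdd_below (g ` X)" "\<And>x. x \<in> X \<Longrightarrow> g x \<le> f x + \<epsilon>"
  shows "(INF x\<in>X. g x) \<le> (INF x\<in>X. f x) + \<epsilon>"
proof -
  have "(INF x\<in>X. g x) - \<epsilon> \<le> (INF x\<in>X. f x)"
  proof (rule cINF_greatest [OF assms(1)])
    fix x assume "x \<in> X"
    then show "(INF x\<in>X. g x) - \<epsilon> \<le> f x"
      using assms(3) cINF_lower [OF assms(2)] by fastforce
  qed
  then show ?thesis by simp
qed

lemma wf_mterm_vars: "wf_mterm L t \<Longrightarrow> x \<in> mterm_vars t \<Longrightarrow> fst x \<in> sorts L"
  by (induction t) auto

lemma wf_mformula_free: "wf_mformula L \<phi> \<Longrightarrow> x \<in> mformula_free \<phi> \<Longrightarrow> fst x \<in> sorts L"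
  by (induction \<phi>) (auto dest: wf_mterm_vars)

text \<open>
  A structure together with larger sorts \<open>V\<close> that are closed under the function symbols and on
  which these are uniformly continuous. The distance need only be a bounded pseudometric on \<open>V\<close>,
  expressed by the Lipschitz condition. Terms take values in \<open>V\<close>, while quantifiers range over the
  universe of the structure.
\<close>

locale uniform_envelope =
  fixes L :: "('s, 'f) metric_language" and M :: "('s, 'f, 'x) metric_structure"
    and V :: "'s \<Rightarrow> 'x set"
  assumes universe_sub: "s \<in> sorts L \<Longrightarrow> universe M s \<subseteq> V s"
    and universe_ne: "s \<in> sorts L \<Longrightarrow> universe M s \<noteq> {}"
    and fun_rng_sort: "f \<in> funs L \<Longrightarrow> fun_rng L f \<in> sorts L"
    and dist_refl: "s \<in> sorts L \<Longrightarrow> x \<in> V s \<Longrightarrow> mdist M s x x = 0"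
    and dist_bounded: "s \<in> sorts L \<Longrightarrow> \<exists>B. \<forall>x\<in>V s. \<forall>y\<in>V s. \<bar>mdist M s x y\<bar> \<le> B"
    and dist_lipschitz: "s \<in> sorts L \<Longrightarrow> x \<in> V s \<Longrightarrow> x' \<in> V s \<Longrightarrow> y \<in> V s \<Longrightarrow> y' \<in> V s \<Longrightarrow>
      \<bar>mdist M s x y - mdist M s x' y'\<bar> \<le> mdist M s x x' + mdist M s y y'"
    and fun_closed: "f \<in> funs L \<Longrightarrow> list_all2 (\<lambda>x s. x \<in> V s) xs (fun_dom L f) \<Longrightarrow>
      interp M f xs \<in> V (fun_rng L f)"
    and fun_uniform: "f \<in> funs L \<Longrightarrow> \<epsilon> > 0 \<Longrightarrow> \<exists>\<delta>>0. \<forall>xs ys.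
      list_all2 (\<lambda>x s. x \<in> V s) xs (fun_dom L f) \<longrightarrow> list_all2 (\<lambda>x s. x \<in> V s) ys (fun_dom L f) \<longrightarrow>
      (\<forall>i<length (fun_dom L f). mdist M (fun_dom L f ! i) (xs ! i) (ys ! i) < \<delta>) \<longrightarrow>
      mdist M (fun_rng L f) (interp M f xs) (interp M f ys) < \<epsilon>"
begin

text \<open>
Assignments with values in the sorts of the envelope.
\<close>

definition asg :: "('s \<times> nat \<Rightarrow> 'x) \<Rightarrow> bool" where
  "asg v \<longleftrightarrow> (\<forall>s\<in>sorts L. \<forall>i. v (s, i) \<in> V s)"

text \<open>
Two assignments are \<open>\<delta>\<close>-close on a set of variables.
\<close>

definition close :: "('s \<times> nat) set \<Rightarrow> real \<Rightarrow> ('s \<times> nat \<Rightarrow> 'x) \<Rightarrow> ('s \<times> nat \<Rightarrow> 'x) \<Rightarrow> bool" where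
  "close X \<delta> v w \<longleftrightarrow> (\<forall>x\<in>X. mdist M (fst x) (v x) (w x) < \<delta>)"

lemma close_mono: "close X \<delta> v w \<Longrightarrow> Y \<subseteq> X \<Longrightarrow> \<delta> \<le> \<delta>' \<Longrightarrow> close Y \<delta>' v w"
  by (fastforce simp: close_def)

lemma asg_upd: "asg v \<Longrightarrow> s \<in> sorts L \<Longrightarrow> x \<in> universe M s \<Longrightarrow> asg (v((s, i) := x))"
  using universe_sub by (auto simp: asg_def)

lemma term_sort_in: "wf_mterm L t \<Longrightarrow> mterm_sort L t \<in> sorts L"
  by (cases t) (auto simp: fun_rng_sort)

lemma term_val_in:
  "wf_mterm L t \<Longrightarrow> asg v \<Longrightarrow> mterm_val M v t \<in> V (mterm_sort L t)"
proof (induction t)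
  case (MVar s i)
  then show ?case by (simp add: asg_def)
next
  case (MApp f ts)
  have "mterm_val M v t \<in> V (mterm_sort L t)" if "t \<in> set ts" for t
    using MApp that by simp
  then have "list_all2 (\<lambda>x s. x \<in> V s) (map (mterm_val M v) ts) (map (mterm_sort L) ts)"
    by (simp add: list_all2_conv_all_nth)
  then show ?case
    using MApp.prems fun_closed fun_rng_sort by simp
qed

lemma term_val_list_in:
  assumes "wf_mterm L (MApp f ts)" "asg v"
  shows "list_all2 (\<lambda>x s. x \<in> V s) (map (mterm_val M v) ts) (fun_dom L f)"
proof -
  have "list_all2 (\<lambda>x s. x \<in> V s) (map (mterm_val M v) ts) (map (mterm_sort L) ts)"
  proof -
    have "mterm_val M v t \<in> V (mterm_sort L t)" if "t \<in> set ts" for t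
      using assms that by (intro term_val_in) simp_all
    then show ?thesis
      by (simp add: list_all2_conv_all_nth)
  qed
  then show ?thesis
    using assms(1) by simp
qed

lemma term_uniform:
  "wf_mterm L t \<Longrightarrow> \<epsilon> > 0 \<Longrightarrow> \<exists>\<delta>>0. \<forall>v w. asg v \<longrightarrow> asg w \<longrightarrow> close (mterm_vars t) \<delta> v w \<longrightarrow>
     mdist M (mterm_sort L t) (mterm_val M v t) (mterm_val M w t) < \<epsilon>"
proof (induction t arbitrary: \<epsilon>)
  case (MVar s i)
  then show ?case
    by (intro exI [of _ \<epsilon>]) (auto simp: close_def)
next
  case (MApp f ts)
  have f: "f \<in> funs L" and dom: "map (mterm_sort L) ts = fun_dom L f"
    using MApp.prems by auto
  obtain \<delta>0 where \<delta>0: "\<delta>0 > 0" "\<And>xs ys. list_all2 (\<lambda>x s. x \<in> V s) xs (fun_dom L f) \<Longrightarrow>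
      list_all2 (\<lambda>x s. x \<in> V s) ys (fun_dom L f) \<Longrightarrow>
      (\<forall>i<length (fun_dom L f). mdist M (fun_dom L f ! i) (xs ! i) (ys ! i) < \<delta>0) \<Longrightarrow>
      mdist M (fun_rng L f) (interp M f xs) (interp M f ys) < \<epsilon>"
    using fun_uniform [OF f MApp.prems(2)] by auto
  have "\<exists>\<delta>>0. \<forall>t\<in>set ts. \<forall>v w. asg v \<longrightarrow> asg w \<longrightarrow> close (mterm_vars t) \<delta> v w \<longrightarrow>
      mdist M (mterm_sort L t) (mterm_val M v t) (mterm_val M w t) < \<delta>0"
  proof (rule finite_uniform_delta)
    fix t assume "t \<in> set ts"
    then show "\<exists>\<delta>>0. \<forall>v w. asg v \<longrightarrow> asg w \<longrightarrow> close (mterm_vars t) \<delta> v w \<longrightarrow>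
        mdist M (mterm_sort L t) (mterm_val M v t) (mterm_val M w t) < \<delta>0"
      using MApp.IH [of t \<delta>0] MApp.prems \<delta>0(1) by simp
  next
    fix t \<delta> \<delta>'
    assume a: "\<forall>v w. asg v \<longrightarrow> asg w \<longrightarrow> close (mterm_vars t) \<delta> v w \<longrightarrow>
        mdist M (mterm_sort L t) (mterm_val M v t) (mterm_val M w t) < \<delta>0" "\<delta>' \<le> \<delta>"
    then show "\<forall>v w. asg v \<longrightarrow> asg w \<longrightarrow> close (mterm_vars t) \<delta>' v w \<longrightarrow>
        mdist M (mterm_sort L t) (mterm_val M v t) (mterm_val M w t) < \<delta>0"
      using close_mono [OF _ subset_refl a(2)] by blast
  qed simp
  then obtain \<delta> where \<delta>: "\<delta> > 0" "\<And>t v w. t \<in> set ts \<Longrightarrow> asg v \<Longrightarrow> asg w \<Longrightarrow> close (mterm_vars t) \<delta> v w \<Longrightarrow>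
      mdist M (mterm_sort L t) (mterm_val M v t) (mterm_val M w t) < \<delta>0"
    by auto
  have "mdist M (fun_rng L f) (mterm_val M v (MApp f ts)) (mterm_val M w (MApp f ts)) < \<epsilon>"
    if v: "asg v" and w: "asg w" and c: "close (mterm_vars (MApp f ts)) \<delta> v w" for v w
    unfolding mterm_val.simps
  proof (rule \<delta>0(2) [OF term_val_list_in [OF MApp.prems(1) v] term_val_list_in [OF MApp.prems(1) w]], intro allI impI)
    fix i assume "i < length (fun_dom L f)"
    then have i: "i < length ts" and s: "fun_dom L f ! i = mterm_sort L (ts ! i)"
      by (auto simp flip: dom)
    have "close (mterm_vars (ts ! i)) \<delta> v w"
      using c i by (auto simp: close_def)
    then show "mdist M (fun_dom L f ! i) (map (mterm_val M v) ts ! i) (map (mterm_val M w) ts ! i) < \<delta>0"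
      using \<delta>(2) [of "ts ! i" v w] i v w by (simp add: s)
  qed
  then show ?case
    using \<delta>(1) by auto
qed

lemma formula_bounded:
  "wf_mformula L \<phi> \<Longrightarrow> \<exists>B. \<forall>v. asg v \<longrightarrow> \<bar>mformula_val M v \<phi>\<bar> \<le> B"
proof (induction \<phi>)
  case (MDist s t t')
  then have s: "s \<in> sorts L"
    using term_sort_in [of t] by simp
  obtain B where "\<forall>x\<in>V s. \<forall>y\<in>V s. \<bar>mdist M s x y\<bar> \<le> B"
    using dist_bounded [OF s] by blast
  then show ?case
    using term_val_in [of t] term_val_in [of t'] MDist.prems by (intro exI [of _ B]) auto
next
  case (MConn u \<phi>s)
  have "\<exists>B. \<forall>\<phi>\<in>set \<phi>s. \<forall>v. asg v \<longrightarrow> \<bar>mformula_val M v \<phi>\<bar> \<le> B"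
    by (rule finite_uniform_bound) (use MConn in \<open>force+\<close>)
  then obtain B where B: "\<And>\<phi> v. \<phi> \<in> set \<phi>s \<Longrightarrow> asg v \<Longrightarrow> \<bar>mformula_val M v \<phi>\<bar> \<le> B"
    by blast
  obtain C where C: "\<forall>x\<in>PiE {..<length \<phi>s} (\<lambda>_. {-B..B}). \<bar>u x\<bar> \<le> C"
    using connective_bounded_uniform(1) [of "length \<phi>s" u B] MConn.prems by auto
  have "(\<lambda>i\<in>{..<length \<phi>s}. map (mformula_val M v) \<phi>s ! i) \<in> PiE {..<length \<phi>s} (\<lambda>_. {-B..B})"
    if "asg v" for v
    using B [OF nth_mem that] by (auto simp: abs_le_iff minus_le_iff)
  then show ?case
    using C unfolding mformula_val.simps by blast
next
  case (MSup s i \<phi>)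
  then obtain B where B: "\<And>v. asg v \<Longrightarrow> \<bar>mformula_val M v \<phi>\<bar> \<le> B"
    by auto
  have s: "s \<in> sorts L" using MSup.prems by simp
  have "\<bar>SUP x\<in>universe M s. mformula_val M (v((s, i) := x)) \<phi>\<bar> \<le> B" if v: "asg v" for v
    by (rule cSup_abs_le) (use universe_ne [OF s] B asg_upd [OF v s] in auto)
  then show ?case by auto
next
  case (MInf s i \<phi>)
  then obtain B where B: "\<And>v. asg v \<Longrightarrow> \<bar>mformula_val M v \<phi>\<bar> \<le> B"
    by auto
  have s: "s \<in> sorts L" using MInf.prems by simp
  have "\<bar>INF x\<in>universe M s. mformula_val M (v((s, i) := x)) \<phi>\<bar> \<le> B" if v: "asg v" for v
    by (rule cInf_abs_ge) (use universe_ne [OF s] B asg_upd [OF v s] in auto)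
  then show ?case by auto
qed

lemma formula_bdd:
  assumes "wf_mformula L \<phi>" "asg v" "s \<in> sorts L"
  shows "bdd_above ((\<lambda>x. mformula_val M (v((s, i) := x)) \<phi>) ` universe M s)"
    and "bdd_below ((\<lambda>x. mformula_val M (v((s, i) := x)) \<phi>) ` universe M s)"
proof -
  obtain B where B: "\<And>v. asg v \<Longrightarrow> \<bar>mformula_val M v \<phi>\<bar> \<le> B"
    using formula_bounded [OF assms(1)] by blast
  have *: "\<bar>mformula_val M (v((s, i) := x)) \<phi>\<bar> \<le> B" if "x \<in> universe M s" for x
    using B asg_upd assms that by blast
  show "bdd_above ((\<lambda>x. mformula_val M (v((s, i) := x)) \<phi>) ` universe M s)"
    by (rule bdd_aboveI2 [of _ _ B]) (use * in force)
  show "bdd_below ((\<lambda>x. mformula_val M (v((s, i) := x)) \<phi>) ` universe M s)"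
    by (rule bdd_belowI2 [of _ "- B"]) (use * in force)
qed

lemma close_upd:
  assumes "close (X - {(s, i)}) \<delta> v w" "\<delta> > 0" "s \<in> sorts L" "x \<in> universe M s"
  shows "close X \<delta> (v((s, i) := x)) (w((s, i) := x))"
  using assms universe_sub [OF assms(3)] dist_refl [of s x] by (auto simp: close_def)



lemma formula_uniform:
  "wf_mformula L \<phi> \<Longrightarrow> \<epsilon> > 0 \<Longrightarrow> \<exists>\<delta>>0. \<forall>v w. asg v \<longrightarrow> asg w \<longrightarrow> close (mformula_free \<phi>) \<delta> v w \<longrightarrow>
     \<bar>mformula_val M v \<phi> - mformula_val M w \<phi>\<bar> < \<epsilon>"
proof (induction \<phi> arbitrary: \<epsilon>)
  case (MDist s t t')
  have t: "wf_mterm L t" "wf_mterm L t'" "mterm_sort L t = s" "mterm_sort L t' = s"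
    using MDist.prems by auto
  obtain \<delta> where \<delta>: "\<delta> > 0" "\<And>v w. asg v \<Longrightarrow> asg w \<Longrightarrow> close (mterm_vars t) \<delta> v w \<Longrightarrow>
     mdist M s (mterm_val M v t) (mterm_val M w t) < \<epsilon> / 2"
    using term_uniform [OF t(1), of "\<epsilon> / 2"] MDist.prems t by auto
  obtain \<delta>' where \<delta>': "\<delta>' > 0" "\<And>v w. asg v \<Longrightarrow> asg w \<Longrightarrow> close (mterm_vars t') \<delta>' v w \<Longrightarrow>
     mdist M s (mterm_val M v t') (mterm_val M w t') < \<epsilon> / 2"
    using term_uniform [OF t(2), of "\<epsilon> / 2"] MDist.prems t by auto
  have "\<bar>mformula_val M v (MDist s t t') - mformula_val M w (MDist s t t')\<bar> < \<epsilon>"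
    if v: "asg v" and w: "asg w" and c: "close (mformula_free (MDist s t t')) (min \<delta> \<delta>') v w" for v w
  proof -
    have "close (mterm_vars t) \<delta> v w" "close (mterm_vars t') \<delta>' v w"
      using close_mono [OF c] by auto
    then have "mdist M s (mterm_val M v t) (mterm_val M w t) < \<epsilon> / 2"
      "mdist M s (mterm_val M v t') (mterm_val M w t') < \<epsilon> / 2"
      using \<delta> \<delta>' v w by auto
    moreover have "\<bar>mdist M s (mterm_val M v t) (mterm_val M v t') - mdist M s (mterm_val M w t) (mterm_val M w t')\<bar>
        \<le> mdist M s (mterm_val M v t) (mterm_val M w t) + mdist M s (mterm_val M v t') (mterm_val M w t')"
      using term_val_in [OF t(1)] term_val_in [OF t(2)] v w t term_sort_in [OF t(1)] by (intro dist_lipschitz) auto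
    ultimately show ?thesis by simp
  qed
  then show ?case
    using \<delta>(1) \<delta>'(1) by (intro exI [of _ "min \<delta> \<delta>'"]) auto
next
  case (MConn u \<phi>s)
  let ?n = "length \<phi>s"
  have "\<exists>B. \<forall>\<phi>\<in>set \<phi>s. \<forall>v. asg v \<longrightarrow> \<bar>mformula_val M v \<phi>\<bar> \<le> B"
    by (rule finite_uniform_bound) (use formula_bounded MConn.prems in \<open>force+\<close>)
  then obtain B where B: "\<And>\<phi> v. \<phi> \<in> set \<phi>s \<Longrightarrow> asg v \<Longrightarrow> \<bar>mformula_val M v \<phi>\<bar> \<le> B"
    by blast
  let ?K = "PiE {..<?n} (\<lambda>_. {-B..B})"
  have inK: "(\<lambda>i\<in>{..<?n}. map (mformula_val M v) \<phi>s ! i) \<in> ?K" if "asg v" for v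
    using B [OF nth_mem that] by (auto simp: abs_le_iff minus_le_iff)
  obtain \<eta> where \<eta>: "\<eta> > 0" "\<And>x y. x \<in> ?K \<Longrightarrow> y \<in> ?K \<Longrightarrow> (\<forall>i<?n. \<bar>x i - y i\<bar> < \<eta>) \<Longrightarrow> \<bar>u x - u y\<bar> < \<epsilon>"
    using connective_bounded_uniform(2) [of ?n u \<epsilon> B] MConn.prems by auto
  have "\<exists>\<delta>>0. \<forall>\<phi>\<in>set \<phi>s. \<forall>v w. asg v \<longrightarrow> asg w \<longrightarrow> close (mformula_free \<phi>) \<delta> v w \<longrightarrow>
     \<bar>mformula_val M v \<phi> - mformula_val M w \<phi>\<bar> < \<eta>"
  proof (rule finite_uniform_delta)
    fix \<phi> assume "\<phi> \<in> set \<phi>s"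
    then show "\<exists>\<delta>>0. \<forall>v w. asg v \<longrightarrow> asg w \<longrightarrow> close (mformula_free \<phi>) \<delta> v w \<longrightarrow>
        \<bar>mformula_val M v \<phi> - mformula_val M w \<phi>\<bar> < \<eta>"
      using MConn.IH [of \<phi> \<eta>] MConn.prems \<eta>(1) by simp
  next
    fix \<phi> \<delta> \<delta>'
    assume a: "\<forall>v w. asg v \<longrightarrow> asg w \<longrightarrow> close (mformula_free \<phi>) \<delta> v w \<longrightarrow>
        \<bar>mformula_val M v \<phi> - mformula_val M w \<phi>\<bar> < \<eta>" "\<delta>' \<le> \<delta>"
    then show "\<forall>v w. asg v \<longrightarrow> asg w \<longrightarrow> close (mformula_free \<phi>) \<delta>' v w \<longrightarrow>
        \<bar>mformula_val M v \<phi> - mformula_val M w \<phi>\<bar> < \<eta>"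
      using close_mono [OF _ subset_refl a(2)] by blast
  qed simp
  then obtain \<delta> where \<delta>: "\<delta> > 0" "\<And>\<phi> v w. \<phi> \<in> set \<phi>s \<Longrightarrow> asg v \<Longrightarrow> asg w \<Longrightarrow> close (mformula_free \<phi>) \<delta> v w \<Longrightarrow>
     \<bar>mformula_val M v \<phi> - mformula_val M w \<phi>\<bar> < \<eta>"
    by auto
  have "\<bar>mformula_val M v (MConn u \<phi>s) - mformula_val M w (MConn u \<phi>s)\<bar> < \<epsilon>"
    if v: "asg v" and w: "asg w" and c: "close (mformula_free (MConn u \<phi>s)) \<delta> v w" for v w
    unfolding mformula_val.simps
  proof (rule \<eta>(2) [OF inK [OF v] inK [OF w]], intro allI impI)
    fix i assume i: "i < ?n"
    have "close (mformula_free (\<phi>s ! i)) \<delta> v w"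
      by (rule close_mono [OF c]) (use nth_mem [OF i] in \<open>auto simp del: nth_mem\<close>)
    then show "\<bar>(\<lambda>i\<in>{..<?n}. map (mformula_val M v) \<phi>s ! i) i - (\<lambda>i\<in>{..<?n}. map (mformula_val M w) \<phi>s ! i) i\<bar> < \<eta>"
      using \<delta>(2) [of "\<phi>s ! i" v w] i v w by simp
  qed
  then show ?case
    using \<delta>(1) by blast
next
  case (MSup s i \<phi>)
  have s: "s \<in> sorts L" and \<phi>: "wf_mformula L \<phi>"
    using MSup.prems by auto
  obtain \<delta> where \<delta>: "\<delta> > 0" "\<And>v w. asg v \<Longrightarrow> asg w \<Longrightarrow> close (mformula_free \<phi>) \<delta> v w \<Longrightarrow>
     \<bar>mformula_val M v \<phi> - mformula_val M w \<phi>\<bar> < \<epsilon> / 2"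
    using MSup.IH [OF \<phi>, of "\<epsilon> / 2"] MSup.prems by auto
  have "\<bar>mformula_val M v (MSup s i \<phi>) - mformula_val M w (MSup s i \<phi>)\<bar> < \<epsilon>"
    if v: "asg v" and w: "asg w" and c: "close (mformula_free (MSup s i \<phi>)) \<delta> v w" for v w
  proof -
    have x: "\<bar>mformula_val M (v((s, i) := x)) \<phi> - mformula_val M (w((s, i) := x)) \<phi>\<bar> < \<epsilon> / 2"
      if "x \<in> universe M s" for x
      using c that s \<delta>(1) by (intro \<delta>(2) asg_upd v w close_upd) auto
    have le: "mformula_val M (v((s, i) := x)) \<phi> \<le> mformula_val M (w((s, i) := x)) \<phi> + \<epsilon> / 2"
      "mformula_val M (w((s, i) := x)) \<phi> \<le> mformula_val M (v((s, i) := x)) \<phi> + \<epsilon> / 2"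
      if "x \<in> universe M s" for x
      using x [OF that] by linarith+
    have "mformula_val M v (MSup s i \<phi>) \<le> mformula_val M w (MSup s i \<phi>) + \<epsilon> / 2"
      unfolding mformula_val.simps
      by (rule cSup_close [OF universe_ne [OF s] formula_bdd(1) [OF \<phi> w s]]) (use le in auto)
    moreover have "mformula_val M w (MSup s i \<phi>) \<le> mformula_val M v (MSup s i \<phi>) + \<epsilon> / 2"
      unfolding mformula_val.simps
      by (rule cSup_close [OF universe_ne [OF s] formula_bdd(1) [OF \<phi> v s]]) (use le in auto)
    ultimately show ?thesis
      using MSup.prems(2) by linarith
  qed
  then show ?case
    using \<delta>(1) by blast
next
  case (MInf s i \<phi>)
  have s: "s \<in> sorts L" and \<phi>: "wf_mformula L \<phi>"
    using MInf.prems by auto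
  obtain \<delta> where \<delta>: "\<delta> > 0" "\<And>v w. asg v \<Longrightarrow> asg w \<Longrightarrow> close (mformula_free \<phi>) \<delta> v w \<Longrightarrow>
     \<bar>mformula_val M v \<phi> - mformula_val M w \<phi>\<bar> < \<epsilon> / 2"
    using MInf.IH [OF \<phi>, of "\<epsilon> / 2"] MInf.prems by auto
  have "\<bar>mformula_val M v (MInf s i \<phi>) - mformula_val M w (MInf s i \<phi>)\<bar> < \<epsilon>"
    if v: "asg v" and w: "asg w" and c: "close (mformula_free (MInf s i \<phi>)) \<delta> v w" for v w
  proof -
    have x: "\<bar>mformula_val M (v((s, i) := x)) \<phi> - mformula_val M (w((s, i) := x)) \<phi>\<bar> < \<epsilon> / 2"
      if "x \<in> universe M s" for x
      using c that s \<delta>(1) by (intro \<delta>(2) asg_upd v w close_upd) auto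
    have le: "mformula_val M (v((s, i) := x)) \<phi> \<le> mformula_val M (w((s, i) := x)) \<phi> + \<epsilon> / 2"
      "mformula_val M (w((s, i) := x)) \<phi> \<le> mformula_val M (v((s, i) := x)) \<phi> + \<epsilon> / 2"
      if "x \<in> universe M s" for x
      using x [OF that] by linarith+
    have "mformula_val M v (MInf s i \<phi>) \<le> mformula_val M w (MInf s i \<phi>) + \<epsilon> / 2"
      unfolding mformula_val.simps
      by (rule cInf_close [OF universe_ne [OF s] formula_bdd(2) [OF \<phi> v s]]) (use le in auto)
    moreover have "mformula_val M w (MInf s i \<phi>) \<le> mformula_val M v (MInf s i \<phi>) + \<epsilon> / 2"
      unfolding mformula_val.simps
      by (rule cInf_close [OF universe_ne [OF s] formula_bdd(2) [OF \<phi> w s]]) (use le in auto)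
    ultimately show ?thesis
      using MInf.prems(2) by linarith
  qed
  then show ?case
    using \<delta>(1) by blast
qed

end

lemma mterm_val_cong:
  "(\<And>x. x \<in> mterm_vars t \<Longrightarrow> v x = w x) \<Longrightarrow> mterm_val M v t = mterm_val M w t"
proof (induction t)
  case (MApp f ts)
  then have "map (mterm_val M v) ts = map (mterm_val M w) ts"
    by (intro map_cong refl) auto
  then show ?case by (simp only: mterm_val.simps)
qed simp

lemma mformula_val_cong:
  "(\<And>x. x \<in> mformula_free \<phi> \<Longrightarrow> v x = w x) \<Longrightarrow> mformula_val M v \<phi> = mformula_val M w \<phi>"
proof (induction \<phi> arbitrary: v w)
  case (MDist s t t')
  have "mterm_val M v t = mterm_val M w t" "mterm_val M v t' = mterm_val M w t'"
    using MDist by (auto intro!: mterm_val_cong)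
  then show ?case by simp
next
  case (MConn u \<phi>s)
  have "map (mformula_val M v) \<phi>s = map (mformula_val M w) \<phi>s"
    by (intro map_cong refl MConn.IH) (use MConn.prems in auto)
  then show ?case by (simp only: mformula_val.simps)
next
  case (MSup s i \<phi>)
  have "mformula_val M (v((s, i) := x)) \<phi> = mformula_val M (w((s, i) := x)) \<phi>" for x
    by (rule MSup.IH) (use MSup.prems in auto)
  then show ?case by simp
next
  case (MInf s i \<phi>)
  have "mformula_val M (v((s, i) := x)) \<phi> = mformula_val M (w((s, i) := x)) \<phi>" for x
    by (rule MInf.IH) (use MInf.prems in auto)
  then show ?case by simp
qed


section \<open>Back-and-forth equivalence\<close>

lemma same_qf_type_sym:
  "length as = length bs \<Longrightarrow> same_qf_type G as H bs \<Longrightarrow> same_qf_type H bs G as"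
  by (simp add: same_qf_type_def)

lemma bf_equiv_forth:
  assumes "bf_equiv \<alpha> G as H bs" "\<beta> < \<alpha>" "cs \<in> lists (carrier G)"
  obtains ds where "ds \<in> lists (carrier H)" "length ds = length cs" "bf_equiv \<beta> G (as @ cs) H (bs @ ds)"
proof -
  have "\<not> (\<forall>\<beta>. \<alpha> \<le> \<beta>)"
    using assms(2) not_le by blast
  then have "\<exists>ds\<in>lists (carrier H). length ds = length cs \<and> bf_equiv \<beta> G (as @ cs) H (bs @ ds)"
    using bf_equiv.simps [of \<alpha> G as H bs] assms by (simp only: if_False simp_thms)
  then show ?thesis
    using that by blast
qed

lemma bf_equiv_sym:
  "length as = length bs \<Longrightarrow> bf_equiv \<alpha> G as H bs \<Longrightarrow> bf_equiv \<alpha> H bs G as"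
proof (induction \<alpha> arbitrary: as bs rule: less_induct)
  case (less \<alpha>)
  show ?case
  proof (cases "\<forall>\<beta>. \<alpha> \<le> \<beta>")
    case True
    then show ?thesis
      using less.prems by (subst bf_equiv.simps, subst (asm) bf_equiv.simps) (auto intro: same_qf_type_sym)
  next
    case False
    have *: "\<forall>\<beta><\<alpha>. (\<forall>cs\<in>lists (carrier G). \<exists>ds\<in>lists (carrier H).
            length ds = length cs \<and> bf_equiv \<beta> G (as @ cs) H (bs @ ds)) \<and>
        (\<forall>ds\<in>lists (carrier H). \<exists>cs\<in>lists (carrier G).
            length cs = length ds \<and> bf_equiv \<beta> G (as @ cs) H (bs @ ds))"
      using less.prems(2) by (subst (asm) bf_equiv.simps) (simp only: False if_False)
    have **: "bf_equiv \<beta> H (bs @ ds) G (as @ cs)"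
      if "\<beta> < \<alpha>" "length ds = length cs" "bf_equiv \<beta> G (as @ cs) H (bs @ ds)" for \<beta> cs ds
      using that less.prems(1) by (intro less.IH) auto
    have "\<forall>\<beta><\<alpha>. (\<forall>ds\<in>lists (carrier H). \<exists>cs\<in>lists (carrier G).
            length cs = length ds \<and> bf_equiv \<beta> H (bs @ ds) G (as @ cs)) \<and>
        (\<forall>cs\<in>lists (carrier G). \<exists>ds\<in>lists (carrier H).
            length ds = length cs \<and> bf_equiv \<beta> H (bs @ ds) G (as @ cs))"
    proof (intro allI impI conjI ballI)
      fix \<beta> ds assume b: "\<beta> < \<alpha>" and "ds \<in> lists (carrier H)"
      then obtain cs where "cs \<in> lists (carrier G)" "length cs = length ds" "bf_equiv \<beta> G (as @ cs) H (bs @ ds)"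
        using * by blast
      then show "\<exists>cs\<in>lists (carrier G). length cs = length ds \<and> bf_equiv \<beta> H (bs @ ds) G (as @ cs)"
        using ** [OF b] by force
    next
      fix \<beta> cs assume b: "\<beta> < \<alpha>" and "cs \<in> lists (carrier G)"
      then obtain ds where "ds \<in> lists (carrier H)" "length ds = length cs" "bf_equiv \<beta> G (as @ cs) H (bs @ ds)"
        using * by blast
      then show "\<exists>ds\<in>lists (carrier H). length ds = length cs \<and> bf_equiv \<beta> H (bs @ ds) G (as @ cs)"
        using ** [OF b] by force
    qed
    then show ?thesis
      by (subst bf_equiv.simps) (simp only: False if_False)
  qed
qed

lemma bf_equiv_imp_same_qf_type: "bf_equiv \<alpha> G as H bs \<Longrightarrow> same_qf_type G as H bs"
proof (induction \<alpha> rule: less_induct)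
  case (less \<alpha>)
  show ?case
  proof (cases "\<forall>\<beta>. \<alpha> \<le> \<beta>")
    case True
    then show ?thesis
      using less.prems by (subst (asm) bf_equiv.simps) simp
  next
    case False
    then obtain \<beta> where \<beta>: "\<beta> < \<alpha>"
      by (auto simp: not_le)
    obtain ds where "ds \<in> lists (carrier H)" "length ds = length []" "bf_equiv \<beta> G (as @ []) H (bs @ ds)"
      using bf_equiv_forth [OF less.prems \<beta>, of "[]"] by auto
    then show ?thesis
      using less.IH [OF \<beta>] by simp
  qed
qed

lemma same_qf_type_term_eq:
  assumes "same_qf_type G as H bs" "group_term_vars s \<subseteq> {..<length as}" "group_term_vars t \<subseteq> {..<length as}"
  shows "group_term_val G as s = group_term_val G as t \<longleftrightarrow> group_term_val H bs s = group_term_val H bs t"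
  using assms(1) [unfolded same_qf_type_def, rule_format, of "GEq s t"] assms(2,3) by simp


section \<open>Formal elements of the group algebra\<close>

text \<open>
  A formal element is a list of coefficients and group terms. It has a value in the group algebra
  of every group at every tuple long enough for its variables.
\<close>

definition formal_val :: "('a, 'm) monoid_scheme \<Rightarrow> 'a list \<Rightarrow> (complex \<times> group_term) list \<Rightarrow> 'a operator" where
  "formal_val G as p = gcomb G (map (map_prod id (group_term_val G as)) p)"

definition formal_vars :: "(complex \<times> group_term) list \<Rightarrow> nat set" where
  "formal_vars p = (\<Union>x\<in>set p. group_term_vars (snd x))"

text \<open>
Formal products and adjoints.
\<close>

definition formal_mult :: "(complex \<times> group_term) list \<Rightarrow> (complex \<times> group_term) list \<Rightarrow> (complex \<times> group_term) list" where
  "formal_mult p q = concat (map (\<lambda>x. map (\<lambda>y. (fst x * fst y, GMult (snd x) (snd y))) q) p)"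

definition formal_adj :: "(complex \<times> group_term) list \<Rightarrow> (complex \<times> group_term) list" where
  "formal_adj p = map (\<lambda>x. (cnj (fst x), GInv (snd x))) p"

lemma formal_vars_simps [simp]:
  "formal_vars [] = {}" "formal_vars (p @ q) = formal_vars p \<union> formal_vars q" "formal_vars (gscale c p) = formal_vars p"
  "formal_vars (formal_adj p) = formal_vars p" "formal_vars [(c, t)] = group_term_vars t"
  by (auto simp: formal_vars_def gscale_def formal_adj_def)

lemma formal_vars_formal_mult: "formal_vars (formal_mult p q) \<subseteq> formal_vars p \<union> formal_vars q"
  by (auto simp: formal_vars_def formal_mult_def)

lemma group_term_val_append:
  "group_term_vars t \<subseteq> {..<length as} \<Longrightarrow> group_term_val G (as @ cs) t = group_term_val G as t"
  by (induction t) (auto simp: nth_append)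

lemma formal_val_append_tuple:
  assumes "formal_vars p \<subseteq> {..<length as}"
  shows "formal_val G (as @ cs) p = formal_val G as p"
proof -
  have "map (map_prod id (group_term_val G (as @ cs))) p = map (map_prod id (group_term_val G as)) p"
    using assms by (intro map_cong refl) (auto simp: formal_vars_def group_term_val_append UN_subset_iff split: prod.splits)
  then show ?thesis
    by (simp only: formal_val_def)
qed

text \<open>
  A group algebra element is the value of a formal element once the group elements in it are
  appended to a tuple of length \<open>n\<close>, where they are named by the variables from \<open>n\<close> on.
\<close>

definition formal_of :: "nat \<Rightarrow> (complex \<times> 'a) list \<Rightarrow> (complex \<times> group_term) list" where
  "formal_of n p = map (\<lambda>j. (fst (p ! j), GVar (n + j))) [0..<length p]"

lemma formal_vars_formal_of: "formal_vars (formal_of n p) \<subseteq> {..<n + length p}"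
  by (auto simp: formal_of_def formal_vars_def)

lemma formal_val_formal_of: "formal_val G (as @ map snd p) (formal_of (length as) p) = gcomb G p"
proof -
  have "map (map_prod id (group_term_val G (as @ map snd p))) (formal_of (length as) p) = p"
    by (rule nth_equalityI) (auto simp: formal_of_def nth_append)
  then show ?thesis
    by (simp only: formal_val_def)
qed

context group
begin

lemma group_term_val_closed [simp]:
  "as \<in> lists A \<Longrightarrow> group_term_vars t \<subseteq> {..<length as} \<Longrightarrow> group_term_val G as t \<in> A"
  by (induction t) auto

lemma supported_formal_val:
  assumes "as \<in> lists A" "formal_vars p \<subseteq> {..<length as}"
  shows "supported (map (map_prod id (group_term_val G as)) p)"
proof -
  have "group_term_val G as (snd x) \<in> A" if "x \<in> set p" for x
    using assms that by (intro group_term_val_closed) (auto simp: formal_vars_def)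
  then show ?thesis
    by (auto simp: supported_def)
qed

lemma formal_val_commutant: "as \<in> lists A \<Longrightarrow> formal_vars p \<subseteq> {..<length as} \<Longrightarrow> formal_val G as p \<in> commutant"
  by (simp add: formal_val_def supported_formal_val)

lemma formal_val_Nil: "formal_val G as [] = 0"
  by (simp add: formal_val_def)

lemma formal_val_append: "formal_val G as (p @ q) = formal_val G as p + formal_val G as q"
  by (simp add: formal_val_def gcomb_append)

lemma formal_val_gscale: "formal_val G as (gscale c p) = op_smul c (formal_val G as p)"
proof -
  have "map (map_prod id (group_term_val G as)) (gscale c p) = gscale c (map (map_prod id (group_term_val G as)) p)"
    by (simp add: gscale_def)
  then show ?thesis
    by (simp only: formal_val_def gcomb_gscale)
qed

lemma formal_val_formal_adj:
  assumes "as \<in> lists A" "formal_vars p \<subseteq> {..<length as}"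
  shows "formal_val G as (formal_adj p) = adjoint_op A (formal_val G as p)"
proof -
  have "map (map_prod id (group_term_val G as)) (formal_adj p) = gadj G (map (map_prod id (group_term_val G as)) p)"
    by (simp add: formal_adj_def gadj_def)
  then show ?thesis
    by (simp only: formal_val_def gcomb_gadj [OF supported_formal_val [OF assms]])
qed

lemma formal_val_formal_mult:
  assumes "as \<in> lists A" "formal_vars p \<subseteq> {..<length as}" "formal_vars q \<subseteq> {..<length as}"
  shows "formal_val G as (formal_mult p q) = formal_val G as p \<circ> formal_val G as q"
proof -
  have "map (map_prod id (group_term_val G as)) (formal_mult p q) =
      gmult G (map (map_prod id (group_term_val G as)) p) (map (map_prod id (group_term_val G as)) q)"
    by (simp add: formal_mult_def gmult_def map_concat o_def)
  then show ?thesis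
    by (simp only: formal_val_def gcomb_gmult [OF supported_formal_val [OF assms(1,2)] supported_formal_val [OF assms(1,3)]])
qed

lemma left_regular_one: "left_regular G \<one> = identity_op A"
  by (auto simp: left_regular_def identity_op_def fun_eq_iff l2_def)

lemma formal_val_one: "formal_val G as [(1, GOne)] = identity_op A"
  by (simp add: formal_val_def left_regular_one)

lemma gcomb_Cons_apply: "gcomb G (x # p) f = smul (fst x) (left_regular G (snd x) f) + gcomb G p f"
  by (simp only: gcomb.simps plus_fun_apply)

lemma l2_inner_gcomb:
  assumes "supported p" "supported q"
  shows "l2_inner A (gcomb G p (delta \<one>)) (gcomb G q (delta \<one>)) =
    (\<Sum>x\<leftarrow>p. \<Sum>y\<leftarrow>q. if snd x = snd y then fst x * cnj (fst y) else 0)"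
proof -
  have lr: "left_regular G a (delta \<one>) = delta a" if "a \<in> A" for a
    using left_regular_indicator [OF is_group that, of \<one>] that by simp
  have l2: "gcomb G p (delta \<one>) \<in> l2 A" if "supported p" for p
    using that by auto
  have single: "l2_inner A (delta a) (gcomb G q (delta \<one>)) = (\<Sum>y\<leftarrow>q. if a = snd y then cnj (fst y) else 0)"
    if "a \<in> A" for a
    using assms(2)
  proof (induction q)
    case (Cons y q)
    have y: "snd y \<in> A" and q: "supported q"
      using Cons.prems by auto
    have "l2_inner A (delta a) (gcomb G (y # q) (delta \<one>)) =
        cnj (fst y) * l2_inner A (delta a) (delta (snd y)) + l2_inner A (delta a) (gcomb G q (delta \<one>))"
      unfolding gcomb_Cons_apply lr [OF y]
      using l2_inner_add_right [OF l2_smul [OF l2_delta [OF y]] l2 [OF q] l2_delta [OF that], of "fst y"]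
      by (simp only: l2_inner_smul_right)
    moreover have "l2_inner A (delta a) (delta (snd y)) = (if a = snd y then 1 else 0)"
      by (auto simp: l2_inner_delta_right [OF y] indicator_def)
    ultimately show ?case
      using Cons.IH [OF q] by (simp del: gcomb.simps)
  qed simp
  show ?thesis
    using assms(1)
  proof (induction p)
    case (Cons x p)
    have x: "snd x \<in> A" and p: "supported p"
      using Cons.prems by auto
    have "l2_inner A (gcomb G (x # p) (delta \<one>)) (gcomb G q (delta \<one>)) =
        fst x * l2_inner A (delta (snd x)) (gcomb G q (delta \<one>)) +
        l2_inner A (gcomb G p (delta \<one>)) (gcomb G q (delta \<one>))"
      unfolding gcomb_Cons_apply lr [OF x]
      using l2_inner_add_left [OF l2_smul [OF l2_delta [OF x]] l2 [OF p] l2 [OF assms(2)], of "fst x"]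
      by (simp only: l2_inner_smul_left)
    moreover have "fst x * (\<Sum>y\<leftarrow>q. if snd x = snd y then cnj (fst y) else 0) =
        (\<Sum>y\<leftarrow>q. if snd x = snd y then fst x * cnj (fst y) else 0)"
      by (induction q) (auto simp: ring_distribs)
    ultimately show ?case
      using Cons.IH [OF p] single [OF x] by (simp del: gcomb.simps)
  qed simp
qed

lemma norm2_formal_val:
  assumes "as \<in> lists A" "formal_vars p \<subseteq> {..<length as}"
  shows "norm2 (formal_val G as p) = sqrt (Re (\<Sum>x\<leftarrow>p. \<Sum>y\<leftarrow>p.
    if group_term_val G as (snd x) = group_term_val G as (snd y) then fst x * cnj (fst y) else 0))"
proof -
  note c = supported_formal_val [OF assms]
  have "norm2 (formal_val G as p) = sqrt (Re (l2_inner A (formal_val G as p (delta \<one>)) (formal_val G as p (delta \<one>))))"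
    using formal_val_commutant [OF assms] by (simp add: norm2_def l2_inner_self)
  then show ?thesis
    unfolding formal_val_def l2_inner_gcomb [OF c c] by (simp add: o_def cong: if_cong)
qed

text \<open>
  An operator norm bound in the commutant may be tested by multiplication with group algebra
  elements, whose vectors are the finitely supported functions.
\<close>

lemma op_le_dense:
  assumes T: "T \<in> commutant" and K: "K \<ge> 0"
    and le: "\<And>q. supported q \<Longrightarrow> norm2 (T \<circ> gcomb G q) \<le> K * norm2 (gcomb G q)"
  shows "op_le A T K"
  unfolding op_le_def
proof
  fix f assume f: "f \<in> l2 A"
  have B: "T \<in> bounded_operators A"
    using T by simp
  obtain C where C: "C \<ge> 1" "op_le A T C"
    using bop_bound [OF B] by blast
  show "l2_norm A (T f) \<le> K * l2_norm A f"
  proof (rule field_le_epsilon)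
    fix e :: real assume "e > 0"
    then have pos: "e / (C + K) > 0"
      using C K by simp
    obtain F where F: "finite F" "F \<subseteq> A" "l2_norm A (f - (\<Sum>a\<in>F. smul (f a) (delta a))) < e / (C + K)"
      by (rule l2_approx_finite [OF f pos])
    obtain xs where xs: "distinct xs" "set xs = F"
      using finite_distinct_list [OF F(1)] by blast
    let ?q = "map (\<lambda>a. (f a, a)) xs"
    define g where "g = gcomb G ?q (delta \<one>)"
    have q: "supported ?q"
      using xs F(2) by (auto simp: supported_def)
    have g: "g \<in> l2 A"
      unfolding g_def using q by auto
    have fg: "l2_norm A (f - g) < e / (C + K)"
      using gcomb_delta_one [of xs f] xs F by (simp add: g_def)
    have "l2_norm A (T f) \<le> l2_norm A (T (f - g)) + l2_norm A (T g)"
      using l2_norm_triangle [of "T (f - g)" A "T g"] B bop_diff [OF B f g] by simp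
    also have "\<dots> \<le> C * l2_norm A (f - g) + K * (l2_norm A f + l2_norm A (f - g))"
    proof (rule add_mono)
      show "l2_norm A (T (f - g)) \<le> C * l2_norm A (f - g)"
        using op_leD [OF C(2)] f g by blast
      have "l2_norm A (T g) \<le> K * l2_norm A g"
        using le [OF q] by (simp add: norm2_def g_def)
      also have "l2_norm A g \<le> l2_norm A f + l2_norm A (f - g)"
        using l2_norm_diff_triangle [of f A "f - g"] f g by simp
      finally show "l2_norm A (T g) \<le> K * (l2_norm A f + l2_norm A (f - g))"
        using K by (simp add: mult_left_mono)
    qed
    also have "\<dots> = K * l2_norm A f + (C + K) * l2_norm A (f - g)"
      by (simp only: ring_distribs)
    finally have "l2_norm A (T f) \<le> K * l2_norm A f + (C + K) * l2_norm A (f - g)" .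
    also have "(C + K) * l2_norm A (f - g) \<le> e"
      using fg C K by (simp add: field_simps)
    finally show "l2_norm A (T f) \<le> K * l2_norm A f + e"
      by simp
  qed
qed

end

lemma norm2_formal_val_transfer:
  assumes "group G" "group H" and as: "as \<in> lists (carrier G)" and bs: "bs \<in> lists (carrier H)"
    and len: "length as = length bs" and qf: "same_qf_type G as H bs" and p: "formal_vars p \<subseteq> {..<length as}"
  shows "group.norm2 G (formal_val G as p) = group.norm2 H (formal_val H bs p)"
proof -
  interpret G: group G by fact
  interpret H: group H by fact
  have "(\<Sum>x\<leftarrow>p. \<Sum>y\<leftarrow>p. if group_term_val G as (snd x) = group_term_val G as (snd y) then fst x * cnj (fst y) else 0) =
    (\<Sum>x\<leftarrow>p. \<Sum>y\<leftarrow>p. if group_term_val H bs (snd x) = group_term_val H bs (snd y) then fst x * cnj (fst y) else 0)"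
  proof (intro arg_cong [where f = sum_list] map_cong refl if_cong)
    fix x y assume "x \<in> set p" "y \<in> set p"
    then show "group_term_val G as (snd x) = group_term_val G as (snd y) \<longleftrightarrow>
        group_term_val H bs (snd x) = group_term_val H bs (snd y)"
      using p by (intro same_qf_type_term_eq [OF qf]) (auto simp: formal_vars_def)
  qed
  then show ?thesis
    using G.norm2_formal_val [OF as p] H.norm2_formal_val [OF bs, of p] p len by simp
qed

text \<open>
  One further move of the game answers the finitely many group elements that occur in a vector on
  which the operator norm is tested.
\<close>

lemma op_le_formal_val_transfer:
  assumes "group G" "group H" and as: "as \<in> lists (carrier G)" and bs: "bs \<in> lists (carrier H)"
    and len: "length as = length bs" and bf: "bf_equiv \<alpha> G as H bs" "\<beta> < \<alpha>"
    and p: "formal_vars p \<subseteq> {..<length as}"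
    and K: "op_le (carrier G) (formal_val G as p) K" "K \<ge> 0"
  shows "op_le (carrier H) (formal_val H bs p) K"
proof -
  interpret G: group G by fact
  interpret H: group H by fact
  have pH: "formal_vars p \<subseteq> {..<length bs}"
    using p len by simp
  show ?thesis
  proof (rule H.op_le_dense [OF H.formal_val_commutant [OF bs pH] K(2)])
    fix q assume q: "H.supported q"
    have ds: "map snd q \<in> lists (carrier H)"
      using q by (auto simp: H.supported_def)
    obtain cs where cs: "cs \<in> lists (carrier G)" "length cs = length (map snd q)"
      "bf_equiv \<beta> H (bs @ map snd q) G (as @ cs)"
      by (rule bf_equiv_forth [OF bf_equiv_sym [OF len bf(1)] bf(2) ds])
    let ?q = "formal_of (length bs) q" and ?as = "as @ cs" and ?bs = "bs @ map snd q"
    have qf: "same_qf_type H ?bs G ?as"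
      by (rule bf_equiv_imp_same_qf_type [OF cs(3)])
    have l: "?as \<in> lists (carrier G)" "?bs \<in> lists (carrier H)" "length ?bs = length ?as"
      using as bs cs(1,2) ds len by auto
    have vq: "formal_vars ?q \<subseteq> {..<length ?bs}" "formal_vars ?q \<subseteq> {..<length ?as}"
      using formal_vars_formal_of [of "length bs" q] cs(2) len by auto
    have vp: "formal_vars p \<subseteq> {..<length ?bs}" "formal_vars p \<subseteq> {..<length ?as}"
      using p len by auto
    have vpq: "formal_vars (formal_mult p ?q) \<subseteq> {..<length ?bs}"
      using formal_vars_formal_mult vq(1) vp(1) by blast
    have "H.norm2 (formal_val H bs p \<circ> gcomb H q) = H.norm2 (formal_val H ?bs p \<circ> formal_val H ?bs ?q)"
      by (simp only: formal_val_formal_of formal_val_append_tuple [OF pH])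
    also have "\<dots> = H.norm2 (formal_val H ?bs (formal_mult p ?q))"
      by (simp only: H.formal_val_formal_mult [OF l(2) vp(1) vq(1)])
    also have "\<dots> = G.norm2 (formal_val G ?as (formal_mult p ?q))"
      by (rule norm2_formal_val_transfer [OF assms(2,1) l(2,1,3) qf vpq])
    also have "\<dots> = G.norm2 (formal_val G as p \<circ> formal_val G ?as ?q)"
      by (simp only: G.formal_val_formal_mult [OF l(1) vp(2) vq(2)] formal_val_append_tuple [OF p])
    also have "\<dots> \<le> K * G.norm2 (formal_val G ?as ?q)"
      by (rule G.norm2_comp_left [OF K(1) G.formal_val_commutant [OF l(1) vq(2)]])
    also have "G.norm2 (formal_val G ?as ?q) = H.norm2 (formal_val H ?bs ?q)"
      by (rule norm2_formal_val_transfer [OF assms(2,1) l(2,1,3) qf vq(1), symmetric])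
    also have "\<dots> = H.norm2 (gcomb H q)"
      by (simp only: formal_val_formal_of)
    finally show "H.norm2 (formal_val H bs p \<circ> gcomb H q) \<le> K * H.norm2 (gcomb H q)" .
  qed
qed

section \<open>Group von Neumann algebras as metric structures\<close>

lemma vN_interp_simps:
  "vN_interp A VZero xs = 0" "vN_interp A VOne xs = identity_op A"
  "vN_interp A (VAdd m n) xs = xs ! 0 + xs ! 1" "vN_interp A (VMult m n) xs = xs ! 0 \<circ> xs ! 1"
  "vN_interp A (VScale c n) xs = op_smul c (xs ! 0)" "vN_interp A (VAdj n) xs = adjoint_op A (xs ! 0)"
  "vN_interp A (VIncl m n) xs = xs ! 0"
  by (auto simp: fun_eq_iff)

lemma vN_language_simps:
  "n \<in> sorts vN_language \<longleftrightarrow> n > 0" "fun_dom vN_language = vN_dom" "fun_rng vN_language = vN_rng"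
  "f \<in> funs vN_language \<longleftrightarrow> (\<forall>n\<in>set (vN_dom f). n > 0) \<and> (\<forall>m n. f = VIncl m n \<longrightarrow> m \<le> n)"
  by (auto simp: vN_language_def)

lemma vN_rng_pos: "f \<in> funs vN_language \<Longrightarrow> vN_rng f > 0"
  by (cases f) (auto simp: vN_language_simps)

context group
begin

abbreviation "vN \<equiv> group_vN_structure G"

text \<open>
  The operator norm balls of the commutant, used as the larger sorts for $L(G)$.
\<close>

definition comm_ball :: "nat \<Rightarrow> 'a operator set" where
  "comm_ball n = {T \<in> commutant. op_le A T (real n)}"

lemma vN_interp [simp]: "interp vN = vN_interp A"
  by (simp add: group_vN_structure_def tracial_structure_def)

lemma vN_dist:
  assumes "S \<in> commutant" "T \<in> commutant"
  shows "mdist vN n S T = norm2 (S - T)"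
proof -
  have "(\<lambda>f x. S f x - T f x) = S - T"
    by (simp add: fun_eq_iff)
  then have "mdist vN n S T = two_norm A (group_trace G) (S - T)"
    by (simp add: group_vN_structure_def tracial_structure_def)
  also have "\<dots> = norm2 (S - T)"
    using assms by (intro two_norm_eq_norm2) auto
  finally show ?thesis .
qed

lemma vN_universe: "T \<in> universe vN n \<longleftrightarrow> T \<in> group_vN_algebra G \<and> op_le A T (real n)"
  using vN_in_commutant operator_norm_le_iff [of T A "real n"]
  by (auto simp: group_vN_structure_def tracial_structure_def)

lemma universe_comm_ball: "universe vN n \<subseteq> comm_ball n"
  using vN_in_commutant by (auto simp: vN_universe comm_ball_def)

lemma gcomb_in_universe: "supported p \<Longrightarrow> op_le A (gcomb G p) (real n) \<Longrightarrow> gcomb G p \<in> universe vN n"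
  by (simp add: vN_universe gcomb_in_vN)

lemma comm_ball_add: "S \<in> comm_ball m \<Longrightarrow> T \<in> comm_ball n \<Longrightarrow> S + T \<in> comm_ball (m + n)"
  using op_le_add [of S A T "real m" "real n"] by (auto simp: comm_ball_def)

lemma comm_ball_comp: "S \<in> comm_ball m \<Longrightarrow> T \<in> comm_ball n \<Longrightarrow> S \<circ> T \<in> comm_ball (m * n)"
  using op_le_comp [of T A S "real m" "real n"] by (auto simp: comm_ball_def)

lemma comm_ball_scale:
  assumes "T \<in> comm_ball n"
  shows "op_smul c T \<in> comm_ball (vN_rng (VScale c n))"
proof -
  have "op_le A (op_smul c T) (cmod c * real n)"
    using assms by (intro op_le_op_smul) (simp add: comm_ball_def)
  moreover have "cmod c * real n \<le> real (vN_rng (VScale c n))"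
    unfolding vN_rng.simps using real_nat_ceiling_ge [of "cmod c * real n"] by linarith
  ultimately show ?thesis
    using assms op_le_mono by (auto simp: comm_ball_def)
qed

lemma comm_ball_adjoint: "T \<in> comm_ball n \<Longrightarrow> adjoint_op A T \<in> comm_ball n"
  using op_le_adjoint [of T A "real n"] by (auto simp: comm_ball_def)

lemma comm_ball_mono: "T \<in> comm_ball m \<Longrightarrow> m \<le> n \<Longrightarrow> T \<in> comm_ball n"
  using op_le_mono [of A T "real m" "real n"] by (auto simp: comm_ball_def)

lemma comm_ball_commutant: "T \<in> comm_ball n \<Longrightarrow> T \<in> commutant"
  by (simp add: comm_ball_def)

text \<open>
  The uniform continuity of multiplication on balls, from
  $S T - S' T' = (S - S') T + S' (T - T')$ and the trace property.
\<close>

lemma norm2_comp_diff: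
  assumes "S \<in> comm_ball m" "S' \<in> comm_ball m" "T \<in> comm_ball n" "T' \<in> comm_ball n"
  shows "norm2 ((S \<circ> T) - (S' \<circ> T')) \<le> real n * norm2 (S - S') + real m * norm2 (T - T')"
proof -
  have C: "S \<in> commutant" "S' \<in> commutant" "T \<in> commutant" "T' \<in> commutant"
    using assms comm_ball_commutant by auto
  have "(S \<circ> T) - (S' \<circ> T') = ((S - S') \<circ> T) + (S' \<circ> (T - T'))"
  proof (rule ext)
    fix f
    have "S' (T f - T' f) = S' (T f) - S' (T' f)"
      using C by (intro bop_diff [of _ A]) auto
    then show "((S \<circ> T) - (S' \<circ> T')) f = (((S - S') \<circ> T) + (S' \<circ> (T - T'))) f"
      by (simp only: comp_apply plus_fun_apply minus_apply) simp
  qed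
  then have "norm2 ((S \<circ> T) - (S' \<circ> T')) \<le> norm2 ((S - S') \<circ> T) + norm2 (S' \<circ> (T - T'))"
    using C by (simp only:) (intro norm2_triangle commutant_comp commutant_diff)
  also have "\<dots> \<le> real n * norm2 (S - S') + real m * norm2 (T - T')"
    using assms C by (intro add_mono norm2_comp_right norm2_comp_left commutant_diff) (auto simp: comm_ball_def)
  finally show ?thesis .
qed

lemma vN_fun_closed:
  assumes f: "f \<in> funs vN_language" and xs: "list_all2 (\<lambda>x s. x \<in> comm_ball s) xs (vN_dom f)"
  shows "vN_interp A f xs \<in> comm_ball (vN_rng f)"
proof (cases f)
  case VZero
  show ?thesis unfolding VZero vN_interp_simps by (simp add: comm_ball_def op_le_zero)
next
  case VOne
  show ?thesis unfolding VOne vN_interp_simps by (simp add: comm_ball_def op_le_identity)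
next
  case (VAdd m n)
  show ?thesis using xs unfolding VAdd vN_interp_simps vN_rng.simps vN_dom.simps
    by (intro comm_ball_add) (auto simp: list_all2_Cons2)
next
  case (VMult m n)
  show ?thesis using xs unfolding VMult vN_interp_simps vN_rng.simps vN_dom.simps
    by (intro comm_ball_comp) (auto simp: list_all2_Cons2)
next
  case (VScale c n)
  show ?thesis using xs unfolding VScale vN_interp_simps vN_dom.simps
    by (intro comm_ball_scale) (auto simp: list_all2_Cons2)
next
  case (VAdj n)
  show ?thesis using xs unfolding VAdj vN_interp_simps vN_rng.simps vN_dom.simps
    by (intro comm_ball_adjoint) (auto simp: list_all2_Cons2)
next
  case (VIncl m n)
  have "m \<le> n"
    using f unfolding VIncl vN_language_simps by blast
  then show ?thesis using xs unfolding VIncl vN_interp_simps vN_rng.simps vN_dom.simps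
    by (intro comm_ball_mono [of _ m n]) (auto simp: list_all2_Cons2)
qed

lemma vN_fun_uniform:
  assumes f: "f \<in> funs vN_language" and \<epsilon>: "\<epsilon> > 0"
  shows "\<exists>\<delta>>0. \<forall>xs ys. list_all2 (\<lambda>x s. x \<in> comm_ball s) xs (vN_dom f) \<longrightarrow>
    list_all2 (\<lambda>x s. x \<in> comm_ball s) ys (vN_dom f) \<longrightarrow>
    (\<forall>i<length (vN_dom f). norm2 (xs ! i - ys ! i) < \<delta>) \<longrightarrow>
    norm2 (vN_interp A f xs - vN_interp A f ys) < \<epsilon>"
proof (cases f)
  case VZero
  then show ?thesis
    unfolding VZero vN_interp_simps using \<epsilon> by (intro exI [of _ 1]) simp
next
  case VOne
  then show ?thesis
    unfolding VOne vN_interp_simps using \<epsilon> by (intro exI [of _ 1]) simp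
next
  case (VAdd m n)
  show ?thesis
    unfolding VAdd vN_interp_simps vN_dom.simps
  proof (intro exI [of _ "\<epsilon> / 2"] conjI allI impI)
    show "\<epsilon> / 2 > 0"
      using \<epsilon> by simp
    fix xs ys
    assume "list_all2 (\<lambda>x s. x \<in> comm_ball s) xs [m, n]" "list_all2 (\<lambda>x s. x \<in> comm_ball s) ys [m, n]"
      and c: "\<forall>i<length [m, n]. norm2 (xs ! i - ys ! i) < \<epsilon> / 2"
    then obtain x x' y y' where xs: "xs = [x, x']" "ys = [y, y']" and
      C: "x \<in> commutant" "x' \<in> commutant" "y \<in> commutant" "y' \<in> commutant"
      by (auto simp: list_all2_Cons2 comm_ball_def)
    have d: "norm2 (x - y) < \<epsilon> / 2" "norm2 (x' - y') < \<epsilon> / 2"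
      using c [rule_format, of 0] c [rule_format, of 1] by (auto simp: xs)
    have "(x + x') - (y + y') = (x - y) + (x' - y')"
      by simp
    then have "norm2 ((x + x') - (y + y')) \<le> norm2 (x - y) + norm2 (x' - y')"
      using C by (simp only:) (intro norm2_triangle commutant_diff)
    then show "norm2 ((xs ! 0 + xs ! 1) - (ys ! 0 + ys ! 1)) < \<epsilon>"
      using d unfolding xs by simp
  qed
next
  case (VMult m n)
  have mn: "m > 0" "n > 0"
    using f by (auto simp: VMult vN_language_simps)
  show ?thesis
    unfolding VMult vN_interp_simps vN_dom.simps
  proof (intro exI [of _ "\<epsilon> / real (m + n)"] conjI allI impI)
    show "\<epsilon> / real (m + n) > 0"
      using \<epsilon> mn by simp
    fix xs ys
    assume "list_all2 (\<lambda>x s. x \<in> comm_ball s) xs [m, n]" "list_all2 (\<lambda>x s. x \<in> comm_ball s) ys [m, n]"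
      and c: "\<forall>i<length [m, n]. norm2 (xs ! i - ys ! i) < \<epsilon> / real (m + n)"
    then obtain x x' y y' where xs: "xs = [x, x']" "ys = [y, y']" and
      C: "x \<in> comm_ball m" "x' \<in> comm_ball n" "y \<in> comm_ball m" "y' \<in> comm_ball n"
      by (auto simp: list_all2_Cons2)
    have d: "norm2 (x - y) < \<epsilon> / real (m + n)" "norm2 (x' - y') < \<epsilon> / real (m + n)"
      using c [rule_format, of 0] c [rule_format, of 1] by (auto simp: xs)
    have "norm2 ((x \<circ> x') - (y \<circ> y')) \<le> real n * norm2 (x - y) + real m * norm2 (x' - y')"
      by (rule norm2_comp_diff [OF C(1,3,2,4)])
    also have "\<dots> < real n * (\<epsilon> / real (m + n)) + real m * (\<epsilon> / real (m + n))"
      using d mn by (intro add_strict_mono mult_strict_left_mono) auto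
    also have "\<dots> = real (m + n) * (\<epsilon> / real (m + n))"
      by (simp only: of_nat_add ring_distribs add.commute)
    also have "\<dots> = \<epsilon>"
      using mn by simp
    finally show "norm2 ((xs ! 0 \<circ> xs ! 1) - (ys ! 0 \<circ> ys ! 1)) < \<epsilon>"
      unfolding xs by simp
  qed
next
  case (VScale c n)
  show ?thesis
    unfolding VScale vN_interp_simps vN_dom.simps
  proof (intro exI [of _ "\<epsilon> / (cmod c + 1)"] conjI allI impI)
    have p: "cmod c + 1 > 0"
      using norm_ge_zero [of c] by linarith
    then show "\<epsilon> / (cmod c + 1) > 0"
      using \<epsilon> by simp
    fix xs ys
    assume "\<forall>i<length [n]. norm2 (xs ! i - ys ! i) < \<epsilon> / (cmod c + 1)"
    then have d: "norm2 (xs ! 0 - ys ! 0) < \<epsilon> / (cmod c + 1)"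
      by simp
    have "op_smul c (xs ! 0) - op_smul c (ys ! 0) = op_smul c (xs ! 0 - ys ! 0)"
      by (intro ext) (simp add: algebra_simps)
    then have "norm2 (op_smul c (xs ! 0) - op_smul c (ys ! 0)) = cmod c * norm2 (xs ! 0 - ys ! 0)"
      by (simp only: norm2_op_smul)
    also have "\<dots> \<le> (cmod c + 1) * norm2 (xs ! 0 - ys ! 0)"
      by (simp add: ring_distribs)
    also have "\<dots> < \<epsilon>"
      using d p by (simp add: field_simps)
    finally show "norm2 (op_smul c (xs ! 0) - op_smul c (ys ! 0)) < \<epsilon>" .
  qed
next
  case (VAdj n)
  show ?thesis
    unfolding VAdj vN_interp_simps vN_dom.simps
  proof (intro exI [of _ \<epsilon>] conjI allI impI)
    fix xs ys
    assume "list_all2 (\<lambda>x s. x \<in> comm_ball s) xs [n]" "list_all2 (\<lambda>x s. x \<in> comm_ball s) ys [n]"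
      and c: "\<forall>i<length [n]. norm2 (xs ! i - ys ! i) < \<epsilon>"
    then obtain x y where xs: "xs = [x]" "ys = [y]" and C: "x \<in> commutant" "y \<in> commutant"
      by (auto simp: list_all2_Cons2 comm_ball_def)
    have "norm2 (adjoint_op A x - adjoint_op A y) = norm2 (x - y)"
      using C by (simp only: adjoint_diff [symmetric] commutant_bop norm2_adjoint commutant_diff)
    then show "norm2 (adjoint_op A (xs ! 0) - adjoint_op A (ys ! 0)) < \<epsilon>"
      using c unfolding xs by simp
  qed (rule \<epsilon>)
next
  case (VIncl m n)
  show ?thesis
    unfolding VIncl vN_interp_simps vN_dom.simps
    using \<epsilon> by (intro exI [of _ \<epsilon>]) simp
qed

lemma list_all2_comm_ball_nth: "list_all2 (\<lambda>x s. x \<in> comm_ball s) xs ds \<Longrightarrow> i < length ds \<Longrightarrow> xs ! i \<in> commutant"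
  by (auto simp: list_all2_conv_all_nth comm_ball_def)

lemma vN_envelope: "uniform_envelope vN_language vN comm_ball"
proof
  fix s assume s: "s \<in> sorts vN_language"
  show "universe vN s \<subseteq> comm_ball s"
    by (rule universe_comm_ball)
  show "universe vN s \<noteq> {}"
    using gcomb_in_universe [of "[]" s] by (auto simp: op_le_zero)
  show "mdist vN s x x = 0" if "x \<in> comm_ball s" for x
    using that by (simp add: vN_dist comm_ball_commutant)
  show "\<exists>B. \<forall>x\<in>comm_ball s. \<forall>y\<in>comm_ball s. \<bar>mdist vN s x y\<bar> \<le> B"
  proof (intro exI [of _ "real s + real s"] ballI)
    fix x y assume x: "x \<in> comm_ball s" and y: "y \<in> comm_ball s"
    have "op_le A (x - y) (real s + real s)"
      using x y by (intro op_le_diff) (auto simp: comm_ball_def)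
    then show "\<bar>mdist vN s x y\<bar> \<le> real s + real s"
      using norm2_le x y by (simp add: vN_dist comm_ball_commutant)
  qed
  fix x x' y y' assume "x \<in> comm_ball s" "x' \<in> comm_ball s" "y \<in> comm_ball s" "y' \<in> comm_ball s"
  then have C: "x \<in> commutant" "x' \<in> commutant" "y \<in> commutant" "y' \<in> commutant"
    by (auto simp: comm_ball_commutant)
  have "norm2 (x - y) \<le> norm2 (x - x') + (norm2 (x' - y') + norm2 (y' - y))"
    using C by (intro order_trans [OF norm2_triangle_diff [of x x' y]] add_left_mono norm2_triangle_diff)
  moreover have "norm2 (x' - y') \<le> norm2 (x' - x) + (norm2 (x - y) + norm2 (y - y'))"
    using C by (intro order_trans [OF norm2_triangle_diff [of x' x y']] add_left_mono norm2_triangle_diff)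
  ultimately show "\<bar>mdist vN s x y - mdist vN s x' y'\<bar> \<le> mdist vN s x x' + mdist vN s y y'"
    using norm2_minus_commute [of x x'] norm2_minus_commute [of y y'] C by (simp add: vN_dist)
next
  fix f assume f: "f \<in> funs vN_language"
  show rng: "fun_rng vN_language f \<in> sorts vN_language"
    using vN_rng_pos [OF f] by (simp add: vN_language_simps)
  show "interp vN f xs \<in> comm_ball (fun_rng vN_language f)"
    if "list_all2 (\<lambda>x s. x \<in> comm_ball s) xs (fun_dom vN_language f)" for xs
    using vN_fun_closed [OF f] that by (simp add: vN_language_simps)
  fix \<epsilon> :: real assume "\<epsilon> > 0"
  from vN_fun_uniform [OF f this] obtain \<delta> where \<delta>: "\<delta> > 0"
    "\<And>xs ys. list_all2 (\<lambda>x s. x \<in> comm_ball s) xs (vN_dom f) \<Longrightarrow>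
    list_all2 (\<lambda>x s. x \<in> comm_ball s) ys (vN_dom f) \<Longrightarrow>
    (\<forall>i<length (vN_dom f). norm2 (xs ! i - ys ! i) < \<delta>) \<Longrightarrow>
    norm2 (vN_interp A f xs - vN_interp A f ys) < \<epsilon>"
    by auto
  have "mdist vN (vN_rng f) (vN_interp A f xs) (vN_interp A f ys) < \<epsilon>"
    if xs: "list_all2 (\<lambda>x s. x \<in> comm_ball s) xs (vN_dom f)" and ys: "list_all2 (\<lambda>x s. x \<in> comm_ball s) ys (vN_dom f)"
      and d: "\<forall>i<length (vN_dom f). mdist vN (vN_dom f ! i) (xs ! i) (ys ! i) < \<delta>" for xs ys
    using \<delta>(2) [OF xs ys] d vN_fun_closed [OF f xs] vN_fun_closed [OF f ys]
      list_all2_comm_ball_nth [OF xs] list_all2_comm_ball_nth [OF ys]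
    by (simp add: vN_dist comm_ball_commutant)
  then show "\<exists>\<delta>>0. \<forall>xs ys.
      list_all2 (\<lambda>x s. x \<in> comm_ball s) xs (fun_dom vN_language f) \<longrightarrow> list_all2 (\<lambda>x s. x \<in> comm_ball s) ys (fun_dom vN_language f) \<longrightarrow>
      (\<forall>i<length (fun_dom vN_language f). mdist vN (fun_dom vN_language f ! i) (xs ! i) (ys ! i) < \<delta>) \<longrightarrow>
      mdist vN (fun_rng vN_language f) (interp vN f xs) (interp vN f ys) < \<epsilon>"
    using \<delta>(1) by (intro exI [of _ \<delta>]) (simp add: vN_language_simps)
qed

end


section \<open>Transfer of the values of formulas\<close>

text \<open>
The function symbols acting on formal elements.
\<close>

primrec formal_app :: "vN_fun \<Rightarrow> (complex \<times> group_term) list list \<Rightarrow> (complex \<times> group_term) list" where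
  "formal_app VZero ps = []"
| "formal_app VOne ps = [(1, GOne)]"
| "formal_app (VAdd m n) ps = ps ! 0 @ ps ! 1"
| "formal_app (VMult m n) ps = formal_mult (ps ! 0) (ps ! 1)"
| "formal_app (VScale c n) ps = gscale c (ps ! 0)"
| "formal_app (VAdj n) ps = formal_adj (ps ! 0)"
| "formal_app (VIncl m n) ps = ps ! 0"

text \<open>
The value of a term when the variables are assigned formal elements.
\<close>

fun formal_term :: "(nat \<times> nat \<Rightarrow> (complex \<times> group_term) list) \<Rightarrow> (nat, vN_fun) mterm \<Rightarrow> (complex \<times> group_term) list" where
  "formal_term e (MVar s i) = e (s, i)"
| "formal_term e (MApp f ts) = formal_app f (map (formal_term e) ts)"

lemma formal_vars_formal_app:
  assumes "length ps = length (vN_dom f)" "\<And>p. p \<in> set ps \<Longrightarrow> formal_vars p \<subseteq> X"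
  shows "formal_vars (formal_app f ps) \<subseteq> X"
proof -
  have nth: "formal_vars (ps ! i) \<subseteq> X" if "i < length (vN_dom f)" for i
    using assms that by (metis nth_mem)
  show ?thesis
    using nth [of 0] nth [of 1] formal_vars_formal_mult [of "ps ! 0" "ps ! 1"] by (cases f) auto
qed

lemma (in group) vN_interp_formal_app:
  assumes as: "as \<in> lists A" and len: "length ps = length (vN_dom f)"
    and ps: "\<And>p. p \<in> set ps \<Longrightarrow> formal_vars p \<subseteq> {..<length as}"
  shows "vN_interp A f (map (formal_val G as) ps) = formal_val G as (formal_app f ps)"
proof -
  have nth: "formal_vars (ps ! i) \<subseteq> {..<length as}" if "i < length (vN_dom f)" for i
    using len ps that by (metis nth_mem)
  show ?thesis
    using nth [of 0] nth [of 1] len as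
    by (cases f) (simp_all only: vN_interp_simps formal_app.simps vN_dom.simps formal_val_Nil formal_val_one formal_val_append
        formal_val_gscale list.size nth_map formal_val_formal_mult formal_val_formal_adj One_nat_def less_Suc_eq add_0 add_Suc zero_less_Suc simp_thms)
qed

lemma (in group) mterm_val_formal_term:
  assumes as: "as \<in> lists A" and e: "\<And>x. formal_vars (e x) \<subseteq> {..<length as}"
  shows "wf_mterm vN_language t \<Longrightarrow> mterm_val vN (\<lambda>x. formal_val G as (e x)) t = formal_val G as (formal_term e t) \<and>
    formal_vars (formal_term e t) \<subseteq> {..<length as}"
proof (induction t)
  case (MVar s i)
  then show ?case using e by simp
next
  case (MApp f ts)
  have len: "length ts = length (vN_dom f)"
    using MApp.prems by (metis length_map vN_language_simps(2) wf_mterm.simps(2))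
  have IH: "mterm_val vN (\<lambda>x. formal_val G as (e x)) t = formal_val G as (formal_term e t)" "formal_vars (formal_term e t) \<subseteq> {..<length as}"
    if "t \<in> set ts" for t
    using MApp that by auto
  have v: "formal_vars p \<subseteq> {..<length as}" if "p \<in> set (map (formal_term e) ts)" for p
    using that IH(2) by auto
  have "map (mterm_val vN (\<lambda>x. formal_val G as (e x))) ts = map (formal_val G as) (map (formal_term e) ts)"
    using IH(1) by simp
  then have "mterm_val vN (\<lambda>x. formal_val G as (e x)) (MApp f ts) = formal_val G as (formal_app f (map (formal_term e) ts))"
    using vN_interp_formal_app [OF as _ v, where f = f] len by (simp only: mterm_val.simps vN_interp length_map)
  moreover have "formal_vars (formal_app f (map (formal_term e) ts)) \<subseteq> {..<length as}"
    by (rule formal_vars_formal_app [OF _ v]) (simp add: len)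
  ultimately show ?case by simp
qed

text \<open>
  A move in the metric structures: an element of a ball of $L(G)$ is approximated in the 2-norm by a
  formal element whose values in both groups lie in the ball.
\<close>

lemma universe_forth:
  assumes "group G" "group H" and as: "as \<in> lists (carrier G)" and bs: "bs \<in> lists (carrier H)"
    and len: "length as = length bs" and bf: "bf_equiv (enat (Suc m)) G as H bs" and m: "m > 0"
    and x: "x \<in> universe (group_vN_structure G) s" and s: "s > 0" and \<delta>: "\<delta> > 0"
  obtains cs ds q where "cs \<in> lists (carrier G)" "ds \<in> lists (carrier H)" "length cs = length ds"
    "bf_equiv (enat m) G (as @ cs) H (bs @ ds)" "formal_vars q \<subseteq> {..<length (as @ cs)}"
    "group.norm2 G (formal_val G (as @ cs) q - x) < \<delta>"
    "formal_val G (as @ cs) q \<in> universe (group_vN_structure G) s"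
    "formal_val H (bs @ ds) q \<in> universe (group_vN_structure H) s"
proof -
  interpret G: group G by fact
  interpret H: group H by fact
  have xC: "x \<in> G.commutant" "op_le (carrier G) x (real s)"
    using x G.universe_comm_ball [of s] by (auto simp: G.comm_ball_def)
  obtain p where p: "G.supported p" "op_le (carrier G) (gcomb G p) (real s)" "G.norm2 (gcomb G p - x) < \<delta>"
    using G.Kaplansky_density [OF xC _ \<delta>] s by auto
  have cs: "map snd p \<in> lists (carrier G)"
    using p(1) by (auto simp: G.supported_def)
  have "enat m < enat (Suc m)" by simp
  then obtain ds where ds: "ds \<in> lists (carrier H)" "length ds = length (map snd p)"
    "bf_equiv (enat m) G (as @ map snd p) H (bs @ ds)"
    by (rule bf_equiv_forth [OF bf _ cs])
  let ?q = "formal_of (length as) p" and ?as = "as @ map snd p" and ?bs = "bs @ ds"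
  have l: "?as \<in> lists (carrier G)" "?bs \<in> lists (carrier H)" "length ?as = length ?bs"
    using as bs cs ds len by auto
  have q: "formal_vars ?q \<subseteq> {..<length ?as}"
    using formal_vars_formal_of [of "length as" p] by simp
  have le: "op_le (carrier G) (formal_val G ?as ?q) (real s)"
    using p(2) by (simp only: formal_val_formal_of)
  have "enat 0 < enat m"
    using m by simp
  then have "op_le (carrier H) (formal_val H ?bs ?q) (real s)"
    by (rule op_le_formal_val_transfer [OF assms(1,2) l ds(3) _ q le]) simp
  moreover have "formal_val H ?bs ?q \<in> group_vN_algebra H"
    unfolding formal_val_def using q l by (intro H.gcomb_in_vN H.supported_formal_val) auto
  ultimately have "formal_val H ?bs ?q \<in> universe (group_vN_structure H) s"
    by (simp add: H.vN_universe)
  moreover have "formal_val G ?as ?q \<in> universe (group_vN_structure G) s"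
    using G.gcomb_in_universe [OF p(1,2)] by (simp only: formal_val_formal_of)
  moreover have "G.norm2 (formal_val G ?as ?q - x) < \<delta>"
    using p(3) by (simp only: formal_val_formal_of)
  ultimately show ?thesis
    using that [OF cs ds(1) ds(2) [symmetric] ds(3) q] by blast
qed

text \<open>
  One direction of the quantifier step. The hypothesis \<open>step\<close> says that \<open>\<phi>\<close> has equal values when
  the quantified variable is assigned a formal element over corresponding tuples.
\<close>

lemma quantifier_approx:
  assumes "group G" "group H" and as: "as \<in> lists (carrier G)" and bs: "bs \<in> lists (carrier H)"
    and len: "length as = length bs" and bf: "bf_equiv (enat (Suc m)) G as H bs" and m: "m > 0"
    and \<phi>: "wf_mformula vN_language \<phi>" and s: "s > 0"
    and v: "\<And>s i. s > 0 \<Longrightarrow> v (s, i) \<in> universe (group_vN_structure G) s"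
    and step: "\<And>cs ds q. cs \<in> lists (carrier G) \<Longrightarrow> ds \<in> lists (carrier H) \<Longrightarrow> length cs = length ds \<Longrightarrow>
      bf_equiv (enat m) G (as @ cs) H (bs @ ds) \<Longrightarrow> formal_vars q \<subseteq> {..<length (as @ cs)} \<Longrightarrow>
      formal_val G (as @ cs) q \<in> universe (group_vN_structure G) s \<Longrightarrow>
      formal_val H (bs @ ds) q \<in> universe (group_vN_structure H) s \<Longrightarrow>
      mformula_val (group_vN_structure G) (v((s, i) := formal_val G (as @ cs) q)) \<phi> =
      mformula_val (group_vN_structure H) (w((s, i) := formal_val H (bs @ ds) q)) \<phi>"
    and x: "x \<in> universe (group_vN_structure G) s" and \<epsilon>: "\<epsilon> > 0"
  obtains y where "y \<in> universe (group_vN_structure H) s"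
    "\<bar>mformula_val (group_vN_structure G) (v((s, i) := x)) \<phi> -
      mformula_val (group_vN_structure H) (w((s, i) := y)) \<phi>\<bar> < \<epsilon>"
proof -
  interpret G: group G by fact
  interpret H: group H by fact
  interpret E: uniform_envelope vN_language "group_vN_structure G" G.comm_ball
    by (rule G.vN_envelope)
  have sort: "s \<in> sorts vN_language"
    using s by (simp add: vN_language_simps)
  have av: "E.asg v"
    unfolding E.asg_def vN_language_simps by (intro ballI allI subsetD [OF G.universe_comm_ball] v) (simp add: vN_language_simps)
  obtain \<delta> where \<delta>: "\<delta> > 0" "\<And>v w. E.asg v \<Longrightarrow> E.asg w \<Longrightarrow> E.close (mformula_free \<phi>) \<delta> v w \<Longrightarrow>
     \<bar>mformula_val (group_vN_structure G) v \<phi> - mformula_val (group_vN_structure G) w \<phi>\<bar> < \<epsilon>"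
    using E.formula_uniform [OF \<phi> \<epsilon>] by blast
  obtain cs ds q where q: "cs \<in> lists (carrier G)" "ds \<in> lists (carrier H)" "length cs = length ds"
    "bf_equiv (enat m) G (as @ cs) H (bs @ ds)" "formal_vars q \<subseteq> {..<length (as @ cs)}"
    "G.norm2 (formal_val G (as @ cs) q - x) < \<delta>"
    "formal_val G (as @ cs) q \<in> universe (group_vN_structure G) s"
    "formal_val H (bs @ ds) q \<in> universe (group_vN_structure H) s"
    by (rule universe_forth [OF assms(1-7) x s \<delta>(1)])
  let ?x = "formal_val G (as @ cs) q"
  have C: "x \<in> G.commutant" "?x \<in> G.commutant"
    using x q(7) G.universe_comm_ball G.comm_ball_commutant by blast+
  have "E.close (mformula_free \<phi>) \<delta> (v((s, i) := x)) (v((s, i) := ?x))"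
    unfolding E.close_def
  proof
    fix z assume z: "z \<in> mformula_free \<phi>"
    show "mdist (group_vN_structure G) (fst z) ((v((s, i) := x)) z) ((v((s, i) := ?x)) z) < \<delta>"
    proof (cases "z = (s, i)")
      case True
      then show ?thesis
        using q(6) G.vN_dist [OF C] G.norm2_minus_commute [of x ?x] by simp
    next
      case False
      have sz: "fst z \<in> sorts vN_language"
        by (rule wf_mformula_free [OF \<phi> z])
      then have "v z \<in> G.comm_ball (fst z)"
        using av unfolding E.asg_def by (metis prod.collapse)
      then show ?thesis
        using E.dist_refl [OF sz] False \<delta>(1) by simp
    qed
  qed
  then have "\<bar>mformula_val (group_vN_structure G) (v((s, i) := x)) \<phi> -
      mformula_val (group_vN_structure G) (v((s, i) := ?x)) \<phi>\<bar> < \<epsilon>"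
    by (intro \<delta>(2) E.asg_upd av sort x q(7))
  then show ?thesis
    using that [OF q(8)] step [OF q(1-5,7,8)] by simp
qed

lemma cSup_le_approx:
  fixes f :: "'x \<Rightarrow> real" and g :: "'y \<Rightarrow> real"
  assumes "X \<noteq> {}" "bdd_above (g ` Y)" and ap: "\<And>x \<epsilon>. x \<in> X \<Longrightarrow> \<epsilon> > 0 \<Longrightarrow> \<exists>y\<in>Y. \<bar>f x - g y\<bar> < \<epsilon>"
  shows "(SUP x\<in>X. f x) \<le> (SUP y\<in>Y. g y)"
proof (rule cSUP_least [OF assms(1)], rule field_le_epsilon)
  fix x and \<epsilon> :: real assume "x \<in> X" "\<epsilon> > 0"
  then obtain y where y: "y \<in> Y" "\<bar>f x - g y\<bar> < \<epsilon>"
    using ap by blast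
  then show "f x \<le> (SUP y\<in>Y. g y) + \<epsilon>"
    using cSUP_upper [OF y(1) assms(2)] by linarith
qed

lemma cInf_ge_approx:
  fixes f :: "'x \<Rightarrow> real" and g :: "'y \<Rightarrow> real"
  assumes "X \<noteq> {}" "bdd_below (g ` Y)" and ap: "\<And>x \<epsilon>. x \<in> X \<Longrightarrow> \<epsilon> > 0 \<Longrightarrow> \<exists>y\<in>Y. \<bar>f x - g y\<bar> < \<epsilon>"
  shows "(INF y\<in>Y. g y) \<le> (INF x\<in>X. f x)"
proof (rule cINF_greatest [OF assms(1)], rule field_le_epsilon)
  fix x and \<epsilon> :: real assume "x \<in> X" "\<epsilon> > 0"
  then obtain y where y: "y \<in> Y" "\<bar>f x - g y\<bar> < \<epsilon>"
    using ap by blast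
  then show "(INF y\<in>Y. g y) \<le> f x + \<epsilon>"
    using cINF_lower [OF assms(2) y(1)] by linarith
qed

lemma quantifier_transfer:
  assumes "group G" "group H" and as: "as \<in> lists (carrier G)" and bs: "bs \<in> lists (carrier H)"
    and len: "length as = length bs" and bf: "bf_equiv (enat (Suc m)) G as H bs" and m: "m > 0"
    and \<phi>: "wf_mformula vN_language \<phi>" and s: "s > 0"
    and e: "\<And>x. formal_vars (e x) \<subseteq> {..<length as}"
    and uG: "\<And>s i. s > 0 \<Longrightarrow> formal_val G as (e (s, i)) \<in> universe (group_vN_structure G) s"
    and uH: "\<And>s i. s > 0 \<Longrightarrow> formal_val H bs (e (s, i)) \<in> universe (group_vN_structure H) s"
    and IH: "\<And>as bs e. bf_equiv (enat m) G as H bs \<Longrightarrow>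
      as \<in> lists (carrier G) \<Longrightarrow> bs \<in> lists (carrier H) \<Longrightarrow> length as = length bs \<Longrightarrow>
      (\<And>x. formal_vars (e x) \<subseteq> {..<length as}) \<Longrightarrow>
      (\<And>s i. s > 0 \<Longrightarrow> formal_val G as (e (s, i)) \<in> universe (group_vN_structure G) s) \<Longrightarrow>
      (\<And>s i. s > 0 \<Longrightarrow> formal_val H bs (e (s, i)) \<in> universe (group_vN_structure H) s) \<Longrightarrow>
      mformula_val (group_vN_structure G) (\<lambda>x. formal_val G as (e x)) \<phi> =
      mformula_val (group_vN_structure H) (\<lambda>x. formal_val H bs (e x)) \<phi>"
  shows "mformula_val (group_vN_structure G) (\<lambda>x. formal_val G as (e x)) (MSup s i \<phi>) =
      mformula_val (group_vN_structure H) (\<lambda>x. formal_val H bs (e x)) (MSup s i \<phi>)" (is "?sup")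
    and "mformula_val (group_vN_structure G) (\<lambda>x. formal_val G as (e x)) (MInf s i \<phi>) =
      mformula_val (group_vN_structure H) (\<lambda>x. formal_val H bs (e x)) (MInf s i \<phi>)" (is "?inf")
proof -
  define v where "v = (\<lambda>x. formal_val G as (e x))"
  define w where "w = (\<lambda>x. formal_val H bs (e x))"
  have v: "v (s, i) \<in> universe (group_vN_structure G) s" if "s > 0" for s i
    unfolding v_def using uG that .
  have w: "w (s, i) \<in> universe (group_vN_structure H) s" if "s > 0" for s i
    unfolding w_def using uH that .
  have e': "formal_vars (e x) \<subseteq> {..<length bs}" for x
    using e len by simp
  have step: "mformula_val (group_vN_structure G) (v((s, i) := formal_val G (as @ cs) q)) \<phi> =
      mformula_val (group_vN_structure H) (w((s, i) := formal_val H (bs @ ds) q)) \<phi>"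
    if cs: "cs \<in> lists (carrier G)" and ds: "ds \<in> lists (carrier H)" and l: "length cs = length ds"
      and bf': "bf_equiv (enat m) G (as @ cs) H (bs @ ds)" and q: "formal_vars q \<subseteq> {..<length (as @ cs)}"
      and qG: "formal_val G (as @ cs) q \<in> universe (group_vN_structure G) s"
      and qH: "formal_val H (bs @ ds) q \<in> universe (group_vN_structure H) s" for cs ds q
  proof -
    let ?e = "e((s, i) := q)"
    have vG: "v((s, i) := formal_val G (as @ cs) q) = (\<lambda>x. formal_val G (as @ cs) (?e x))"
      by (rule ext) (simp add: v_def formal_val_append_tuple [OF e])
    have vH: "w((s, i) := formal_val H (bs @ ds) q) = (\<lambda>x. formal_val H (bs @ ds) (?e x))"
      by (rule ext) (simp add: w_def formal_val_append_tuple [OF e'])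
    have l1: "as @ cs \<in> lists (carrier G)" and l2: "bs @ ds \<in> lists (carrier H)"
      and l3: "length (as @ cs) = length (bs @ ds)"
      using as bs cs ds len l by auto
    have ve: "formal_vars (?e x) \<subseteq> {..<length (as @ cs)}" for x
      using e [of x] q by auto
    have uG': "formal_val G (as @ cs) (?e (s', j)) \<in> universe (group_vN_structure G) s'" if "s' > 0" for s' j
      using uG [OF that, of j] qG by (simp add: formal_val_append_tuple [OF e])
    have uH': "formal_val H (bs @ ds) (?e (s', j)) \<in> universe (group_vN_structure H) s'" if "s' > 0" for s' j
      using uH [OF that, of j] qH by (simp add: formal_val_append_tuple [OF e'])
    show ?thesis
      unfolding vG vH by (rule IH [OF bf' l1 l2 l3 ve uG' uH'])
  qed
  interpret G: group G by fact
  interpret H: group H by fact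
  interpret EG: uniform_envelope vN_language "group_vN_structure G" G.comm_ball
    by (rule G.vN_envelope)
  interpret EH: uniform_envelope vN_language "group_vN_structure H" H.comm_ball
    by (rule H.vN_envelope)
  have sort: "s \<in> sorts vN_language"
    using s by (simp add: vN_language_simps)
  have av: "EG.asg v"
    unfolding EG.asg_def vN_language_simps by (intro ballI allI subsetD [OF G.universe_comm_ball] v) (simp add: vN_language_simps)
  have aw: "EH.asg w"
    unfolding EH.asg_def vN_language_simps by (intro ballI allI subsetD [OF H.universe_comm_ball] w) (simp add: vN_language_simps)
  let ?X = "universe (group_vN_structure G) s" and ?Y = "universe (group_vN_structure H) s"
  let ?f = "\<lambda>x. mformula_val (group_vN_structure G) (v((s, i) := x)) \<phi>"
  let ?g = "\<lambda>y. mformula_val (group_vN_structure H) (w((s, i) := y)) \<phi>"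
  have fromG: "\<exists>y\<in>?Y. \<bar>?f x - ?g y\<bar> < \<epsilon>" if x: "x \<in> ?X" and \<epsilon>: "\<epsilon> > 0" for x \<epsilon>
    by (rule quantifier_approx [OF assms(1,2) as bs len bf m \<phi> s v step x \<epsilon>]) blast+
  have step': "mformula_val (group_vN_structure H) (w((s, i) := formal_val H (bs @ ds) q)) \<phi> =
      mformula_val (group_vN_structure G) (v((s, i) := formal_val G (as @ cs) q)) \<phi>"
    if "ds \<in> lists (carrier H)" "cs \<in> lists (carrier G)" "length ds = length cs"
      "bf_equiv (enat m) H (bs @ ds) G (as @ cs)" "formal_vars q \<subseteq> {..<length (bs @ ds)}"
      "formal_val H (bs @ ds) q \<in> ?Y" "formal_val G (as @ cs) q \<in> ?X" for cs ds q
    using that len bf_equiv_sym [of "bs @ ds" "as @ cs"] by (intro step [symmetric]) auto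
  have fromH: "\<exists>x\<in>?X. \<bar>?g y - ?f x\<bar> < \<epsilon>" if y: "y \<in> ?Y" and \<epsilon>: "\<epsilon> > 0" for y \<epsilon>
    by (rule quantifier_approx [OF assms(2,1) bs as len [symmetric] bf_equiv_sym [OF len bf] m \<phi> s w step' y \<epsilon>]) blast+
  note ne = EG.universe_ne [OF sort] EH.universe_ne [OF sort]
  note bdd = EG.formula_bdd [OF \<phi> av sort, of i] EH.formula_bdd [OF \<phi> aw sort, of i]
  show ?sup
    unfolding mformula_val.simps v_def [symmetric] w_def [symmetric]
    by (rule order_antisym [OF cSup_le_approx [OF ne(1) bdd(3) fromG] cSup_le_approx [OF ne(2) bdd(1) fromH]])
  show ?inf
    unfolding mformula_val.simps v_def [symmetric] w_def [symmetric]
    by (rule order_antisym [OF cInf_ge_approx [OF ne(2) bdd(2) fromH] cInf_ge_approx [OF ne(1) bdd(4) fromG]])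
qed

text \<open>
  A bound for the number of moves that a formula needs. The sum over the arguments of a connective
  is at least their maximum, which does no harm because arbitrarily many moves are available.
\<close>

fun quantifier_rank :: "('s, 'f) mformula \<Rightarrow> nat" where
  "quantifier_rank (MDist s t t') = 0"
| "quantifier_rank (MConn u \<phi>s) = sum_list (map quantifier_rank \<phi>s)"
| "quantifier_rank (MSup s i \<phi>) = Suc (quantifier_rank \<phi>)"
| "quantifier_rank (MInf s i \<phi>) = Suc (quantifier_rank \<phi>)"

text \<open>
  The induction asks for one move more than the rank, because the operator norms of the elements
  chosen last have to be transferred.
\<close>

lemma formula_transfer:
  assumes G: "group G" and H: "group H"
  shows "wf_mformula vN_language \<phi> \<Longrightarrow> quantifier_rank \<phi> < n \<Longrightarrow> bf_equiv (enat n) G as H bs \<Longrightarrow>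
    as \<in> lists (carrier G) \<Longrightarrow> bs \<in> lists (carrier H) \<Longrightarrow> length as = length bs \<Longrightarrow>
    (\<And>x. formal_vars (e x) \<subseteq> {..<length as}) \<Longrightarrow>
    (\<And>s i. s > 0 \<Longrightarrow> formal_val G as (e (s, i)) \<in> universe (group_vN_structure G) s) \<Longrightarrow>
    (\<And>s i. s > 0 \<Longrightarrow> formal_val H bs (e (s, i)) \<in> universe (group_vN_structure H) s) \<Longrightarrow>
    mformula_val (group_vN_structure G) (\<lambda>x. formal_val G as (e x)) \<phi> =
    mformula_val (group_vN_structure H) (\<lambda>x. formal_val H bs (e x)) \<phi>"
proof (induction \<phi> arbitrary: n as bs e)
  case (MDist s t t')
  interpret G: group G by fact
  interpret H: group H by fact
  have t: "wf_mterm vN_language t" "wf_mterm vN_language t'"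
    using MDist.prems(1) by auto
  note as = MDist.prems(4) and bs = MDist.prems(5) and len = MDist.prems(6)
  have e: "formal_vars (e x) \<subseteq> {..<length bs}" for x
    using MDist.prems(7) len by simp
  note tG = G.mterm_val_formal_term [OF as MDist.prems(7) t(1)] G.mterm_val_formal_term [OF as MDist.prems(7) t(2)]
  note tH = H.mterm_val_formal_term [OF bs e t(1)] H.mterm_val_formal_term [OF bs e t(2)]
  let ?d = "formal_term e t @ gscale (-1) (formal_term e t')"
  have d: "formal_vars ?d \<subseteq> {..<length as}"
    using tG by simp
  have "mformula_val (group_vN_structure G) (\<lambda>x. formal_val G as (e x)) (MDist s t t') = G.norm2 (formal_val G as ?d)"
    using tG by (simp add: G.vN_dist G.formal_val_commutant [OF as] G.formal_val_append G.formal_val_gscale operator_diff_eq)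
  also have "\<dots> = H.norm2 (formal_val H bs ?d)"
    by (rule norm2_formal_val_transfer [OF G H as bs len bf_equiv_imp_same_qf_type [OF MDist.prems(3)] d])
  also have "\<dots> = mformula_val (group_vN_structure H) (\<lambda>x. formal_val H bs (e x)) (MDist s t t')"
    using tH by (simp add: H.vN_dist H.formal_val_commutant [OF bs] H.formal_val_append H.formal_val_gscale operator_diff_eq)
  finally show ?case .
next
  case (MConn u \<phi>s)
  have "map (mformula_val (group_vN_structure G) (\<lambda>x. formal_val G as (e x))) \<phi>s =
      map (mformula_val (group_vN_structure H) (\<lambda>x. formal_val H bs (e x))) \<phi>s"
  proof (intro map_cong refl)
    fix \<phi> assume \<phi>: "\<phi> \<in> set \<phi>s"
    then have "quantifier_rank \<phi> \<le> quantifier_rank (MConn u \<phi>s)"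
      by (simp add: member_le_sum_list)
    then have r: "quantifier_rank \<phi> < n"
      using MConn.prems(2) by simp
    have wf: "wf_mformula vN_language \<phi>"
      using MConn.prems(1) \<phi> by simp
    show "mformula_val (group_vN_structure G) (\<lambda>x. formal_val G as (e x)) \<phi> =
        mformula_val (group_vN_structure H) (\<lambda>x. formal_val H bs (e x)) \<phi>"
      by (rule MConn.IH [OF \<phi> wf r MConn.prems(3-9)])
  qed
  then show ?case by (simp only: mformula_val.simps)
next
  case (MSup s i \<phi>)
  obtain m where n: "n = Suc m" and r: "quantifier_rank \<phi> < m"
    using MSup.prems(2) by (cases n) auto
  have \<phi>: "wf_mformula vN_language \<phi>" and s: "s > 0"
    using MSup.prems(1) by (auto simp: vN_language_simps)
  have m: "m > 0"
    using r by simp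
  show ?case
    by (rule quantifier_transfer(1) [OF G H MSup.prems(4-6) MSup.prems(3) [unfolded n] m \<phi> s MSup.prems(7-9)
          MSup.IH [OF \<phi> r]])
next
  case (MInf s i \<phi>)
  obtain m where n: "n = Suc m" and r: "quantifier_rank \<phi> < m"
    using MInf.prems(2) by (cases n) auto
  have \<phi>: "wf_mformula vN_language \<phi>" and s: "s > 0"
    using MInf.prems(1) by (auto simp: vN_language_simps)
  have m: "m > 0"
    using r by simp
  show ?case
    by (rule quantifier_transfer(2) [OF G H MInf.prems(4-6) MInf.prems(3) [unfolded n] m \<phi> s MInf.prems(7-9)
          MInf.IH [OF \<phi> r]])
qed

theorem theorem1p2:
  fixes G :: "('a, 'm) monoid_scheme" and H :: "('b, 'n) monoid_scheme"
  assumes "group G" and "group H"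
    and "bf_omega_equiv G H"
  shows "elementarily_equivalent vN_language (group_vN_structure G) (group_vN_structure H)"
  unfolding elementarily_equivalent_def
proof (intro allI impI)
  interpret G: group G by fact
  interpret H: group H by fact
  fix \<sigma> assume \<sigma>: "msentence vN_language \<sigma>"
  then have wf: "wf_mformula vN_language \<sigma>" and closed: "mformula_free \<sigma> = {}"
    by (auto simp: msentence_def)
  let ?n = "Suc (quantifier_rank \<sigma>)"
  have "bf_equiv (\<infinity>::enat) G [] H []"
    using assms(3) by (simp add: bf_omega_equiv_def)
  then obtain ds where "ds \<in> lists (carrier H)" "length ds = length ([] :: 'a list)"
    "bf_equiv (enat ?n) G ([] @ []) H ([] @ ds)"
    by (rule bf_equiv_forth [of _ _ _ _ _ "enat ?n" "[]"]) auto
  then have bf: "bf_equiv (enat ?n) G [] H []"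
    by simp
  have uG: "formal_val G [] [] \<in> universe (group_vN_structure G) s" for s
    using G.gcomb_in_universe [of "[]" s] by (simp add: formal_val_def op_le_zero)
  have uH: "formal_val H [] [] \<in> universe (group_vN_structure H) s" for s
    using H.gcomb_in_universe [of "[]" s] by (simp add: formal_val_def op_le_zero)
  have "msentence_val (group_vN_structure G) \<sigma> = mformula_val (group_vN_structure G) (\<lambda>x. formal_val G [] []) \<sigma>"
    unfolding msentence_val_def by (rule mformula_val_cong) (simp add: closed)
  also have "\<dots> = mformula_val (group_vN_structure H) (\<lambda>x. formal_val H [] []) \<sigma>"
    by (rule formula_transfer [OF assms(1,2) wf lessI bf, where e = "\<lambda>_. []"]) (simp_all add: uG uH)
  also have "\<dots> = msentence_val (group_vN_structure H) \<sigma>"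
    unfolding msentence_val_def by (rule mformula_val_cong) (simp add: closed)
  finally show "msentence_val (group_vN_structure G) \<sigma> = msentence_val (group_vN_structure H) \<sigma>" .
qed

end
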